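(* Let $G$ be an unmixed bipartite graph on the vertex set $\{x_1,\ldots,x_n\}\cup\{y_1,\ldots,y_n\}$ with $\{x_i,y_i\}\in E(G)$ for all $i$, let $R=K[x_1,\ldots,x_n,y_1,\ldots,y_n]$ with $K$ a field, and let $I(G)\subseteq R$ be the edge ideal of $G$. Let $t(R/I(G))$ denote the last nonzero total Betti number of $R/I(G)$, and let $B_G\subseteq A_G$ be the set of all $q\in A_G$ with $$|q|-|N(q)|-\bigl|\bigwedge\{r : r\in N(q)\}\bigr|=\max_{p\in A_G}\bigl\{|p|-|N(p)|-\bigl|\bigwedge\{r : r\in N(p)\}\bigr|\bigr\}.$$ Then $t(R/I(G))\ge|B_G|$.
   Context: All graphs are finite and have no isolated vertices. A graph is unmixed if all its minimal vertex covers have the same cardinality. An unmixed bipartite graph has bipartition classes of equal size and a perfect matching, so its vertices can be labelled $x_1,\dots,x_n$ and $y_1,\dots,y_n$ (the two classes) with $\{x_i,y_i\}\in E(G)$ for all $i$; every minimal vertex cover then contains exactly one of $x_i,y_i$ for each $i$. The edge ideal $I(G)$ is generated by the products $x_iy_j$ with $\{x_i,y_j\}\in E(G)$. Put $\mathcal{L}_G=\{C\cap\{x_1,\dots,x_n\} : C \text{ is a minimal vertex cover of } G\}$. It is known that $\mathcal{L}_G$ is a sublattice of the Boolean lattice of all subsets of $\{x_1,\dots,x_n\}$, containing $\emptyset$ and $\{x_1,\dots,x_n\}$; thus $\wedge$ is intersection and $\vee$ is union. $N(p)$ denotes the set of lower neighbors of $p$ in $\mathcal{L}_G$, i.e. the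 elements of $\mathcal{L}_G$ covered by $p$. For $N(p)=\emptyset$ the meet $\bigwedge\{r:r\in N(p)\}$ is taken to be $p$. $|\cdot|$ denotes cardinality of a set. $A_G$ is the set of all $p\in\mathcal{L}_G$ such that the interval $[\bigwedge\{r:r\in N(p)\},p]$ is a maximal Boolean lattice in $\mathcal{L}_G$, i.e. maximal with respect to inclusion among all intervals of $\mathcal{L}_G$ that are isomorphic to a Boolean lattice. The last nonzero total Betti number of an $R$-module $M$ is $\beta_r(M)=\dim_K\operatorname{Tor}_r^R(M,K)$ for $r$ the projective dimension of $M$. *)

theory Defs
  imports
    "HOL-Library.Poly_Mapping"
    "HOL-Algebra.Ideal"
    "Jordan_Normal_Form.VS_Connect"
    "Jordan_Normal_Form.Matrix_Kernel"
begin

section \<open>Graphs\<close>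

text \<open>A graph is given by its vertex set \<open>V\<close> and its set \<open>E\<close> of two-element edges.\<close>

definition simple_graph :: "'v set \<Rightarrow> 'v set set \<Rightarrow> bool" where
  "simple_graph V E \<longleftrightarrow> finite V \<and> (\<forall>e\<in>E. e \<subseteq> V \<and> card e = 2)"

definition no_isolated_vertices :: "'v set \<Rightarrow> 'v set set \<Rightarrow> bool" where
  "no_isolated_vertices V E \<longleftrightarrow> (\<forall>v\<in>V. \<exists>e\<in>E. v \<in> e)"

definition is_bipartition :: "'v set \<Rightarrow> 'v set set \<Rightarrow> 'v set \<Rightarrow> 'v set \<Rightarrow> bool" where
  "is_bipartition V E A B \<longleftrightarrow>
     A \<union> B = V \<and> A \<inter> B = {} \<and> (\<forall>e\<in>E. \<exists>a\<in>A. \<exists>b\<in>B. e = {a, b})"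

definition vertex_cover :: "'v set \<Rightarrow> 'v set set \<Rightarrow> 'v set \<Rightarrow> bool" where
  "vertex_cover V E C \<longleftrightarrow> C \<subseteq> V \<and> (\<forall>e\<in>E. e \<inter> C \<noteq> {})"

definition minimal_vertex_cover :: "'v set \<Rightarrow> 'v set set \<Rightarrow> 'v set \<Rightarrow> bool" where
  "minimal_vertex_cover V E C \<longleftrightarrow>
     vertex_cover V E C \<and> (\<forall>D. D \<subset> C \<longrightarrow> \<not> vertex_cover V E D)"

definition unmixed :: "'v set \<Rightarrow> 'v set set \<Rightarrow> bool" where
  "unmixed V E \<longleftrightarrow>
     (\<forall>C D. minimal_vertex_cover V E C \<longrightarrow> minimal_vertex_cover V E D \<longrightarrow> card C = card D)"

text \<open>The labelled vertices \<open>x\<^sub>i\<close> and \<open>y\<^sub>i\<close>; the index set \<open>{1,\<dots>,n}\<close> is rendered as a finite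
  type \<open>'n\<close>, so that \<open>n = CARD('n)\<close>.\<close>

datatype 'n vertex = X 'n | Y 'n

instance vertex :: (finite) finite
proof
  have "(UNIV :: 'a vertex set) = range X \<union> range Y"
    by (metis UNIV_eq_I UnCI rangeI vertex.exhaust)
  moreover have "finite (range (X :: 'a \<Rightarrow> _) \<union> range Y)"
    by simp
  ultimately show "finite (UNIV :: 'a vertex set)"
    by metis
qed


section \<open>The lattice of minimal vertex covers\<close>

definition cover_lattice :: "'n vertex set set \<Rightarrow> 'n vertex set set" where
  "cover_lattice E = {C \<inter> range X | C. minimal_vertex_cover UNIV E C}"

text \<open>In what follows \<open>L\<close> is a family of sets ordered by inclusion.\<close>

definition lower_neighbors :: "'a set set \<Rightarrow> 'a set \<Rightarrow> 'a set set" where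
  "lower_neighbors L p = {q \<in> L. q \<subset> p \<and> \<not> (\<exists>r\<in>L. q \<subset> r \<and> r \<subset> p)}"

definition meet_lower :: "'a set set \<Rightarrow> 'a set \<Rightarrow> 'a set" where
  "meet_lower L p = (if lower_neighbors L p = {} then p else \<Inter> (lower_neighbors L p))"

definition interval :: "'a set set \<Rightarrow> 'a set \<Rightarrow> 'a set \<Rightarrow> 'a set set" where
  "interval L a b = {r \<in> L. a \<subseteq> r \<and> r \<subseteq> b}"

definition intervals :: "'a set set \<Rightarrow> 'a set set set" where
  "intervals L = {interval L a b | a b. a \<in> L \<and> b \<in> L \<and> a \<subseteq> b}"

text \<open>Isomorphic to the lattice of all subsets of a finite set; an order isomorphism between
  lattices is the same thing as a lattice isomorphism.\<close>

definition boolean_lattice :: "'a set set \<Rightarrow> bool" where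
  "boolean_lattice S \<longleftrightarrow>
     (\<exists>(k::nat) f. bij_betw f S (Pow {..<k}) \<and> (\<forall>a\<in>S. \<forall>b\<in>S. a \<subseteq> b \<longleftrightarrow> f a \<subseteq> f b))"

definition maximal_boolean_interval :: "'a set set \<Rightarrow> 'a set set \<Rightarrow> bool" where
  "maximal_boolean_interval L S \<longleftrightarrow>
     S \<in> intervals L \<and> boolean_lattice S \<and>
     (\<forall>T\<in>intervals L. boolean_lattice T \<and> S \<subseteq> T \<longrightarrow> T = S)"

definition A_set :: "'n vertex set set \<Rightarrow> 'n vertex set set" where
  "A_set E = {p \<in> cover_lattice E.
     maximal_boolean_interval (cover_lattice E)
       (interval (cover_lattice E) (meet_lower (cover_lattice E) p) p)}"

definition score :: "'n vertex set set \<Rightarrow> 'n vertex set \<Rightarrow> int" where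
  "score E p =
     int (card p) - int (card (lower_neighbors (cover_lattice E) p))
       - int (card (meet_lower (cover_lattice E) p))"

definition B_set :: "'n vertex set set \<Rightarrow> 'n vertex set set" where
  "B_set E = {q \<in> A_set E. score E q = Max (score E ` A_set E)}"


section \<open>Polynomial rings and edge ideals\<close>

text \<open>Polynomials over \<open>'k\<close> in the variables indexed by the type \<open>'v\<close>, as finitely supported
  functions from exponent vectors to coefficients.\<close>

type_synonym ('v, 'k) polynomials = "('v \<Rightarrow>\<^sub>0 nat) \<Rightarrow>\<^sub>0 'k"

definition var :: "'v \<Rightarrow> ('v, 'k::comm_ring_1) polynomials" where
  "var v = Poly_Mapping.single (Poly_Mapping.single v 1) 1"

definition edge_ideal :: "'v set set \<Rightarrow> ('v, 'k::field) polynomials set" where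
  "edge_ideal E = Idl\<^bsub>class_ring\<^esub> {var u * var v | u v. {u, v} \<in> E}"


section \<open>Modules and resolutions\<close>

definition regular_module :: "('r::comm_ring_1, 'r) module" where
  "regular_module =
     \<lparr>carrier = UNIV, mult = (*), one = 1, zero = 0, add = (+), smult = (*)\<rparr>"

text \<open>The fields \<open>mult\<close> and \<open>one\<close> of a module record carry no information.\<close>

definition quotient_module :: "('r, 'm) module \<Rightarrow> 'm set \<Rightarrow> ('r, 'm set) module" where
  "quotient_module M N =
     \<lparr>carrier = a_rcosets\<^bsub>M\<^esub> N, mult = undefined, one = undefined, zero = N, add = set_add M,
      smult = (\<lambda>a A. \<Union>v\<in>A. N +>\<^bsub>M\<^esub> (a \<odot>\<^bsub>M\<^esub> v))\<rparr>"

text \<open>Exactness of \<open>\<dots> \<rightarrow> P\<^sub>2 \<rightarrow> P\<^sub>1 \<rightarrow> P\<^sub>0 \<rightarrow> M \<rightarrow> 0\<close>, where \<open>\<delta> i : P\<^bsub>i+1\<^esub> \<rightarrow> P\<^sub>i\<close> and \<open>\<epsilon> : P\<^sub>0 \<rightarrow> M\<close>.\<close>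

definition is_resolution ::
  "(nat \<Rightarrow> ('r::comm_ring_1, 'p) module) \<Rightarrow> (nat \<Rightarrow> 'p \<Rightarrow> 'p) \<Rightarrow> ('p \<Rightarrow> 'm) \<Rightarrow> ('r, 'm) module \<Rightarrow> bool"
where
  "is_resolution P \<delta> \<epsilon> M \<longleftrightarrow>
     (\<forall>i. Module.module class_ring (P i)) \<and>
     (\<forall>i. \<delta> i \<in> LinearCombinations.module_hom class_ring (P (Suc i)) (P i)) \<and>
     \<epsilon> \<in> LinearCombinations.module_hom class_ring (P 0) M \<and>
     \<epsilon> ` carrier (P 0) = carrier M \<and>
     a_kernel (P 0) M \<epsilon> = \<delta> 0 ` carrier (P 1) \<and>
     (\<forall>i. a_kernel (P (Suc i)) (P i) (\<delta> i) = \<delta> (Suc i) ` carrier (P (Suc (Suc i))))"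

text \<open>Finitely generated projective modules: direct summands of some \<open>R\<^sup>m\<close>. Every such module is
  isomorphic to one whose elements are vectors over \<open>R\<close>.\<close>

definition fg_projective :: "('r::comm_ring_1, 'p) module \<Rightarrow> bool" where
  "fg_projective P \<longleftrightarrow>
     Module.module class_ring P \<and>
     (\<exists>m. \<exists>s \<in> LinearCombinations.module_hom class_ring P (module_vec TYPE('r) m).
          \<exists>t \<in> LinearCombinations.module_hom class_ring (module_vec TYPE('r) m) P. \<forall>v\<in>carrier P. t (s v) = v)"

text \<open>The least length of a projective resolution. It suffices to use finitely generated
  projectives, because \<open>M\<close> will be a finitely generated module over a Noetherian ring; over a
  polynomial ring in finitely many variables the minimum exists by Hilbert's syzygy theorem.\<close>

definition projective_dimension :: "('r::comm_ring_1, 'm) module \<Rightarrow> nat" where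
  "projective_dimension M =
     (LEAST r. \<exists>(P :: nat \<Rightarrow> ('r, 'r vec) module) \<delta> \<epsilon>.
        is_resolution P \<delta> \<epsilon> M \<and> (\<forall>i. fg_projective (P i)) \<and>
        (\<forall>i>r. carrier (P i) = {\<zero>\<^bsub>P i\<^esub>}))"

text \<open>A resolution of \<open>M\<close> by the free modules \<open>R\<^bsup>b i\<^esup>\<close>, the differential \<open>R\<^bsup>b (i+1)\<^esup> \<rightarrow> R\<^bsup>b i\<^esup>\<close>
  being given by the matrix \<open>d i\<close>.\<close>

definition free_resolution ::
  "(nat \<Rightarrow> nat) \<Rightarrow> (nat \<Rightarrow> 'r mat) \<Rightarrow> ('r vec \<Rightarrow> 'm) \<Rightarrow> ('r::comm_ring_1, 'm) module \<Rightarrow> bool"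
where
  "free_resolution b d \<epsilon> M \<longleftrightarrow>
     (\<forall>i. d i \<in> carrier_mat (b i) (b (Suc i))) \<and>
     is_resolution (\<lambda>i. module_vec TYPE('r) (b i)) (\<lambda>i v. d i *\<^sub>v v) \<epsilon> M"


section \<open>Tor and Betti numbers\<close>

text \<open>\<open>K\<close> is the \<open>R\<close>-module \<open>R/(variables)\<close>, so \<open>R\<^sup>m \<otimes>\<^sub>R K = K\<^sup>m\<close>, and tensoring a matrix over \<open>R\<close>
  with \<open>K\<close> replaces every entry by its constant coefficient.\<close>

definition tensor_K ::
  "('v, 'k::field) polynomials mat \<Rightarrow> 'k mat" where
  "tensor_K A = map_mat (\<lambda>p. Poly_Mapping.lookup p 0) A"

fun cycles_K :: "(nat \<Rightarrow> nat) \<Rightarrow> (nat \<Rightarrow> ('v, 'k::field) polynomials mat) \<Rightarrow> nat \<Rightarrow> 'k vec set" where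
  "cycles_K b d 0 = carrier_vec (b 0)"
| "cycles_K b d (Suc i) = mat_kernel (tensor_K (d i))"

definition boundaries_K ::
  "(nat \<Rightarrow> nat) \<Rightarrow> (nat \<Rightarrow> ('v, 'k::field) polynomials mat) \<Rightarrow> nat \<Rightarrow> 'k vec set" where
  "boundaries_K b d i = (\<lambda>v. tensor_K (d i) *\<^sub>v v) ` carrier_vec (b (Suc i))"

definition homology_K ::
  "(nat \<Rightarrow> nat) \<Rightarrow> (nat \<Rightarrow> ('v, 'k::field) polynomials mat) \<Rightarrow> nat \<Rightarrow> ('k, 'k vec set) module" where
  "homology_K b d i =
     quotient_module ((module_vec TYPE('k) (b i))\<lparr>carrier := cycles_K b d i\<rparr>) (boundaries_K b d i)"

text \<open>\<open>Tor\<^sub>i\<^sup>R(M, K)\<close>, computed from a chosen resolution of \<open>M\<close> by free modules of finite rank. Up to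
  isomorphism it does not depend on the choice.\<close>

definition Tor_K ::
  "(('v, 'k::field) polynomials, 'm) module \<Rightarrow> nat \<Rightarrow> ('k, 'k vec set) module" where
  "Tor_K M i = (let (b, d) = (SOME (b, d). \<exists>\<epsilon>. free_resolution b d \<epsilon> M) in homology_K b d i)"

definition betti :: "(('v, 'k::field) polynomials, 'm) module \<Rightarrow> nat \<Rightarrow> nat" where
  "betti M i = vectorspace.dim class_ring (Tor_K M i)"

definition last_betti :: "(('v, 'k::field) polynomials, 'm) module \<Rightarrow> nat" where
  "last_betti M = betti M (projective_dimension M)"

end

(*
  Put i <= j iff {x_i, y_j} is an edge. Unmixedness makes this a preorder, the lattice L_G is its
  lattice of down-sets, and p in A_G corresponds to the maximal antichain of classes of maximal
  elements of p. The exponent |p| - |N(p)| - |meet N(p)| becomes the excess of the antichain, the sum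
  of (size of class - 1), so B_G is the set of maximal antichains of largest excess mu.

  A multigraded free resolution of R/I(G) is built by splitting off a minimal class, using the exact
  sequences 0 -> R/(I : x) -> R/I -> R/(I + x) -> 0. It has length n + mu, and every p in B_G
  contributes a generator in homological degree n + mu whose multidegree no generator of degree
  n + mu - 1 shares, so that its column in the last differential vanishes modulo the variables.
  Comparison with an arbitrary projective resolution then shows that n + mu is the projective
  dimension and that these generators stay independent in Tor_{n+mu}(R/I(G), K).
*)
theory Submission
  imports Defs
begin

section \<open>Finite preorders\<close>

text \<open>The iterated mapping cones need not be minimal, so Betti numbers cannot be read off from
  them. A lower bound in the top degree only requires enough columns of the last differential to
  vanish modulo the variables, and this has to be checked against all generators one degree lower.
  Two data are kept per generator for that purpose: the mark \<open>gm\<close>, recording as an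
  antichain the variables at which the colon branch was taken, and the Koszul part
  \<open>gs\<close>, whose size is the homological degree. A colon by \<open>X v\<close> removes the
  pairs above \<open>v\<close> and adjoins their \<open>Y\<close>-variables together with at most
  \<open>card (cl v) - 1\<close> variables of the class of \<open>v\<close>; this surplus is the
  origin of the excess. A generator that could cancel a top one for the antichain \<open>A\<close>
  would have a mark with \<open>card A + 1\<close> elements, and comparing the mark with
  \<open>A\<close> produces two comparable elements of the mark. Since \<open>Tor_K\<close> uses an
  unspecified free resolution and the projective dimension quantifies over all projective ones, the
  constructed complex is related to both by homotopies. All exactness is proved by linear algebra
  over \<open>K\<close> in squarefree degrees; polynomials enter only when the complex is
  translated.\<close>

locale finite_preorder =
  fixes le :: "'n::finite \<Rightarrow> 'n \<Rightarrow> bool"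
  assumes le_refl: "le i i"
    and le_trans: "le i j \<Longrightarrow> le j k \<Longrightarrow> le i k"
begin

definition cl :: "'n \<Rightarrow> 'n set" where
  "cl i = {j. le i j \<and> le j i}"

definition downset :: "'n set \<Rightarrow> bool" where
  "downset q \<longleftrightarrow> (\<forall>j\<in>q. \<forall>i. le i j \<longrightarrow> i \<in> q)"

definition antichain :: "'n set \<Rightarrow> bool" where
  "antichain D \<longleftrightarrow> (\<forall>i\<in>D. \<forall>j\<in>D. le i j \<longrightarrow> i = j)"

definition excess :: "'n set \<Rightarrow> nat" where
  "excess D = (\<Sum>i\<in>D. card (cl i) - 1)"

definition maxs :: "'n set \<Rightarrow> 'n set" where
  "maxs q = {i \<in> q. \<forall>j\<in>q. le i j \<longrightarrow> le j i}"

lemma cl_self [simp]: "i \<in> cl i"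
  by (simp add: cl_def le_refl)

lemma cl_eq: "j \<in> cl i \<Longrightarrow> cl j = cl i"
  by (auto simp: cl_def intro: le_trans)

lemma cl_card_pos: "card (cl i) > 0"
  by (metis card_gt_0_iff cl_self empty_iff finite)

lemma downset_cl: "downset q \<Longrightarrow> i \<in> q \<Longrightarrow> cl i \<subseteq> q"
  unfolding downset_def cl_def by blast

text \<open>Among the elements of \<open>S\<close> above \<open>a\<close>, take one with the largest
  principal down-set. Passing to a larger element can only enlarge that set, so equality of sizes
  forces equality of down-sets and hence equivalence.\<close>

lemma ex_maximal:
  assumes "a \<in> S"
  shows "\<exists>c\<in>S. le a c \<and> (\<forall>d\<in>S. le c d \<longrightarrow> le d c)"
proof -
  let ?f = "\<lambda>c. card {x. le x c}"
  obtain c where c: "c \<in> S" "le a c" "\<And>d. d \<in> S \<Longrightarrow> le a d \<Longrightarrow> ?f d \<le> ?f c"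
  proof -
    have "\<forall>c. c \<in> S \<and> le a c \<longrightarrow> ?f c \<le> card (UNIV :: 'n set)"
      by (simp add: card_mono)
    then have "\<exists>c. (c \<in> S \<and> le a c) \<and> (\<forall>d. d \<in> S \<and> le a d \<longrightarrow> ?f d \<le> ?f c)"
      by (intro ex_has_greatest_nat[of _ a _ "card (UNIV :: 'n set) + 1"])
        (simp_all add: assms le_refl less_Suc_eq_le)
    then show thesis using that by (elim exE conjE) simp
  qed
  have "le d c" if d: "d \<in> S" "le c d" for d
  proof -
    have "?f d \<le> ?f c" using c d le_trans by blast
    moreover have "{x. le x c} \<subseteq> {x. le x d}" using d le_trans by blast
    ultimately have "{x. le x c} = {x. le x d}" by (simp add: card_seteq)
    then show ?thesis using le_refl by blast
  qed
  then show ?thesis using c by blast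
qed

lemma maxs_above:
  assumes "a \<in> q" shows "\<exists>c\<in>maxs q. le a c"
  using ex_maximal[OF assms] unfolding maxs_def by blast

lemma maxs_cl: "downset q \<Longrightarrow> c \<in> maxs q \<Longrightarrow> cl c \<subseteq> maxs q"
  unfolding maxs_def cl_def downset_def using le_trans by blast

lemma maxs_le: "c \<in> maxs q \<Longrightarrow> d \<in> q \<Longrightarrow> le c d \<Longrightarrow> le d c"
  unfolding maxs_def by blast

lemma maxs_subset: "maxs q \<subseteq> q"
  unfolding maxs_def by blast

lemma downset_remove_cl:
  assumes "downset q" "c \<in> maxs q" shows "downset (q - cl c)"
  using assms le_trans unfolding downset_def maxs_def cl_def by blast

lemma downset_remove_maxs:
  assumes "downset q" shows "downset (q - maxs q)"
  using assms le_trans unfolding downset_def maxs_def by blast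

section \<open>The lattice of down-sets: lower neighbors and Boolean intervals\<close>

definition latt :: "'n vertex set set" where
  "latt = {X ` q | q. downset q}"

lemma X_image_inject [simp]: "X ` p = X ` q \<longleftrightarrow> p = q"
  by (simp add: inj_image_eq_iff inj_def)

lemma X_image_mono [simp]: "X ` p \<subseteq> X ` q \<longleftrightarrow> p \<subseteq> q"
  by (simp add: inj_image_subset_iff inj_def)

lemma X_image_strict_mono [simp]: "X ` p \<subset> X ` q \<longleftrightarrow> p \<subset> q"
  by (simp add: psubset_eq)

lemma card_X_image [simp]: "card (X ` q) = card q"
  by (simp add: card_image inj_on_def)

lemma X_in_latt [simp]: "X ` q \<in> latt \<longleftrightarrow> downset q"
  unfolding latt_def by simp

lemma latt_cases: "r \<in> latt \<Longrightarrow> (\<And>q. r = X ` q \<Longrightarrow> downset q \<Longrightarrow> thesis) \<Longrightarrow> thesis"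
  unfolding latt_def by blast

text \<open>A down-set properly inside \<open>q\<close> misses some \<open>a\<close>, hence
  everything above \<open>a\<close>, in particular a whole maximal class of \<open>q\<close>. So
  deleting one maximal class gives the largest proper sub-down-sets.\<close>

lemma lower_neighbors_latt:
  assumes q: "downset q"
  shows "lower_neighbors latt (X ` q) = (\<lambda>c. X ` (q - cl c)) ` maxs q"
proof (intro subset_antisym subsetI)
  fix r assume "r \<in> lower_neighbors latt (X ` q)"
  then have r: "r \<in> latt" "r \<subset> X ` q" "\<And>s. s \<in> latt \<Longrightarrow> r \<subset> s \<Longrightarrow> \<not> s \<subset> X ` q"
    unfolding lower_neighbors_def by blast+
  obtain q' where q': "r = X ` q'" "downset q'" using r(1) by (rule latt_cases)
  have sub: "q' \<subset> q" using r(2) q'(1) by simp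
  then obtain a where a: "a \<in> q" "a \<notin> q'" by blast
  obtain c where c: "c \<in> maxs q" "le a c" using maxs_above[OF a(1)] by blast
  have cq: "c \<notin> q'" using q'(2) c(2) a(2) unfolding downset_def by blast
  have "q' \<subseteq> q - cl c"
    using sub cq q'(2) unfolding downset_def cl_def by blast
  moreover have "X ` (q - cl c) \<in> latt" using downset_remove_cl[OF q c(1)] by simp
  moreover have "X ` (q - cl c) \<subset> X ` q"
    unfolding X_image_strict_mono using c(1) maxs_subset cl_self by blast
  ultimately have "q' = q - cl c" using r(3) q'(1) by (metis X_image_strict_mono psubsetI)
  then show "r \<in> (\<lambda>c. X ` (q - cl c)) ` maxs q" using c q' by blast
next
  fix r assume "r \<in> (\<lambda>c. X ` (q - cl c)) ` maxs q"
  then obtain c where c: "c \<in> maxs q" "r = X ` (q - cl c)" by blast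
  have c1: "r \<in> latt" using c downset_remove_cl[OF q c(1)] by simp
  have c2: "r \<subset> X ` q"
    unfolding c(2) X_image_strict_mono using c(1) maxs_subset cl_self by blast
  have c3: "\<not> s \<subset> X ` q" if s: "s \<in> latt" "r \<subset> s" for s
  proof
    assume sq: "s \<subset> X ` q"
    obtain s' where s': "s = X ` s'" "downset s'" using s(1) by (rule latt_cases)
    have a: "q - cl c \<subset> s'" "s' \<subset> q" using sq s s' c(2) X_image_strict_mono by blast+
    then obtain d where "d \<in> s'" "d \<in> cl c" by blast
    then have "cl c \<subseteq> s'" using downset_cl[OF s'(2)] cl_eq by blast
    then show False using a by blast
  qed
  show "r \<in> lower_neighbors latt (X ` q)"
    unfolding lower_neighbors_def using c1 c2 c3 by blast
qed

text \<open>Each lower neighbor omits one maximal class, so their intersection omits all of them.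
  When \<open>q\<close> has no maximal elements, the convention for an empty set of neighbors gives
  the same formula.\<close>

lemma meet_lower_latt:
  assumes q: "downset q"
  shows "meet_lower latt (X ` q) = X ` (q - maxs q)"
proof (cases "maxs q = {}")
  case True
  then show ?thesis using q by (simp add: meet_lower_def lower_neighbors_latt)
next
  case False
  have "(\<Inter>c\<in>maxs q. X ` (q - cl c)) = X ` (q - maxs q)"
  proof (intro subset_antisym subsetI)
    fix x assume x: "x \<in> (\<Inter>c\<in>maxs q. X ` (q - cl c))"
    then obtain i where i: "x = X i" "i \<in> q" using False by blast
    have "i \<notin> maxs q" using x i cl_self by blast
    then show "x \<in> X ` (q - maxs q)" using i by blast
  next
    fix x assume "x \<in> X ` (q - maxs q)"
    then obtain i where i: "x = X i" "i \<in> q" "i \<notin> maxs q" by blast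
    have "i \<notin> cl c" if "c \<in> maxs q" for c using maxs_cl[OF q that] i by blast
    then show "x \<in> (\<Inter>c\<in>maxs q. X ` (q - cl c))" using i by blast
  qed
  then show ?thesis using q False by (simp add: meet_lower_def lower_neighbors_latt)
qed

text \<open>Equivalent maximal elements give the same neighbor; indexing by the class instead of the
  element makes the parametrization injective.\<close>

lemma card_lower_neighbors_latt:
  assumes q: "downset q"
  shows "card (lower_neighbors latt (X ` q)) = card (cl ` maxs q)"
proof -
  have "lower_neighbors latt (X ` q) = (\<lambda>C. X ` (q - C)) ` (cl ` maxs q)"
    unfolding lower_neighbors_latt[OF q] by (simp add: image_image)
  moreover have "inj_on (\<lambda>C. X ` (q - C)) (cl ` maxs q)"
  proof (rule inj_onI)
    fix C C' assume C: "C \<in> cl ` maxs q" "C' \<in> cl ` maxs q" "X ` (q - C) = X ` (q - C')"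
    have "C \<subseteq> q" "C' \<subseteq> q" using C(1,2) maxs_cl[OF q] maxs_subset by blast+
    moreover have "q - C = q - C'" using C(3) by simp
    ultimately show "C = C'" by blast
  qed
  ultimately show ?thesis by (simp add: card_image)
qed

lemma ex_reps:
  "\<exists>D\<subseteq>T. inj_on cl D \<and> cl ` D = cl ` T"
proof -
  have "cl ` T \<subseteq> cl ` T" by simp
  then obtain D where "D \<subseteq> T" "inj_on cl D" "cl ` T = cl ` D"
    unfolding subset_image_inj[of "cl ` T" cl T] by blast
  then show ?thesis by (intro exI[of _ D]) simp
qed

text \<open>\<open>T\<close> is the disjoint union of the classes of the representatives, and each
  class contributes its size minus one. Classes are nonempty, so the truncated subtraction in
  \<open>excess\<close> is exact.\<close>

lemma excess_reps:
  assumes D: "D \<subseteq> T" "inj_on cl D" "cl ` D = cl ` T" and T: "\<And>i. i \<in> T \<Longrightarrow> cl i \<subseteq> T"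
  shows "int (excess D) = int (card T) - int (card (cl ` T))"
proof -
  have "T = (\<Union>i\<in>T. cl i)"
  proof
    show "T \<subseteq> (\<Union>i\<in>T. cl i)" using cl_self by blast
    show "(\<Union>i\<in>T. cl i) \<subseteq> T" using T by (rule UN_least)
  qed
  also have "\<dots> = (\<Union>i\<in>D. cl i)" using D(3) by simp
  finally have TU: "T = (\<Union>i\<in>D. cl i)" .
  have "card (\<Union>i\<in>D. cl i) = (\<Sum>i\<in>D. card (cl i))"
  proof (rule card_UN_disjoint)
    have "i = j" if "i \<in> D" "j \<in> D" "x \<in> cl i" "x \<in> cl j" for i j x
    proof -
      have "cl i = cl j" using cl_eq[OF that(3)] cl_eq[OF that(4)] by (rule trans[OF sym])
      then show ?thesis using inj_onD[OF D(2)] that by blast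
    qed
    then show "\<forall>i\<in>D. \<forall>j\<in>D. i \<noteq> j \<longrightarrow> cl i \<inter> cl j = {}" by blast
  qed auto
  then have "card T = (\<Sum>i\<in>D. card (cl i))" unfolding TU[symmetric] .
  moreover have "card (cl ` T) = card D" using card_image[OF D(2)] unfolding D(3) .
  moreover have "(\<Sum>i\<in>D. card (cl i)) = excess D + card D"
  proof -
    have "(\<Sum>i\<in>D. card (cl i)) = (\<Sum>i\<in>D. (card (cl i) - 1) + 1)"
    proof (rule sum.cong)
      fix i show "card (cl i) = (card (cl i) - 1) + 1" using cl_card_pos[of i] by linarith
    qed simp
    also have "\<dots> = excess D + (\<Sum>i\<in>D. 1)" unfolding excess_def by (rule sum.distrib)
    also have "(\<Sum>i\<in>D. 1) = card D" by simp
    finally show ?thesis .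
  qed
  ultimately show ?thesis by simp
qed

text \<open>By \<open>anti\<close>, \<open>T\<close> is a union of pairwise incomparable classes. A
  down-set between \<open>a\<close> and \<open>a \<union> T\<close> is therefore \<open>a\<close>
  together with an arbitrary selection of these classes, and the isomorphism sends it to the numbers
  of the classes it contains.\<close>

lemma boolean_interval:
  assumes a: "downset a" and T: "downset (a \<union> T)" "a \<inter> T = {}" "\<And>i. i \<in> T \<Longrightarrow> cl i \<subseteq> T"
    and anti: "\<And>i j. i \<in> T \<Longrightarrow> j \<in> T \<Longrightarrow> le i j \<Longrightarrow> le j i"
  shows "boolean_lattice (interval latt (X ` a) (X ` (a \<union> T)))" (is "boolean_lattice ?S")
proof -
  define k where "k = card (cl ` T)"
  obtain g where g: "bij_betw g (cl ` T) {..<k}"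
    unfolding k_def using ex_bij_betw_finite_nat[of "cl ` T"] by (auto simp: atLeast0LessThan)
  have ginj: "inj_on g (cl ` T)" and gim: "g ` cl ` T = {..<k}" using g by (auto simp: bij_betw_def)
  define f where "f r = g ` {C \<in> cl ` T. X ` C \<subseteq> r}" for r :: "'n vertex set"
  have mono: "r \<subseteq> s" if r: "r \<in> ?S" and s: "s \<in> ?S" and fs: "f r \<subseteq> f s" for r s
  proof
    fix x assume x: "x \<in> r"
    obtain r' where r': "r = X ` r'" "downset r'" using r unfolding interval_def by (auto elim: latt_cases)
    then obtain i where i: "x = X i" "i \<in> r'" using x by blast
    have "i \<in> a \<union> T" using r r' i unfolding interval_def by auto
    then show "x \<in> s"
    proof
      assume "i \<in> a" then show ?thesis using s i unfolding interval_def by blast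
    next
      assume iT: "i \<in> T"
      then have "g (cl i) \<in> f r" unfolding f_def using downset_cl[OF r'(2) i(2)] r'(1) by auto
      then have "g (cl i) \<in> f s" using fs by blast
      then obtain C where gC: "g (cl i) = g C" and "C \<in> {C \<in> cl ` T. X ` C \<subseteq> s}"
        unfolding f_def by (rule imageE)
      then have C: "C \<in> cl ` T" "X ` C \<subseteq> s" by blast+
      then have "C = cl i" using inj_onD[OF ginj gC] iT by blast
      then show ?thesis using C(2) i(1) cl_self by blast
    qed
  qed
  have mono2: "f r \<subseteq> f s" if "r \<subseteq> s" for r s using that unfolding f_def by blast
  have "inj_on f ?S"
  proof (rule inj_onI)
    fix r s assume "r \<in> ?S" "s \<in> ?S" "f r = f s"
    then show "r = s" using mono[of r s] mono[of s r] by simp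
  qed
  moreover have "f ` ?S = Pow {..<k}"
  proof
    show "f ` ?S \<subseteq> Pow {..<k}" using gim unfolding f_def by blast
    show "Pow {..<k} \<subseteq> f ` ?S"
    proof
      fix B assume "B \<in> Pow {..<k}"
      then obtain \<C> where C: "\<C> \<subseteq> cl ` T" "B = g ` \<C>" using gim by (metis PowD subset_imageE)
      have CT: "\<Union>\<C> \<subseteq> T" using C(1) T(3) by blast
      have ds: "downset (a \<union> \<Union>\<C>)"
        unfolding downset_def
      proof (intro ballI allI impI)
        fix j i assume j: "j \<in> a \<union> \<Union>\<C>" and ij: "le i j"
        show "i \<in> a \<union> \<Union>\<C>"
        proof (cases "j \<in> a")
          case True then show ?thesis using a ij unfolding downset_def by blast
        next
          case False
          then obtain C where jC: "j \<in> C" "C \<in> \<C>" using j by blast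
          then have Ccl: "C = cl j" using C(1) cl_eq by blast
          have jT: "j \<in> T" using CT jC by blast
          have "i \<in> a \<union> T" using T(1) jT ij unfolding downset_def by blast
          then show ?thesis
          proof
            assume "i \<in> T" then have "i \<in> cl j" using anti[OF _ jT ij] ij unfolding cl_def by blast
            then show ?thesis using jC Ccl by blast
          qed blast
        qed
      qed
      let ?r = "X ` (a \<union> \<Union>\<C>)"
      have "?r \<in> ?S" using ds CT unfolding interval_def by auto
      moreover have "{C \<in> cl ` T. X ` C \<subseteq> ?r} = \<C>"
      proof (intro subset_antisym subsetI)
        fix C assume "C \<in> \<C>" then show "C \<in> {C \<in> cl ` T. X ` C \<subseteq> ?r}" using C(1) by auto
      next
        fix C assume "C \<in> {C \<in> cl ` T. X ` C \<subseteq> ?r}"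
        then obtain i where i: "i \<in> T" "C = cl i" "X ` cl i \<subseteq> ?r" by blast
        then have "i \<in> a \<union> \<Union>\<C>" using cl_self X_image_mono by blast
        then obtain C' where "C' \<in> \<C>" "i \<in> C'" using T(2) i(1) by blast
        moreover have "C' = cl i" using calculation C(1) cl_eq by blast
        ultimately show "C \<in> \<C>" using i(2) by simp
      qed
      ultimately have "?r \<in> ?S" "f ?r = B" using C(2) unfolding f_def by simp_all
      then show "B \<in> f ` ?S" by blast
    qed
  qed
  ultimately have "bij_betw f ?S (Pow {..<k})" by (simp add: bij_betw_def)
  then show ?thesis unfolding boolean_lattice_def using mono mono2 by blast
qed

lemma downset_inter: "downset p \<Longrightarrow> downset q \<Longrightarrow> downset (p \<inter> q)"
  unfolding downset_def by blast

lemma downset_union: "downset p \<Longrightarrow> downset q \<Longrightarrow> downset (p \<union> q)"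
  unfolding downset_def by blast

text \<open>Boolean lattices are complemented. If \<open>i\<close> were strictly below
  \<open>j\<close>, the down-set generated by \<open>i\<close> over \<open>a\<close> would avoid
  \<open>j\<close>, so its complement \<open>s\<close> would contain \<open>j\<close> and then
  \<open>i\<close>, although the two meet only in \<open>a\<close>.\<close>

lemma boolean_interval_antichain:
  assumes a: "downset a" and b: "downset b" and ab: "a \<subseteq> b"
    and B: "boolean_lattice (interval latt (X ` a) (X ` b))" (is "boolean_lattice ?S")
    and ij: "i \<in> b - a" "j \<in> b - a" "le i j"
  shows "le j i"
proof (rule ccontr)
  assume nji: "\<not> le j i"
  obtain k :: nat and f where f: "bij_betw f ?S (Pow {..<k})"
    and fm': "\<forall>r\<in>?S. \<forall>s\<in>?S. r \<subseteq> s \<longleftrightarrow> f r \<subseteq> f s"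
    using B unfolding boolean_lattice_def by (elim exE conjE)
  have fm: "r \<subseteq> s \<longleftrightarrow> f r \<subseteq> f s" if "r \<in> ?S" "s \<in> ?S" for r s
    using bspec[OF bspec[OF fm' that(1)] that(2)] .
  have fS: "f r \<subseteq> {..<k}" if "r \<in> ?S" for r using f that unfolding bij_betw_def by blast
  have memS: "X ` q \<in> ?S \<longleftrightarrow> downset q \<and> a \<subseteq> q \<and> q \<subseteq> b" for q
    unfolding interval_def by auto
  define r where "r = a \<union> {x. le x i}"
  have "downset {x. le x i}" unfolding downset_def using le_trans by blast
  then have rd: "downset r" unfolding r_def using downset_union[OF a] by blast
  have rS: "X ` r \<in> ?S" using rd ab ij b unfolding memS r_def downset_def by blast
  have "f ` ?S = Pow {..<k}" using f unfolding bij_betw_def by (rule conjunct2)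
  then have "{..<k} - f (X ` r) \<in> f ` ?S" by simp
  \<comment> \<open>The complement is taken in \<open>Pow {..<k}\<close> and pulled back along the
    isomorphism; that its join and meet with \<open>r\<close> are \<open>b\<close> and
    \<open>a\<close> is then deduced from order preservation alone.\<close>
  then obtain s0 where s0': "{..<k} - f (X ` r) = f s0" and s0: "s0 \<in> ?S" by (rule imageE)
  note s0 = s0 s0'[symmetric]
  obtain s where s: "s0 = X ` s" "downset s" using s0(1) unfolding interval_def by (auto elim: latt_cases)
  have sS: "X ` s \<in> ?S" using s s0 by simp
  have sab: "a \<subseteq> s" "s \<subseteq> b" using sS unfolding memS by simp_all
  have rab: "a \<subseteq> r" "r \<subseteq> b" using rS unfolding memS by simp_all
  have uS: "X ` (r \<union> s) \<in> ?S" using rd s(2) sab rab downset_union by (simp add: memS le_supI1)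
  have iS: "X ` (r \<inter> s) \<in> ?S" using rd s(2) sab rab downset_inter by (auto simp: memS)
  have "{..<k} \<subseteq> f (X ` (r \<union> s))"
    using fm[OF rS uS] fm[OF sS uS] s0(2) s(1) by auto
  then have "f (X ` b) \<subseteq> f (X ` (r \<union> s))"
    using fS[of "X ` b"] b ab by (auto simp: memS)
  then have 1: "b \<subseteq> r \<union> s" using fm[OF _ uS, of "X ` b"] b ab by (simp add: memS)
  have "f (X ` (r \<inter> s)) \<subseteq> {}"
    using fm[OF iS rS] fm[OF iS sS] s0(2) s(1) by auto
  then have "f (X ` (r \<inter> s)) \<subseteq> f (X ` a)" by blast
  then have 2: "r \<inter> s \<subseteq> a" using fm[OF iS, of "X ` a"] a ab by (simp add: memS)
  have "j \<notin> r" using nji ij unfolding r_def by blast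
  then have "j \<in> s" using 1 ij by blast
  then have "i \<in> s" using s(2) ij unfolding downset_def by blast
  moreover have "i \<in> r" unfolding r_def using le_refl by blast
  ultimately show False using 2 ij by blast
qed

text \<open>The interval below \<open>q\<close> is always Boolean, its atoms corresponding to the
  maximal classes. It can be enlarged exactly when some element outside \<open>q\<close> lies above
  no maximal element of \<open>q\<close>: a minimal such class is incomparable to all maximal
  classes and can be adjoined to them.\<close>

lemma maximal_boolean_iff:
  assumes q: "downset q"
  shows "maximal_boolean_interval latt (interval latt (meet_lower latt (X ` q)) (X ` q))
    \<longleftrightarrow> (\<forall>j. j \<in> q \<or> (\<exists>d\<in>maxs q. le d j))" (is "?M \<longleftrightarrow> ?R")
proof -
  define a where "a = q - maxs q"
  have ad: "downset a" unfolding a_def by (rule downset_remove_maxs[OF q])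
  have aq: "a \<subseteq> q" "a \<union> maxs q = q" "a \<inter> maxs q = {}" unfolding a_def using maxs_subset by auto
  let ?S = "interval latt (X ` a) (X ` q)"
  have S: "interval latt (meet_lower latt (X ` q)) (X ` q) = ?S"
    using meet_lower_latt[OF q] by (simp add: a_def)
  have intI: "interval latt (X ` c) (X ` b) \<in> intervals latt" if "downset c" "downset b" "c \<subseteq> b" for c b
    unfolding intervals_def using that X_in_latt X_image_mono by blast
  have SI: "?S \<in> intervals latt" using intI ad q aq(1) by blast
  have SB: "boolean_lattice ?S"
    using boolean_interval[OF ad, of "maxs q"] aq q maxs_cl[OF q] maxs_le maxs_subset
    by (metis subsetD)
  have memI: "X ` p \<in> interval latt (X ` c) (X ` b) \<longleftrightarrow> downset p \<and> c \<subseteq> p \<and> p \<subseteq> b" for p c b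
    unfolding interval_def by auto
  show ?thesis
  proof
    assume M: ?M
    show ?R
    proof (rule ccontr)
      assume "\<not> ?R"
      then obtain j0 where j0: "j0 \<in> {j. j \<notin> q \<and> \<not> (\<exists>d\<in>maxs q. le d j)}" (is "_ \<in> ?J") by blast
      \<comment> \<open>Applying \<open>ex_maximal\<close> to the reversed order picks a minimal
        obstruction \<open>j\<close>.\<close>
      interpret d: finite_preorder "\<lambda>i j. le j i" by unfold_locales (auto intro: le_refl le_trans)
      obtain j where j: "j \<in> ?J" "\<And>d. d \<in> ?J \<Longrightarrow> le d j \<Longrightarrow> le j d" using d.ex_maximal[OF j0] by blast
      define T where "T = maxs q \<union> cl j"
      \<comment> \<open>By minimality of \<open>j\<close>, an element strictly below it is no
        obstruction, and it cannot lie above a maximal element of \<open>q\<close> because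
        \<open>j\<close> does not. So it is in \<open>q\<close>, and it is not maximal
        there.\<close>
      have below: "i \<in> a" if "le i j" "i \<notin> cl j" for i
      proof -
        have "i \<notin> ?J" using j(2) that unfolding cl_def by blast
        moreover have "\<not> (\<exists>d\<in>maxs q. le d i)" using that(1) j(1) le_trans by blast
        ultimately have "i \<in> q" by blast
        moreover have "i \<notin> maxs q" using that(1) j(1) by blast
        ultimately show ?thesis unfolding a_def by blast
      qed
      have clq: "cl j \<inter> q = {}" using j(1) downset_cl[OF q] cl_eq cl_self by blast
      have dT: "downset (a \<union> T)"
      proof -
        have "downset (q \<union> cl j)" unfolding downset_def
        proof (intro ballI allI impI)
          fix x i assume x: "x \<in> q \<union> cl j" "le i x"
          show "i \<in> q \<union> cl j"
          proof (cases "x \<in> q")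
            case True then show ?thesis using q x unfolding downset_def by blast
          next
            case False
            then have "le i j" using x le_trans unfolding cl_def by blast
            then show ?thesis using below aq by blast
          qed
        qed
        moreover have "a \<union> T = q \<union> cl j" unfolding T_def using aq by blast
        ultimately show ?thesis by simp
      qed
      have aT: "a \<inter> T = {}" using aq clq unfolding T_def by blast
      have Tcl: "cl i \<subseteq> T" if "i \<in> T" for i using that maxs_cl[OF q] cl_eq unfolding T_def by blast
      have Tanti: "le y x" if "x \<in> T" "y \<in> T" "le x y" for x y
      proof -
        have nj: "\<not> le x y" if "x \<in> maxs q" "y \<in> cl j" for x y
          using that j(1) le_trans unfolding cl_def by blast
        have nj2: "\<not> le x y" if "x \<in> cl j" "y \<in> maxs q" for x y
          using that clq q maxs_subset unfolding downset_def by blast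
        have "le y x" if "x \<in> cl j" "y \<in> cl j" for x y using that le_trans unfolding cl_def by blast
        moreover have "le y x" if "x \<in> maxs q" "y \<in> maxs q" "le x y" for x y
          using that maxs_le maxs_subset by blast
        ultimately show ?thesis using that nj nj2 unfolding T_def by blast
      qed
      let ?T = "interval latt (X ` a) (X ` (a \<union> T))"
      have "boolean_lattice ?T" by (rule boolean_interval[OF ad dT aT Tcl Tanti])
      moreover have "?T \<in> intervals latt" using intI ad dT by blast
      moreover have "?S \<subseteq> ?T"
      proof -
        have "X ` q \<subseteq> X ` (a \<union> T)" unfolding X_image_mono T_def using aq by blast
        then show ?thesis unfolding interval_def by blast
      qed
      ultimately have "?T = ?S" using M unfolding S maximal_boolean_interval_def by blast
      moreover have "X ` (a \<union> T) \<in> ?T" using dT by (simp add: memI)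
      ultimately have "a \<union> T \<subseteq> q" by (simp add: memI)
      then show False using j(1) cl_self unfolding T_def by blast
    qed
  next
    assume R: ?R
    have "T = ?S" if T: "T \<in> intervals latt" "boolean_lattice T" "?S \<subseteq> T" for T
    proof -
      obtain a' b' where ab0: "T = interval latt a' b'" "a' \<in> latt" "b' \<in> latt" "a' \<subseteq> b'"
        using T(1) unfolding intervals_def by blast
      obtain c where c: "a' = X ` c" "downset c" using ab0(2) by (rule latt_cases)
      obtain b where b: "b' = X ` b" "downset b" using ab0(3) by (rule latt_cases)
      have cb: "c \<subseteq> b" using ab0(4) b c by simp
      have Teq: "T = interval latt (X ` c) (X ` b)" using ab0 b c by simp
      have "X ` a \<in> T" "X ` q \<in> T" using T(3) ad q aq(1) by (auto simp: memI)
      then have sub: "c \<subseteq> a" "q \<subseteq> b" unfolding Teq memI by blast+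
      have anti: "le j i" if "i \<in> b - c" "j \<in> b - c" "le i j" for i j
        by (rule boolean_interval_antichain[OF c(2) b(2) cb _ that]) (use T(2) Teq in simp)
      \<comment> \<open>In \<open>b - c\<close> comparable elements are equivalent. Every element of
        it is comparable to some maximal element of \<open>q\<close>, by \<open>maxs_above\<close>
        inside \<open>q\<close> and by the assumption outside, hence is itself maximal in
        \<open>q\<close>.\<close>
      have *: "b - c \<subseteq> maxs q"
      proof
        fix j assume j: "j \<in> b - c"
        have mq: "maxs q \<subseteq> b - c" using maxs_subset aq(3) sub by blast
        show "j \<in> maxs q"
        proof (cases "j \<in> q")
          case True
          then obtain d where d: "d \<in> maxs q" "le j d" using maxs_above by blast
          then have "le d j" using anti j mq by blast
          then show ?thesis using d maxs_cl[OF q d(1)] unfolding cl_def by blast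
        next
          case False
          then obtain d where d: "d \<in> maxs q" "le d j" using R by blast
          then have "le j d" using anti j mq by blast
          then show ?thesis using d maxs_cl[OF q d(1)] unfolding cl_def by blast
        qed
      qed
      then have "a \<subseteq> c" using aq sub by blast
      moreover have "b \<subseteq> q" using * maxs_subset sub aq by blast
      ultimately show ?thesis using Teq sub by simp
    qed
    then show ?M unfolding S maximal_boolean_interval_def using SI SB by blast
  qed
qed

section \<open>Down-sets and antichains\<close>

text \<open>Passage from a down-set to an antichain: one representative is chosen from each maximal
  class. The equivalence for \<open>j\<close> lets the criterion for maximal Boolean intervals be
  restated for the representatives.\<close>

lemma ex_reps_maxs:
  assumes q: "downset q"
  obtains D where "antichain D" "D \<subseteq> maxs q" "q = {i. \<exists>d\<in>D. le i d}"
    "\<forall>j. (\<exists>d\<in>maxs q. le d j) \<longleftrightarrow> (\<exists>d\<in>D. le d j)"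
    "int (excess D) = int (card (maxs q)) - int (card (cl ` maxs q))"
proof -
  obtain D where D: "D \<subseteq> maxs q" "inj_on cl D" "cl ` D = cl ` maxs q"
    using ex_reps[of "maxs q"] by (elim exE conjE)
  have rep: "\<exists>d'\<in>D. le d d' \<and> le d' d" if "d \<in> maxs q" for d
  proof -
    have "cl d \<in> cl ` D" using D(3) that by simp
    then obtain d' where d': "cl d = cl d'" "d' \<in> D" by (rule imageE)
    then have "d' \<in> cl d" by simp
    then show ?thesis using d'(2) unfolding cl_def by blast
  qed
  have 1: "antichain D" unfolding antichain_def
  proof (intro ballI impI)
    fix i j assume "i \<in> D" "j \<in> D" "le i j"
    then have "le j i" using maxs_le D(1) maxs_subset by blast
    then have "j \<in> cl i" using \<open>le i j\<close> unfolding cl_def by blast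
    then have "cl i = cl j" by (simp add: cl_eq)
    then show "i = j" using D(2) \<open>i \<in> D\<close> \<open>j \<in> D\<close> by (simp add: inj_on_def)
  qed
  have 2: "q = {i. \<exists>d\<in>D. le i d}"
  proof (intro subset_antisym subsetI)
    fix i assume "i \<in> q"
    then obtain d where "d \<in> maxs q" "le i d" using maxs_above by blast
    then show "i \<in> {i. \<exists>d\<in>D. le i d}" using rep le_trans by blast
  next
    fix i assume "i \<in> {i. \<exists>d\<in>D. le i d}"
    then show "i \<in> q" using D(1) maxs_subset q unfolding downset_def by blast
  qed
  have 3: "\<forall>j. (\<exists>d\<in>maxs q. le d j) \<longleftrightarrow> (\<exists>d\<in>D. le d j)"
    using rep le_trans D(1) by blast
  have 4: "int (excess D) = int (card (maxs q)) - int (card (cl ` maxs q))"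
    by (rule excess_reps[OF D maxs_cl[OF q]])
  show ?thesis by (rule that[OF 1 D(1) 2 3 4])
qed

lemma ex_maximal_antichain:
  assumes "antichain D"
  obtains D' where "antichain D'" "D \<subseteq> D'" "\<forall>j. \<exists>d\<in>D'. le j d \<or> le d j"
proof -
  let ?P = "{D'. antichain D' \<and> D \<subseteq> D'}"
  have "finite ?P" "?P \<noteq> {}" using assms by auto
  then obtain M where M: "M \<in> ?P" "\<And>N. N \<in> ?P \<Longrightarrow> M \<subseteq> N \<Longrightarrow> M = N"
    using finite_has_maximal[of ?P] by blast
  have "\<exists>d\<in>M. le j d \<or> le d j" for j
  proof (rule ccontr)
    assume c: "\<not> (\<exists>d\<in>M. le j d \<or> le d j)"
    then have "insert j M \<in> ?P" using M(1) unfolding antichain_def by auto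
    then have "j \<in> M" using M(2) by blast
    then show False using c le_refl by blast
  qed
  then show ?thesis using that[of M] M(1) by simp
qed

lemma antichain_maxs:
  assumes D: "antichain D"
  shows "downset {i. \<exists>d\<in>D. le i d}" "maxs {i. \<exists>d\<in>D. le i d} = (\<Union>d\<in>D. cl d)"
proof -
  show "downset {i. \<exists>d\<in>D. le i d}" unfolding downset_def using le_trans by blast
  show "maxs {i. \<exists>d\<in>D. le i d} = (\<Union>d\<in>D. cl d)" (is "?l = ?r")
  proof (intro subset_antisym subsetI)
    fix i assume i: "i \<in> ?l"
    then obtain d where "d \<in> D" "le i d" unfolding maxs_def by blast
    moreover then have "le d i" using maxs_le[OF i] le_refl by blast
    ultimately show "i \<in> ?r" unfolding cl_def by blast
  next
    fix i assume "i \<in> ?r"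
    then obtain d where d: "d \<in> D" "le d i" "le i d" unfolding cl_def by blast
    have "le j i" if j: "le i j" "d' \<in> D" "le j d'" for j d'
    proof -
      have "d = d'" using D d j le_trans unfolding antichain_def by blast
      then show ?thesis using d j le_trans by blast
    qed
    then show "i \<in> ?l" using d unfolding maxs_def by blast
  qed
qed

lemma excess_mono: "D \<subseteq> D' \<Longrightarrow> excess D \<le> excess D'"
  unfolding excess_def by (rule sum_mono2) auto

lemma excess_antichain:
  assumes D: "antichain D"
  defines "T \<equiv> (\<Union>d\<in>D. cl d)"
  shows "int (excess D) = int (card T) - int (card (cl ` T))"
proof (rule excess_reps)
  show "D \<subseteq> T" unfolding T_def using cl_self by blast
  show "inj_on cl D"
    by (rule inj_onI) (use D cl_self in \<open>auto simp: antichain_def cl_def\<close>)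
  show "cl ` D = cl ` T"
  proof
    show "cl ` D \<subseteq> cl ` T" unfolding T_def using cl_self by blast
    show "cl ` T \<subseteq> cl ` D" unfolding T_def using cl_eq by (metis (no_types, lifting) UN_E image_eqI image_subsetI)
  qed
  show "\<And>i. i \<in> T \<Longrightarrow> cl i \<subseteq> T" unfolding T_def using cl_eq by blast
qed

end

section \<open>Unmixed bipartite graphs\<close>

locale unmixed_bipartite =
  fixes E :: "('n::finite) vertex set set"
  assumes simple: "simple_graph UNIV E"
    and noiso: "no_isolated_vertices UNIV E"
    and bip: "is_bipartition UNIV E (range X) (range Y)"
    and matching: "\<forall>i. {X i, Y i} \<in> E"
    and unmixed: "unmixed UNIV E"
begin

definition le :: "'n \<Rightarrow> 'n \<Rightarrow> bool" where
  "le i j \<longleftrightarrow> {X i, Y j} \<in> E"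

lemma edge_cases:
  assumes "e \<in> E"
  obtains i j where "e = {X i, Y j}" "le i j"
proof -
  have "\<exists>a\<in>range X. \<exists>b\<in>range Y. e = {a, b}"
    using bip assms unfolding is_bipartition_def by simp
  then obtain i j where e: "e = {X i, Y j}" by (elim bexE imageE) simp
  show thesis by (rule that[OF e]) (use assms in \<open>simp add: le_def e\<close>)
qed

lemma cover_iff: "vertex_cover UNIV E C \<longleftrightarrow> (\<forall>i j. le i j \<longrightarrow> X i \<in> C \<or> Y j \<in> C)"
proof
  assume C: "vertex_cover UNIV E C"
  show "\<forall>i j. le i j \<longrightarrow> X i \<in> C \<or> Y j \<in> C"
  proof (intro allI impI)
    fix i j assume "le i j"
    then have "{X i, Y j} \<inter> C \<noteq> {}" using C unfolding vertex_cover_def le_def by blast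
    then show "X i \<in> C \<or> Y j \<in> C" by blast
  qed
next
  assume C: "\<forall>i j. le i j \<longrightarrow> X i \<in> C \<or> Y j \<in> C"
  have "e \<inter> C \<noteq> {}" if "e \<in> E" for e
  proof -
    obtain i j where "e = {X i, Y j}" "le i j" using \<open>e \<in> E\<close> by (rule edge_cases)
    then show ?thesis using C by auto
  qed
  then show "vertex_cover UNIV E C" unfolding vertex_cover_def by simp
qed

lemma le_refl': "le i i"
  using matching unfolding le_def by simp

text \<open>This cover fixes the common size of all minimal covers as \<open>n\<close>; deleting
  \<open>X i\<close> would leave the matching edge at \<open>i\<close> uncovered.\<close>

lemma minimal_cover_X: "minimal_vertex_cover UNIV E (range X)"
  unfolding minimal_vertex_cover_def
proof (intro conjI allI impI)
  show "vertex_cover UNIV E (range X)" unfolding cover_iff by simp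
  fix D :: "'n vertex set" assume "D \<subset> range X"
  then obtain i where "X i \<notin> D" "D \<subseteq> range X" by blast
  then show "\<not> vertex_cover UNIV E D" unfolding cover_iff using le_refl'[of i] by blast
qed

lemma card_minimal_cover:
  assumes "minimal_vertex_cover UNIV E C" shows "card C = card (UNIV :: 'n set)"
proof -
  have "card C = card (range X :: 'n vertex set)"
    using unmixed[unfolded unmixed_def, rule_format, OF assms minimal_cover_X] .
  also have "\<dots> = card (UNIV :: 'n set)" by (simp add: card_image inj_on_def)
  finally show ?thesis .
qed

lemma card_split: "card C = card {i. X i \<in> C} + card {i. Y i \<in> C}"
  for C :: "'n vertex set"
proof -
  have "C = X ` {i. X i \<in> C} \<union> Y ` {i. Y i \<in> C}"
  proof (intro subset_antisym subsetI)
    fix x assume "x \<in> C" then show "x \<in> X ` {i. X i \<in> C} \<union> Y ` {i. Y i \<in> C}" by (cases x) auto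
  qed auto
  then have "card C = card (X ` {i. X i \<in> C} \<union> Y ` {i. Y i \<in> C})" by simp
  also have "\<dots> = card (X ` {i. X i \<in> C}) + card (Y ` {i. Y i \<in> C})"
    by (rule card_Un_disjoint) auto
  also have "\<dots> = card {i. X i \<in> C} + card {i. Y i \<in> C}"
    by (simp add: card_image inj_on_def)
  finally show ?thesis .
qed

text \<open>A cover meets each of the \<open>n\<close> disjoint matching edges, and a minimal one
  has only \<open>n\<close> elements.\<close>

lemma minimal_cover_exactly_one:
  assumes C: "minimal_vertex_cover UNIV E C" shows "X i \<in> C \<longleftrightarrow> Y i \<notin> C"
proof -
  let ?A = "{i. X i \<in> C}" and ?B = "{i. Y i \<in> C}"
  have "vertex_cover UNIV E C" using C unfolding minimal_vertex_cover_def by simp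
  then have AB: "?A \<union> ?B = UNIV" using le_refl' unfolding cover_iff by blast
  have "card ?A + card ?B = card (UNIV :: 'n set)"
    using card_minimal_cover[OF C] card_split[of C] by simp
  moreover have "card ?A + card ?B = card (?A \<union> ?B) + card (?A \<inter> ?B)"
    by (rule card_Un_Int) auto
  ultimately have "card (?A \<inter> ?B) = 0" using AB by simp
  then have "?A \<inter> ?B = {}" by simp
  then show ?thesis using AB by blast
qed

lemma minimal_cover_inside:
  assumes "vertex_cover UNIV E C"
  obtains D where "D \<subseteq> C" "minimal_vertex_cover UNIV E D"
proof -
  let ?P = "{D. D \<subseteq> C \<and> vertex_cover UNIV E D}"
  have "finite ?P" "?P \<noteq> {}" using assms by auto
  from finite_has_minimal[OF this] obtain D where D: "D \<in> ?P" "\<forall>D'\<in>?P. D' \<subseteq> D \<longrightarrow> D = D'"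
    by (elim bexE)
  then have "minimal_vertex_cover UNIV E D" unfolding minimal_vertex_cover_def by blast
  then show thesis by (intro that[of D]) (use D in simp_all)
qed

text \<open>If \<open>le i k\<close> failed, all vertices except \<open>X i\<close> and
  \<open>Y k\<close> would form a cover. A minimal cover inside it must use \<open>Y j\<close> for
  the edge from \<open>i\<close> to \<open>j\<close> and \<open>X j\<close> for the edge from
  \<open>j\<close> to \<open>k\<close>, so it contains both ends of a matching edge.\<close>

lemma le_trans': assumes "le i j" "le j k" shows "le i k"
proof (rule ccontr)
  assume n: "\<not> le i k"
  have "vertex_cover UNIV E (- {X i, Y k})" unfolding cover_iff using n by auto
  then obtain D where D: "D \<subseteq> - {X i, Y k}" "minimal_vertex_cover UNIV E D" by (rule minimal_cover_inside)
  then have "vertex_cover UNIV E D" unfolding minimal_vertex_cover_def by simp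
  then have "Y j \<in> D" "X j \<in> D" using D(1) assms unfolding cover_iff by blast+
  then show False using minimal_cover_exactly_one[OF D(2)] by blast
qed

sublocale finite_preorder le
  by unfold_locales (fact le_refl', fact le_trans')

text \<open>Since \<open>Y j\<close> belongs to a minimal cover exactly when \<open>X j\<close> does
  not, covering the edge \<open>{X i, Y j}\<close> says that \<open>j \<in> q\<close> implies
  \<open>i \<in> q\<close>. Conversely \<open>q\<close> is completed by the
  \<open>Y\<close>-vertices of its complement; this is minimal because every cover already needs one
  vertex from each pair.\<close>

lemma cover_lattice_eq: "cover_lattice E = latt"
proof (intro subset_antisym subsetI)
  fix r assume "r \<in> cover_lattice E"
  then obtain C where C: "r = C \<inter> range X" "minimal_vertex_cover UNIV E C"
    unfolding cover_lattice_def mem_Collect_eq by (elim exE conjE)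
  note C = C(2,1)
  have "vertex_cover UNIV E C" using C unfolding minimal_vertex_cover_def by simp
  then have "downset {i. X i \<in> C}"
    unfolding cover_iff minimal_cover_exactly_one[OF C(1)] downset_def mem_Collect_eq by blast
  moreover have "r = X ` {i. X i \<in> C}" unfolding C(2) by auto
  ultimately show "r \<in> latt" unfolding X_in_latt[symmetric] by simp
next
  fix r assume "r \<in> latt"
  then obtain q where q: "r = X ` q" "downset q" by (rule latt_cases)
  let ?C = "X ` q \<union> Y ` (- q)"
  have mX: "X i \<in> ?C \<longleftrightarrow> i \<in> q" for i by auto
  have mY: "Y i \<in> ?C \<longleftrightarrow> i \<notin> q" for i by auto
  have "vertex_cover UNIV E ?C" unfolding cover_iff mX mY
    using q(2)[unfolded downset_def] by blast
  moreover have "\<not> vertex_cover UNIV E D" if sub: "D \<subset> ?C" for D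
  proof
    assume D: "vertex_cover UNIV E D"
    from psubset_imp_ex_mem[OF sub] obtain v where v: "v \<in> ?C" "v \<notin> D" by (elim exE DiffE)
    have "X i \<in> D \<or> Y i \<in> D" for i using D[unfolded cover_iff, rule_format, OF le_refl'] .
    moreover have "X i \<in> D \<Longrightarrow> i \<in> q" "Y i \<in> D \<Longrightarrow> i \<notin> q" for i
      using psubsetD[OF sub, of "X i"] psubsetD[OF sub, of "Y i"] by auto
    ultimately have "X i \<in> D \<longleftrightarrow> i \<in> q" "Y i \<in> D \<longleftrightarrow> i \<notin> q" for i by metis+
    then show False using v mX mY by (cases v) simp_all
  qed
  ultimately have "minimal_vertex_cover UNIV E ?C" unfolding minimal_vertex_cover_def by simp
  moreover have "r = ?C \<inter> range X" using q(1) by auto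
  ultimately show "r \<in> cover_lattice E"
    unfolding cover_lattice_def mem_Collect_eq by (intro exI[of _ ?C] conjI)
qed

section \<open>The sets \<open>A_G\<close> and \<open>B_G\<close> in terms of antichains\<close>

text \<open>For an antichain this is maximality under inclusion, in the form in which it is used
  later.\<close>

definition spanning :: "'n set \<Rightarrow> bool" where
  "spanning D \<longleftrightarrow> (\<forall>j. \<exists>d\<in>D. le j d \<or> le d j)"

text \<open>The criterion for a maximal Boolean interval becomes comparability of every element with
  \<open>D\<close>. In the score, \<open>card q\<close> cancels against
  \<open>card (q - maxs q)\<close>, leaving the number of maximal elements minus the number of
  maximal classes.\<close>

lemma A_set_antichain:
  assumes "p \<in> A_set E"
  obtains D where "antichain D" "spanning D" "p = X ` {i. \<exists>d\<in>D. le i d}" "score E p = int (excess D)"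
proof -
  have p: "p \<in> latt" using assms unfolding A_set_def cover_lattice_eq by simp
  then obtain q where q: "p = X ` q" "downset q" by (rule latt_cases)
  obtain D where D: "antichain D" "D \<subseteq> maxs q" "q = {i. \<exists>d\<in>D. le i d}"
    "\<forall>j. (\<exists>d\<in>maxs q. le d j) \<longleftrightarrow> (\<exists>d\<in>D. le d j)"
    "int (excess D) = int (card (maxs q)) - int (card (cl ` maxs q))"
    by (rule ex_reps_maxs[OF q(2)])
  have "\<forall>j. j \<in> q \<or> (\<exists>d\<in>maxs q. le d j)"
    using assms unfolding A_set_def cover_lattice_eq q(1) mem_Collect_eq maximal_boolean_iff[OF q(2)] by simp
  then have "j \<in> q \<or> (\<exists>d\<in>D. le d j)" for j using spec[OF D(4), of j] by blast
  then have "\<exists>d\<in>D. le j d \<or> le d j" for j unfolding D(3) by blast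
  then have "spanning D" unfolding spanning_def by blast
  moreover have "score E p = int (excess D)"
  proof -
    have "card (q - maxs q) = card q - card (maxs q)" using maxs_subset by (simp add: card_Diff_subset)
    moreover have "card (maxs q) \<le> card q" using maxs_subset by (simp add: card_mono)
    ultimately show ?thesis
      unfolding score_def cover_lattice_eq q(1) D(5) card_lower_neighbors_latt[OF q(2)] meet_lower_latt[OF q(2)]
      by simp
  qed
  ultimately show thesis using that[of D] D(1,3) q(1) by simp
qed

lemma antichain_A_set:
  assumes D: "antichain D" "spanning D"
  shows "X ` {i. \<exists>d\<in>D. le i d} \<in> A_set E" "score E (X ` {i. \<exists>d\<in>D. le i d}) = int (excess D)"
proof -
  let ?q = "{i. \<exists>d\<in>D. le i d}"
  note q = antichain_maxs(1)[OF D(1)] and m = antichain_maxs(2)[OF D(1)]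
  have sp: "\<exists>d\<in>D. le j d \<or> le d j" for j using D(2) unfolding spanning_def by (rule spec)
  have "D \<subseteq> maxs ?q" unfolding m using cl_self by blast
  then have "\<forall>j. j \<in> ?q \<or> (\<exists>d\<in>maxs ?q. le d j)" using sp by blast
  then show "X ` ?q \<in> A_set E"
    unfolding A_set_def cover_lattice_eq mem_Collect_eq maximal_boolean_iff[OF q] using q by simp
  have "card (?q - maxs ?q) = card ?q - card (maxs ?q)" using maxs_subset by (simp add: card_Diff_subset)
  moreover have "card (maxs ?q) \<le> card ?q" using maxs_subset by (simp add: card_mono)
  moreover have "int (excess D) = int (card (maxs ?q)) - int (card (cl ` maxs ?q))"
    using excess_antichain[OF D(1)] unfolding m .
  ultimately show "score E (X ` ?q) = int (excess D)"
    unfolding score_def cover_lattice_eq card_lower_neighbors_latt[OF q] meet_lower_latt[OF q] by simp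
qed

text \<open>The maximum over \<open>A_set E\<close> dominates the excess of every antichain,
  spanning or not, because an antichain extends to a spanning one without losing excess. The
  stronger form is needed for the marks of generators, which are arbitrary antichains.\<close>

theorem B_set_antichain:
  assumes "p \<in> B_set E"
  obtains D where "antichain D" "spanning D" "p = X ` {i. \<exists>d\<in>D. le i d}"
    "\<And>D'. antichain D' \<Longrightarrow> excess D' \<le> excess D"
proof -
  have p: "p \<in> A_set E" "score E p = Max (score E ` A_set E)" using assms unfolding B_set_def by simp_all
  obtain D where D: "antichain D" "spanning D" "p = X ` {i. \<exists>d\<in>D. le i d}" "score E p = int (excess D)"
    by (rule A_set_antichain[OF p(1)])
  have "excess D' \<le> excess D" if D': "antichain D'" for D'
  proof -
    obtain D'' where D'': "antichain D''" "D' \<subseteq> D''" "\<forall>j. \<exists>d\<in>D''. le j d \<or> le d j"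
      by (rule ex_maximal_antichain[OF D']) 
    have s: "spanning D''" unfolding spanning_def using D''(3) by simp
    have "score E (X ` {i. \<exists>d\<in>D''. le i d}) \<in> score E ` A_set E"
      using antichain_A_set(1)[OF D''(1) s] by simp
    then have "score E (X ` {i. \<exists>d\<in>D''. le i d}) \<le> score E p"
      unfolding p(2) by (intro Max_ge) simp_all
    then have "excess D'' \<le> excess D" using antichain_A_set(2)[OF D''(1) s] D(4) by simp
    then show ?thesis using excess_mono[OF D''(2)] by simp
  qed
  then show thesis using that[OF D(1,2,3)] by simp
qed

end

section \<open>Labelled complexes\<close>

text \<open>Multigraded free complexes with squarefree degrees, encoded over \<open>K\<close>: a generator \<open>Gen m s\<close> has
  multidegree \<open>m \<union> s\<close> and homological degree \<open>|s|\<close>, and \<open>D h g\<close> is the coefficient of \<open>h\<close> in the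
  boundary of \<open>g\<close> (the monomial factor is determined by the labels). \<open>lres J G D\<close> says that the strand
  in each degree \<open>U\<close> is exact, so that the complex resolves \<open>R/I\<close>, where \<open>I\<close> is spanned by the
  monomials whose support lies in \<open>J\<close>.\<close>

datatype 'v gen = Gen (gm: "'v set") (gs: "'v set")

instance gen :: (finite) finite
proof
  have "(UNIV :: 'a gen set) = range (\<lambda>(m, s). Gen m s)"
  proof (intro subset_antisym subsetI)
    fix g :: "'a gen" show "g \<in> range (\<lambda>(m, s). Gen m s)"
      by (rule image_eqI[of _ _ "(gm g, gs g)"]) simp_all
  qed simp
  also have "finite \<dots>" by (rule finite_imageI) simp
  finally show "finite (UNIV :: 'a gen set)" .
qed

definition lab :: "'v gen \<Rightarrow> 'v set" where
  "lab g = gm g \<union> gs g"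

definition hdeg :: "'v gen \<Rightarrow> nat" where
  "hdeg g = card (gs g)"

definition bd :: "('v gen \<Rightarrow> 'v gen \<Rightarrow> 'k::field) \<Rightarrow> (('v::finite) gen \<Rightarrow> 'k) \<Rightarrow> 'v gen \<Rightarrow> 'k" where
  "bd D c h = (\<Sum>g\<in>UNIV. D h g * c g)"

text \<open>The augmentation in one multidegree outside \<open>J\<close>, where the quotient is
  one-dimensional: every generator of homological degree 0 is sent to the monomial of its label, so
  only the sum of the coefficients remains.\<close>

definition aug :: "(('v::finite) gen \<Rightarrow> 'k::field) \<Rightarrow> 'k" where
  "aug c = (\<Sum>g\<in>UNIV. if hdeg g = 0 then c g else 0)"

definition supp_in :: "'v gen set \<Rightarrow> 'v set \<Rightarrow> ('v gen \<Rightarrow> 'k::field) \<Rightarrow> bool" where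
  "supp_in G U c \<longleftrightarrow> (\<forall>g. c g \<noteq> 0 \<longrightarrow> g \<in> G \<and> lab g \<subseteq> U)"

definition lres :: "('v::finite) set set \<Rightarrow> 'v gen set \<Rightarrow> ('v gen \<Rightarrow> 'v gen \<Rightarrow> 'k::field) \<Rightarrow> bool" where
  "lres J G D \<longleftrightarrow>
     (\<forall>h g. D h g \<noteq> 0 \<longrightarrow> h \<in> G \<and> g \<in> G \<and> hdeg g = Suc (hdeg h) \<and> lab h \<subseteq> lab g) \<and>
     (\<forall>h g. (\<Sum>f\<in>UNIV. D h f * D f g) = 0) \<and>
     (\<forall>g. lab g \<notin> J \<longrightarrow> aug (\<lambda>h. D h g) = 0) \<and>
     (\<forall>U. U \<notin> J \<longrightarrow> (\<exists>c. supp_in G U c \<and> aug c = (1::'k))) \<and>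
     (\<forall>U c. supp_in G U c \<longrightarrow> bd D c = (\<lambda>_. 0) \<longrightarrow> (U \<notin> J \<longrightarrow> aug c = 0) \<longrightarrow>
        (\<exists>w. supp_in G U w \<and> bd D w = c))"

lemma lresD:
  fixes D :: "('v::finite) gen \<Rightarrow> 'v gen \<Rightarrow> 'k::field"
  assumes "lres J G D"
  shows "D h g \<noteq> 0 \<Longrightarrow> h \<in> G" "D h g \<noteq> 0 \<Longrightarrow> g \<in> G"
    "D h g \<noteq> 0 \<Longrightarrow> hdeg g = Suc (hdeg h)" "D h g \<noteq> 0 \<Longrightarrow> lab h \<subseteq> lab g"
    "(\<Sum>f\<in>UNIV. D h f * D f g) = 0"
    "lab g \<notin> J \<Longrightarrow> aug (\<lambda>h. D h g) = 0"
    "U \<notin> J \<Longrightarrow> \<exists>c. supp_in G U c \<and> aug c = (1::'k)"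
    "supp_in G U c \<Longrightarrow> bd D c = (\<lambda>_. 0) \<Longrightarrow> (U \<notin> J \<Longrightarrow> aug c = 0) \<Longrightarrow> \<exists>w. supp_in G U w \<and> bd D w = c"
proof -
  note a = assms[unfolded lres_def]
  note a1 = a[THEN conjunct1, rule_format] and b1 = a[THEN conjunct2]
  note a2 = b1[THEN conjunct1, rule_format] and b2 = b1[THEN conjunct2]
  note a3 = b2[THEN conjunct1, rule_format] and b3 = b2[THEN conjunct2]
  note a4 = b3[THEN conjunct1, rule_format] and a5 = b3[THEN conjunct2, rule_format]
  show "D h g \<noteq> 0 \<Longrightarrow> h \<in> G" "D h g \<noteq> 0 \<Longrightarrow> g \<in> G"
    "D h g \<noteq> 0 \<Longrightarrow> hdeg g = Suc (hdeg h)" "D h g \<noteq> 0 \<Longrightarrow> lab h \<subseteq> lab g"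
    by (drule a1, elim conjE, assumption)+
  show "(\<Sum>f\<in>UNIV. D h f * D f g) = 0" by (rule a2)
  show "lab g \<notin> J \<Longrightarrow> aug (\<lambda>h. D h g) = 0" by (rule a3)
  show "U \<notin> J \<Longrightarrow> \<exists>c. supp_in G U c \<and> aug c = (1::'k)" by (rule a4)
  show "supp_in G U c \<Longrightarrow> bd D c = (\<lambda>_. 0) \<Longrightarrow> (U \<notin> J \<Longrightarrow> aug c = 0) \<Longrightarrow> \<exists>w. supp_in G U w \<and> bd D w = c"
    by (rule a5) simp_all
qed

lemma lresI:
  fixes D :: "('v::finite) gen \<Rightarrow> 'v gen \<Rightarrow> 'k::field"
  assumes "\<And>h g. D h g \<noteq> 0 \<Longrightarrow> h \<in> G \<and> g \<in> G \<and> hdeg g = Suc (hdeg h) \<and> lab h \<subseteq> lab g"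
    "\<And>h g. (\<Sum>f\<in>UNIV. D h f * D f g) = 0"
    "\<And>g. lab g \<notin> J \<Longrightarrow> aug (\<lambda>h. D h g) = 0"
    "\<And>U. U \<notin> J \<Longrightarrow> \<exists>c. supp_in G U c \<and> aug c = (1::'k)"
    "\<And>U c. supp_in G U c \<Longrightarrow> bd D c = (\<lambda>_. 0) \<Longrightarrow> (U \<notin> J \<Longrightarrow> aug c = 0) \<Longrightarrow>
        \<exists>w. supp_in G U w \<and> bd D w = c"
  shows "lres J G D"
  unfolding lres_def
proof (intro conjI)
  show "\<forall>h g. D h g \<noteq> 0 \<longrightarrow> h \<in> G \<and> g \<in> G \<and> hdeg g = Suc (hdeg h) \<and> lab h \<subseteq> lab g"
    by (intro allI impI) (rule assms(1))
  show "\<forall>h g. (\<Sum>f\<in>UNIV. D h f * D f g) = 0" by (intro allI) (rule assms(2))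
  show "\<forall>g. lab g \<notin> J \<longrightarrow> aug (\<lambda>h. D h g) = 0" by (intro allI impI) (rule assms(3))
  show "\<forall>U. U \<notin> J \<longrightarrow> (\<exists>c. supp_in G U c \<and> aug c = (1::'k))" by (intro allI impI) (rule assms(4))
  show "\<forall>U c. supp_in G U c \<longrightarrow> bd D c = (\<lambda>_. 0) \<longrightarrow> (U \<notin> J \<longrightarrow> aug c = 0) \<longrightarrow>
      (\<exists>w. supp_in G U w \<and> bd D w = c)"
    by (intro allI impI) (rule assms(5); simp)
qed

lemma bd_sum_smult: "bd D (\<lambda>h. \<Sum>f\<in>A. a f * t f h) h' = (\<Sum>f\<in>A. a f * bd D (t f) h')"
proof -
  have "bd D (\<lambda>h. \<Sum>f\<in>A. a f * t f h) h' = (\<Sum>g\<in>UNIV. \<Sum>f\<in>A. a f * (D h' g * t f g))"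
    unfolding bd_def sum_distrib_left by (intro sum.cong refl) (simp add: mult_ac)
  also have "\<dots> = (\<Sum>f\<in>A. \<Sum>g\<in>UNIV. a f * (D h' g * t f g))" by (rule sum.swap)
  finally show ?thesis unfolding bd_def sum_distrib_left .
qed

lemma aug_sum_smult: "aug (\<lambda>h. \<Sum>f\<in>A. a f * t f h) = (\<Sum>f\<in>A. a f * aug (t f))"
proof -
  have "aug (\<lambda>h. \<Sum>f\<in>A. a f * t f h) = (\<Sum>g\<in>UNIV. \<Sum>f\<in>A. a f * (if hdeg g = 0 then t f g else 0))"
    unfolding aug_def by (intro sum.cong refl) simp
  also have "\<dots> = (\<Sum>f\<in>A. \<Sum>g\<in>UNIV. a f * (if hdeg g = 0 then t f g else 0))" by (rule sum.swap)
  finally show ?thesis unfolding aug_def sum_distrib_left .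
qed

lemma bd_minus: "bd D (\<lambda>g. a g - b g) h = bd D a h - bd D b h"
  unfolding bd_def by (simp add: right_diff_distrib sum_subtractf)

lemma aug_minus: "aug (\<lambda>g. a g - b g) = aug a - aug b"
  unfolding aug_def sum_subtractf[symmetric] by (intro sum.cong refl) simp

lemma bd_bd:
  assumes "lres J G D" shows "bd D (bd D w) = (\<lambda>_. 0)"
proof
  fix h
  have "bd D (bd D w) h = (\<Sum>f\<in>UNIV. \<Sum>g\<in>UNIV. D h f * D f g * w g)"
    unfolding bd_def sum_distrib_left by (simp add: mult.assoc)
  also have "\<dots> = (\<Sum>g\<in>UNIV. \<Sum>f\<in>UNIV. D h f * D f g * w g)" by (rule sum.swap)
  also have "\<dots> = (\<Sum>g\<in>UNIV. (\<Sum>f\<in>UNIV. D h f * D f g) * w g)" unfolding sum_distrib_right ..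
  also have "\<dots> = 0" using lresD(5)[OF assms] by simp
  finally show "bd D (bd D w) h = 0" .
qed

subsection \<open>Adding a variable\<close>

text \<open>Generators come in pairs, an unmarked one and its marked copy. \<open>i\<close> adds the
  mark and \<open>d\<close> removes it; they are inverse to each other only on the proper
  halves.\<close>

lemma sum_pairing:
  fixes F :: "'a::finite \<Rightarrow> 'b::comm_monoid_add"
  assumes "\<And>g. \<not> M g \<Longrightarrow> d (i g) = g" "\<And>g. M g \<Longrightarrow> i (d g) = g" "\<And>g. M (i g)" "\<And>g. \<not> M (d g)"
  shows "(\<Sum>g\<in>UNIV. F g) = (\<Sum>g\<in>UNIV. if M g then 0 else F g + F (i g))"
proof -
  have "(\<Sum>g\<in>UNIV. F g) = (\<Sum>g\<in>{g. M g}. F g) + (\<Sum>g\<in>{g. \<not> M g}. F g)"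
    using sum.Int_Diff[of UNIV F "{g. M g}"] by (simp add: Collect_neg_eq[symmetric] Compl_eq_Diff_UNIV[symmetric])
  also have "(\<Sum>g\<in>{g. M g}. F g) = (\<Sum>g\<in>{g. \<not> M g}. F (i g))"
    by (rule sum.reindex_bij_witness[of _ i d]) (simp_all add: assms)
  also have "\<dots> + (\<Sum>g\<in>{g. \<not> M g}. F g) = (\<Sum>g\<in>{g. \<not> M g}. F g + F (i g))"
    by (simp add: sum.distrib add.commute)
  also have "\<dots> = (\<Sum>g\<in>UNIV. if \<not> M g then F g + F (i g) else 0)"
    by (simp add: sum.inter_filter[symmetric])
  also have "\<dots> = (\<Sum>g\<in>UNIV. if M g then 0 else F g + F (i g))"
    by (intro sum.cong refl) simp
  finally show ?thesis .
qed

definition ins_gs :: "'v \<Rightarrow> 'v gen \<Rightarrow> 'v gen" where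
  "ins_gs z g = Gen (gm g) (insert z (gs g))"

definition del_gs :: "'v \<Rightarrow> 'v gen \<Rightarrow> 'v gen" where
  "del_gs z g = Gen (gm g) (gs g - {z})"

lemma del_ins_gs: "z \<notin> gs g \<Longrightarrow> del_gs z (ins_gs z g) = g"
  by (cases g) (simp add: del_gs_def ins_gs_def)

lemma ins_del_gs: "z \<in> gs g \<Longrightarrow> ins_gs z (del_gs z g) = g"
  by (cases g) (simp add: del_gs_def ins_gs_def insert_absorb)

lemma mem_ins_gs: "z \<in> gs (ins_gs z g)"
  by (simp add: ins_gs_def)

lemma mem_del_gs: "z \<notin> gs (del_gs z g)"
  by (simp add: del_gs_def)

lemma sum_mark_gs:
  fixes F :: "('v::finite) gen \<Rightarrow> 'k::field"
  shows "(\<Sum>g\<in>UNIV. F g) = (\<Sum>g\<in>UNIV. if z \<in> gs g then 0 else F g + F (ins_gs z g))"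
  by (rule sum_pairing[where d="del_gs z"]) (simp_all add: del_ins_gs ins_del_gs mem_ins_gs mem_del_gs)

text \<open>The mapping cone of multiplication by \<open>z\<close>, with \<open>ins_gs z g\<close>
  as the shifted copy of \<open>g\<close>. In a degree without \<open>z\<close> no copy is present
  and nothing changes; in a degree containing \<open>z\<close> the strand is the cone of an identity
  map and is contracted by passing from \<open>g\<close> to its copy.\<close>

lemma lres_cone:
  fixes D :: "('v::finite) gen \<Rightarrow> 'v gen \<Rightarrow> 'k::field"
  assumes D: "lres J G D" and z: "\<forall>g\<in>G. z \<notin> lab g"
  shows "\<exists>D' :: 'v gen \<Rightarrow> 'v gen \<Rightarrow> 'k. lres {U. U \<in> J \<or> z \<in> U} (G \<union> ins_gs z ` G) D'"
proof -
  let ?J = "{U. U \<in> J \<or> z \<in> U}" and ?G = "G \<union> ins_gs z ` G"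
  \<comment> \<open>The sign on the block of copies makes the square vanish. The identity block is
    confined to copies of members of \<open>G\<close>, so that the matrix stays supported on the new
    generators.\<close>
  define D' where "D' h g = (if z \<in> gs g
      then (if z \<in> gs h then - D (del_gs z h) (del_gs z g) else if g \<in> ins_gs z ` G \<and> h = del_gs z g then 1 else 0)
      else (if z \<in> gs h then 0 else D h g))" for h g
  note Dz = lresD[OF D]
  have zs: "z \<notin> gs g" "z \<notin> gm g" if "g \<in> G" for g using bspec[OF z that] unfolding lab_def by auto
  have Dmark: "D h g = 0" if "z \<in> gs g \<or> z \<in> gs h" for h g
  proof (rule ccontr)
    assume "D h g \<noteq> 0"
    then have "z \<notin> gs h" "z \<notin> gs g" using zs(1)[OF Dz(1)] zs(1)[OF Dz(2)] by simp_all
    then show False using that by simp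
  qed
  note di = del_ins_gs[of z] and id = ins_del_gs[of z] and zi [simp] = mem_ins_gs[of z]
  have inG: "ins_gs z g \<in> ins_gs z ` G \<longleftrightarrow> g \<in> G" if "z \<notin> gs g" for g
  proof
    assume "ins_gs z g \<in> ins_gs z ` G"
    then obtain g' where g': "ins_gs z g = ins_gs z g'" "g' \<in> G" by (rule imageE)
    then have "del_gs z (ins_gs z g) = del_gs z (ins_gs z g')" by simp
    then show "g \<in> G" using di[OF that] di[OF zs(1)[OF g'(2)]] g'(2) by simp
  qed simp
  have D'1: "D' h g = D h g" if "z \<notin> gs h" "z \<notin> gs g" for h g using that unfolding D'_def by simp
  have D'2: "D' (ins_gs z h) g = 0" if "z \<notin> gs g" for h g using that unfolding D'_def by simp
  have D'3: "D' (ins_gs z h) (ins_gs z g) = - D h g" if "z \<notin> gs h" "z \<notin> gs g" for h g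
    using that di unfolding D'_def by simp
  have D'4: "D' h (ins_gs z g) = (if g \<in> G \<and> h = g then 1 else 0)" if "z \<notin> gs h" "z \<notin> gs g" for h g
    using that di inG unfolding D'_def by simp
  have degi: "hdeg (ins_gs z g) = Suc (hdeg g)" if "z \<notin> gs g" for g
    using that unfolding hdeg_def ins_gs_def by simp
  have labi: "lab (ins_gs z g) = insert z (lab g)" for g unfolding lab_def ins_gs_def by simp
  have all: "\<forall>g. P g" if P: "\<And>g. z \<notin> gs g \<Longrightarrow> P g" "\<And>g. z \<notin> gs g \<Longrightarrow> P (ins_gs z g)" for P
  proof
    fix g show "P g"
    proof (cases "z \<in> gs g")
      case True
      have "P (ins_gs z (del_gs z g))" by (rule P(2)) (simp add: del_gs_def)
      then show ?thesis using id[OF True] by simp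
    qed (rule P(1))
  qed
  have b1: "bd D' c h = bd D c h + (if h \<in> G then c (ins_gs z h) else 0)" if h: "z \<notin> gs h" for c h
  proof -
    have "bd D' c h = (\<Sum>g\<in>UNIV. if z \<in> gs g then 0 else D h g * c g + (if g \<in> G \<and> h = g then c (ins_gs z g) else 0))"
      unfolding bd_def by (rule trans[OF sum_mark_gs[of _ z]], intro sum.cong refl) (use h D'1 D'4 in auto)
    also have "\<dots> = (\<Sum>g\<in>UNIV. D h g * c g + (if h = g then (if h \<in> G then c (ins_gs z h) else 0) else 0))"
      by (intro sum.cong refl) (use h Dmark in auto)
    also have "\<dots> = bd D c h + (if h \<in> G then c (ins_gs z h) else 0)"
      unfolding sum.distrib bd_def by simp
    finally show ?thesis .
  qed
  have b2: "bd D' c (ins_gs z h) = - bd D (\<lambda>g. c (ins_gs z g)) h" if h: "z \<notin> gs h" for c h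
  proof -
    have "bd D' c (ins_gs z h) = (\<Sum>g\<in>UNIV. if z \<in> gs g then 0 else - D h g * c (ins_gs z g))"
      unfolding bd_def by (rule trans[OF sum_mark_gs[of _ z]], intro sum.cong refl) (use h D'2 D'3 in auto)
    also have "\<dots> = (\<Sum>g\<in>UNIV. - (D h g * c (ins_gs z g)))"
      by (intro sum.cong refl) (use Dmark in auto)
    finally show ?thesis unfolding bd_def sum_negf .
  qed
  have bdD: "bd D (\<lambda>g. D g g0) h = 0" for h g0 unfolding bd_def by (rule Dz(5))
  show ?thesis
  proof (rule exI[of _ D'], rule lresI)
    fix h g
    have "\<forall>h. \<forall>g. D' h g \<noteq> 0 \<longrightarrow> h \<in> ?G \<and> g \<in> ?G \<and> hdeg g = Suc (hdeg h) \<and> lab h \<subseteq> lab g"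
    proof (rule all; rule all)
      fix h g :: "'v gen" assume hg: "z \<notin> gs h" "z \<notin> gs g"
      show "D' h g \<noteq> 0 \<longrightarrow> h \<in> ?G \<and> g \<in> ?G \<and> hdeg g = Suc (hdeg h) \<and> lab h \<subseteq> lab g"
        using Dz(1-4)[of h g] D'1[OF hg] by simp
      show "D' h (ins_gs z g) \<noteq> 0 \<longrightarrow> h \<in> ?G \<and> ins_gs z g \<in> ?G \<and> hdeg (ins_gs z g) = Suc (hdeg h) \<and> lab h \<subseteq> lab (ins_gs z g)"
        using D'4[OF hg] degi[OF hg(2)] labi[of g] by auto
      show "D' (ins_gs z h) g \<noteq> 0 \<longrightarrow> ins_gs z h \<in> ?G \<and> g \<in> ?G \<and> hdeg g = Suc (hdeg (ins_gs z h)) \<and> lab (ins_gs z h) \<subseteq> lab g"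
        using D'2[OF hg(2)] by simp
      show "D' (ins_gs z h) (ins_gs z g) \<noteq> 0 \<longrightarrow> ins_gs z h \<in> ?G \<and> ins_gs z g \<in> ?G \<and> hdeg (ins_gs z g) = Suc (hdeg (ins_gs z h)) \<and> lab (ins_gs z h) \<subseteq> lab (ins_gs z g)"
        using D'3[OF hg] Dz(1-4)[of h g] degi hg labi by auto
    qed
    then show "D' h g \<noteq> 0 \<Longrightarrow> h \<in> ?G \<and> g \<in> ?G \<and> hdeg g = Suc (hdeg h) \<and> lab h \<subseteq> lab g" by blast
  next
    fix h g
    have "\<forall>h. \<forall>g. bd D' (\<lambda>f. D' f g) h = 0"
    proof (rule all; rule all)
      fix h g :: "'v gen" assume hg: "z \<notin> gs h" "z \<notin> gs g"
      have e1: "bd D (\<lambda>f. D' f g) h = bd D (\<lambda>f. D f g) h" for h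
        unfolding bd_def by (intro sum.cong refl) (use hg Dmark D'1 in auto)
      show "bd D' (\<lambda>f. D' f g) h = 0"
        unfolding b1[OF hg(1)] e1 bdD D'2[OF hg(2)] by simp
      show "bd D' (\<lambda>f. D' f g) (ins_gs z h) = 0"
        unfolding b2[OF hg(1)] D'2[OF hg(2)] by (simp add: bd_def)
      have e2: "bd D (\<lambda>f. D' f (ins_gs z g)) h = D h g" for h
      proof -
        have pt: "D h f * D' f (ins_gs z g) = (if f = g then D h g else 0)" for f
        proof (cases "z \<in> gs f")
          case True
          then have "D h f = 0" "f \<noteq> g" using Dmark hg by auto
          then show ?thesis by simp
        next
          case False
          have "g \<notin> G \<Longrightarrow> D h g = 0" using Dz(2)[of h g] by argo
          then show ?thesis unfolding D'4[OF False hg(2)] by auto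
        qed
        show ?thesis unfolding bd_def pt by simp
      qed
      show "bd D' (\<lambda>f. D' f (ins_gs z g)) h = 0"
        unfolding b1[OF hg(1)] e2 D'3[OF hg] using Dz(1) by auto
      have "bd D (\<lambda>f. D' (ins_gs z f) (ins_gs z g)) h = bd D (\<lambda>f. - D f g) h"
        unfolding bd_def
      proof (intro sum.cong refl)
        fix f show "D h f * D' (ins_gs z f) (ins_gs z g) = D h f * - D f g"
          using hg Dmark[of f h] D'3[of f g] by (cases "z \<in> gs f") simp_all
      qed
      also have "\<dots> = - bd D (\<lambda>f. D f g) h" unfolding bd_def by (simp add: sum_negf)
      finally show "bd D' (\<lambda>f. D' f (ins_gs z g)) (ins_gs z h) = 0"
        unfolding b2[OF hg(1)] bdD by simp
    qed
    then show "(\<Sum>f\<in>UNIV. D' h f * D' f g) = 0" unfolding bd_def by blast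
  next
    fix g assume "lab g \<notin> ?J"
    then have zg: "z \<notin> lab g" "lab g \<notin> J" by simp_all
    then have "aug (\<lambda>h. D h g) = 0" using Dz(6) by simp
    moreover have "aug (\<lambda>h. D' h g) = aug (\<lambda>h. D h g)"
      unfolding aug_def by (intro sum.cong refl) (use zg Dmark in \<open>auto simp: D'_def lab_def\<close>)
    ultimately show "aug (\<lambda>h. D' h g) = 0" by simp
  next
    fix U assume "U \<notin> ?J"
    then obtain c where "supp_in G U c" "aug c = (1::'k)" using Dz(7)[of U] by blast
    then show "\<exists>c. supp_in ?G U c \<and> aug c = (1::'k)" unfolding supp_in_def by blast
  next
    fix U :: "'v set" and c :: "'v gen \<Rightarrow> 'k" assume c: "supp_in ?G U c" "bd D' c = (\<lambda>_. 0)" "U \<notin> ?J \<Longrightarrow> aug c = 0"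
    show "\<exists>w. supp_in ?G U w \<and> bd D' w = c"
    proof (cases "z \<in> U")
      case False
      have c0: "c (ins_gs z g) = 0" for g
        using c(1) False labi[of g] unfolding supp_in_def by (metis insert_subset)
      have cG: "supp_in G U c"
        using c(1) False labi unfolding supp_in_def by (metis Un_iff c0 image_iff)
      have "bd D c h = 0" for h
      proof (cases "z \<in> gs h")
        case True then show ?thesis using Dmark unfolding bd_def by simp
      next
        case F: False
        then show ?thesis using b1[OF F, of c] c(2) c0 by (simp split: if_splits)
      qed
      then obtain w where w: "supp_in G U w" "bd D w = c"
        using Dz(8)[OF cG, OF ext] c(3) False by auto
      have w0: "w (ins_gs z g) = 0" for g
        using w(1) zs[of "ins_gs z g"] unfolding supp_in_def by auto
      have "\<forall>h. bd D' w h = c h"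
      proof (rule all)
        fix h :: "'v gen" assume h: "z \<notin> gs h"
        show "bd D' w h = c h" using b1[OF h] w(2) w0 by simp
        show "bd D' w (ins_gs z h) = c (ins_gs z h)" unfolding b2[OF h] w0 c0 by (simp add: bd_def)
      qed
      then have "bd D' w = c" by blast
      moreover have "supp_in ?G U w" using w(1) unfolding supp_in_def by blast
      ultimately show ?thesis by blast
    next
      case True
      \<comment> \<open>The contraction: the unmarked part of \<open>c\<close> is moved onto the
        copies. Its boundary recovers that part directly, and recovers the marked part of
        \<open>c\<close> because \<open>c\<close> is a cycle.\<close>
      define w where "w g = (if z \<in> gs g then c (del_gs z g) else 0)" for g
      have w0: "w g = 0" if "z \<notin> gs g" for g using that unfolding w_def by simp
      have w1: "w (ins_gs z g) = c g" if "z \<notin> gs g" for g using that di unfolding w_def by simp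
      have cG: "g \<in> G" if "c g \<noteq> 0" "z \<notin> gs g" for g
        using that c(1) unfolding supp_in_def by (metis UnE image_iff zi)
      have "\<forall>g. w g \<noteq> 0 \<longrightarrow> g \<in> ?G \<and> lab g \<subseteq> U"
      proof (rule all)
        fix g :: "'v gen" assume g: "z \<notin> gs g"
        show "w g \<noteq> 0 \<longrightarrow> g \<in> ?G \<and> lab g \<subseteq> U" using w0[OF g] by simp
        show "w (ins_gs z g) \<noteq> 0 \<longrightarrow> ins_gs z g \<in> ?G \<and> lab (ins_gs z g) \<subseteq> U"
          unfolding w1[OF g] labi using cG[OF _ g] c(1) True unfolding supp_in_def by simp
      qed
      then have "supp_in ?G U w" unfolding supp_in_def .
      moreover have "\<forall>h. bd D' w h = c h"
      proof (rule all)
        fix h :: "'v gen" assume h: "z \<notin> gs h"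
        have "bd D w h = 0" unfolding bd_def by (intro sum.neutral ballI) (use w0 Dmark in fastforce)
        then show "bd D' w h = c h" unfolding b1[OF h] w1[OF h] using cG[OF _ h] by auto
        have "bd D (\<lambda>g. w (ins_gs z g)) h = bd D c h"
          unfolding bd_def by (intro sum.cong refl) (use w1 Dmark in fastforce)
        moreover have "bd D c h + c (ins_gs z h) = 0" 
        proof -
          have "h \<in> G" if "c (ins_gs z h) \<noteq> 0"
          proof -
            have "ins_gs z h \<in> ?G" using c(1) that unfolding supp_in_def by blast
            then show ?thesis using inG[OF h] zs zi by blast
          qed
          then have "c (ins_gs z h) = 0" if "h \<notin> G" using that by blast
          then show ?thesis using b1[OF h, of c] c(2) by (simp split: if_splits)
        qed
        ultimately show "bd D' w (ins_gs z h) = c (ins_gs z h)" unfolding b2[OF h]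
          by (simp add: add_eq_0_iff)
      qed
      ultimately show ?thesis by blast
    qed
  qed
qed

subsection \<open>The horseshoe construction\<close>

definition ins_gm :: "'v \<Rightarrow> 'v gen \<Rightarrow> 'v gen" where
  "ins_gm z g = Gen (insert z (gm g)) (gs g)"

definition del_gm :: "'v \<Rightarrow> 'v gen \<Rightarrow> 'v gen" where
  "del_gm z g = Gen (gm g - {z}) (gs g)"

lemma del_ins_gm: "z \<notin> gm g \<Longrightarrow> del_gm z (ins_gm z g) = g"
  by (cases g) (simp add: del_gm_def ins_gm_def)

lemma ins_del_gm: "z \<in> gm g \<Longrightarrow> ins_gm z (del_gm z g) = g"
  by (cases g) (simp add: del_gm_def ins_gm_def insert_absorb)

lemma mem_ins_gm: "z \<in> gm (ins_gm z g)"
  by (simp add: ins_gm_def)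

lemma mem_del_gm: "z \<notin> gm (del_gm z g)"
  by (simp add: del_gm_def)

lemma hdeg_ins_gm: "hdeg (ins_gm z g) = hdeg g"
  by (simp add: hdeg_def ins_gm_def)

lemma lab_ins_gm: "lab (ins_gm z g) = insert z (lab g)"
  by (simp add: lab_def ins_gm_def)

lemma sum_mark_gm:
  fixes F :: "('v::finite) gen \<Rightarrow> 'k::field"
  shows "(\<Sum>g\<in>UNIV. F g) = (\<Sum>g\<in>UNIV. if z \<in> gm g then 0 else F g + F (ins_gm z g))"
  by (rule sum_pairing[where d="del_gm z"]) (simp_all add: del_ins_gm ins_del_gm mem_ins_gm mem_del_gm)

lemma all_mark_gm:
  assumes P: "\<And>g. z \<notin> gm g \<Longrightarrow> P g" "\<And>g. z \<notin> gm g \<Longrightarrow> P (ins_gm z g)"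
  shows "P g"
proof (cases "z \<in> gm g")
  case True
  have "P (ins_gm z (del_gm z g))" by (rule P(2)) (simp add: del_gm_def)
  then show ?thesis using ins_del_gm[OF True] by simp
qed (rule P(1))

text \<open>This is what makes \<open>J\<close> the collection of supports of the monomials in a
  monomial ideal whose membership depends on supports alone.\<close>

definition up_closed :: "'v set set \<Rightarrow> bool" where
  "up_closed J \<longleftrightarrow> (\<forall>U\<in>J. \<forall>U'. U \<subseteq> U' \<longrightarrow> U' \<in> J)"

lemma up_closedD: "up_closed J \<Longrightarrow> U \<in> J \<Longrightarrow> U \<subseteq> U' \<Longrightarrow> U' \<in> J"
  unfolding up_closed_def by blast

text \<open>The connecting map of \<open>0 \<rightarrow> R/(I : x\<^sub>v)(-v) \<rightarrow> R/I \<rightarrow> R/(I + x\<^sub>v) \<rightarrow> 0\<close>, by recursion on the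
  homological degree.\<close>

lemma connecting_map:
  fixes D1 D2 :: "('v::finite) gen \<Rightarrow> 'v gen \<Rightarrow> 'k::field"
  assumes D1: "lres J1 G1 D1" and D2: "lres J2 G2 D2"
    and J1: "\<And>U. U \<in> J1 \<longleftrightarrow> insert v U \<in> J" and J2: "J2 = {U. U \<in> J \<or> v \<in> U}"
    and up: "up_closed J"
  shows "\<exists>t :: 'v gen \<Rightarrow> 'v gen \<Rightarrow> 'k. \<forall>g. (g \<notin> G2 \<longrightarrow> t g = (\<lambda>_. 0)) \<and> supp_in G1 (lab g - {v}) (t g) \<and>
    (v \<notin> lab g \<longrightarrow> t g = (\<lambda>_. 0)) \<and> (\<forall>h. t g h \<noteq> 0 \<longrightarrow> hdeg g = Suc (hdeg h)) \<and>
    (\<forall>h. bd D1 (t g) h = - (\<Sum>f\<in>UNIV. D2 f g * t f h)) \<and>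
    (lab g \<notin> J \<longrightarrow> aug (t g) = - aug (\<lambda>f. D2 f g))"
proof -
  note Dz1 = lresD[OF D1] and Dz2 = lresD[OF D2]
  define P where "P t g r \<longleftrightarrow> (g \<notin> G2 \<longrightarrow> r = (\<lambda>_. 0)) \<and> supp_in G1 (lab g - {v}) r \<and>
    (v \<notin> lab g \<longrightarrow> r = (\<lambda>_. 0)) \<and> (\<forall>h. r h \<noteq> 0 \<longrightarrow> hdeg g = Suc (hdeg h)) \<and>
    (\<forall>h. bd D1 r h = - (\<Sum>f\<in>UNIV. D2 f g * t f h)) \<and>
    (lab g \<notin> J \<longrightarrow> aug r = - aug (\<lambda>f. D2 f g))" for t :: "'v gen \<Rightarrow> 'v gen \<Rightarrow> 'k" and g r
  have bd0: "bd D1 (\<lambda>_. 0) h = 0" for h unfolding bd_def by simp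
  have aug0: "aug (\<lambda>_. 0 :: 'k) = 0" unfolding aug_def by simp
  have supp0: "supp_in G1 U (\<lambda>_. 0 :: 'k)" for U unfolding supp_in_def by simp
  have "\<exists>t. \<forall>g. P t g (t g)"
  proof (rule dependent_wf_choice[of "measure hdeg"])
    fix t t' :: "'v gen \<Rightarrow> 'v gen \<Rightarrow> 'k" and g r
    assume tt: "\<And>z. (z, g) \<in> measure hdeg \<Longrightarrow> t z = t' z"
    have eq: "D2 f g * t f h = D2 f g * t' f h" for f h
    proof (cases "D2 f g = 0")
      case False
      then have "t f = t' f" using Dz2(3)[OF False] by (intro tt) simp
      then show ?thesis by simp
    qed simp
    show "P t g r = P t' g r" by (simp only: P_def eq)
  next
    fix g and t :: "'v gen \<Rightarrow> 'v gen \<Rightarrow> 'k"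
    assume "\<And>y. (y, g) \<in> measure hdeg \<Longrightarrow> P t y (t y)"
    then have IH: "P t f (t f)" if "D2 f g \<noteq> 0" for f using Dz2(3)[OF that] by simp
    define z where "z h = (\<Sum>f\<in>UNIV. D2 f g * t f h)" for h
    show "\<exists>r. P t g r"
    proof (cases "g \<in> G2 \<and> v \<in> lab g")
      \<comment> \<open>The copy of \<open>R/(I : x_v)\<close> lives in degrees containing
        \<open>v\<close>, so outside them \<open>t\<close> must vanish. The condition on the
        augmentation then holds because \<open>lab g\<close> avoids \<open>J2\<close> as
        well.\<close>
      case False
      have "D2 f g * t f h = 0" for f h
      proof (cases "D2 f g = 0")
        case F: False
        then have "v \<notin> lab f" using False Dz2(2,4)[OF F] by blast
        then have "t f = (\<lambda>_. 0)" using IH[OF F] unfolding P_def by blast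
        then show ?thesis by simp
      qed simp
      moreover have "aug (\<lambda>f. D2 f g) = 0" if "lab g \<notin> J"
      proof (cases "g \<in> G2")
        case True
        then have "lab g \<notin> J2" using that False J2 by simp
        then show ?thesis by (rule Dz2(6))
      next
        case F: False
        then have "D2 f g = 0" for f using Dz2(2)[of f g] by blast
        then show ?thesis by (simp add: aug0)
      qed
      ultimately have "P t g (\<lambda>_. 0)" unfolding P_def by (simp add: bd0 aug0 supp0)
      then show ?thesis by blast
    next
      case True
      then have gG: "g \<in> G2" and vg: "v \<in> lab g" by simp_all
      \<comment> \<open>The marked copy of \<open>h\<close> has label
        \<open>insert v (lab h)\<close>, so in degree \<open>lab g\<close> the first complex is
        evaluated at \<open>lab g - {v}\<close>. That set is in \<open>J1\<close> exactly when
        \<open>lab g\<close> is in \<open>J\<close>.\<close>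
      let ?U = "lab g - {v}"
      have UJ: "?U \<in> J1 \<longleftrightarrow> lab g \<in> J" unfolding J1 using vg by (simp add: insert_absorb)
      have zsupp: "supp_in G1 ?U z" unfolding supp_in_def
      proof (intro allI impI)
        fix h assume "z h \<noteq> 0"
        then obtain f where f0: "D2 f g * t f h \<noteq> 0" unfolding z_def by (rule sum.not_neutral_contains_not_neutral)
        then have f: "D2 f g \<noteq> 0" "t f h \<noteq> 0" by auto
        have "supp_in G1 (lab f - {v}) (t f)" using IH[OF f(1)] unfolding P_def by simp
        then show "h \<in> G1 \<and> lab h \<subseteq> ?U" using f(2) Dz2(4)[OF f(1)] unfolding supp_in_def by blast
      qed
      have zdeg: "hdeg g = Suc (Suc (hdeg h))" if zh: "z h \<noteq> 0" for h
      proof -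
        obtain f where f0: "D2 f g * t f h \<noteq> 0" using zh unfolding z_def by (rule sum.not_neutral_contains_not_neutral)
        then have f: "D2 f g \<noteq> 0" "t f h \<noteq> 0" by auto
        have "hdeg f = Suc (hdeg h)" using IH[OF f(1)] f(2) unfolding P_def by simp
        then show ?thesis using Dz2(3)[OF f(1)] by simp
      qed
      \<comment> \<open>The induction hypothesis turns the boundary of \<open>z\<close> into a
        composite of two boundaries of the second complex. Hence the equation for \<open>t g\<close>
        can be solved by exactness of the first one.\<close>
      have bdz: "bd D1 z h = 0" for h
      proof -
        have "bd D1 z h = (\<Sum>f\<in>UNIV. D2 f g * bd D1 (t f) h)"
          unfolding z_def by (rule bd_sum_smult)
        also have "\<dots> = (\<Sum>f\<in>UNIV. D2 f g * - (\<Sum>e\<in>UNIV. D2 e f * t e h))"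
        proof (intro sum.cong refl)
          fix f show "D2 f g * bd D1 (t f) h = D2 f g * - (\<Sum>e\<in>UNIV. D2 e f * t e h)"
            using IH[of f] unfolding P_def by (cases "D2 f g = 0") simp_all
        qed
        also have "\<dots> = - (\<Sum>f\<in>UNIV. \<Sum>e\<in>UNIV. D2 e f * D2 f g * t e h)"
          unfolding mult_minus_right sum_negf sum_distrib_left by (simp add: mult_ac)
        also have "\<dots> = - (\<Sum>e\<in>UNIV. \<Sum>f\<in>UNIV. D2 e f * D2 f g * t e h)" by (subst sum.swap) (rule refl)
        also have "\<dots> = - (\<Sum>e\<in>UNIV. (\<Sum>f\<in>UNIV. D2 e f * D2 f g) * t e h)" unfolding sum_distrib_right ..
        finally show ?thesis unfolding Dz2(5) by simp
      qed
      have augz: "aug z = 0" if gJ: "lab g \<notin> J"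
      proof -
        have "aug z = (\<Sum>f\<in>UNIV. D2 f g * aug (t f))" unfolding z_def by (rule aug_sum_smult)
        also have "\<dots> = (\<Sum>f\<in>UNIV. D2 f g * - aug (\<lambda>e. D2 e f))"
        proof (intro sum.cong refl)
          fix f show "D2 f g * aug (t f) = D2 f g * - aug (\<lambda>e. D2 e f)"
          proof (cases "D2 f g = 0")
            case False
            then have "lab f \<notin> J" using up_closedD[OF up, of "lab f" "lab g"] Dz2(4)[OF False] gJ by blast
            then show ?thesis using IH[OF False] unfolding P_def by simp
          qed simp
        qed
        also have "\<dots> = - (\<Sum>f\<in>UNIV. D2 f g * aug (\<lambda>e. D2 e f))" by (simp add: sum_negf)
        also have "\<dots> = - aug (\<lambda>e. \<Sum>f\<in>UNIV. D2 f g * D2 e f)"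
          using aug_sum_smult[where A=UNIV and a="\<lambda>f. D2 f g" and t="\<lambda>f e. D2 e f"] by simp
        also have "(\<lambda>e. \<Sum>f\<in>UNIV. D2 f g * D2 e f) = (\<lambda>_. 0)"
          using Dz2(5) by (simp add: mult.commute)
        finally show ?thesis by (simp add: aug0)
      qed
      have m0: "supp_in G1 ?U (\<lambda>h. - z h)" using zsupp unfolding supp_in_def by simp
      have m1: "bd D1 (\<lambda>h. - z h) = (\<lambda>_. 0)"
        using bdz unfolding bd_def by (simp add: sum_negf)
      have m2: "aug (\<lambda>h. - z h) = 0" if "?U \<notin> J1"
        using augz that UJ aug_minus[of "\<lambda>_. 0" z] aug0 by simp
      obtain w0 where w0: "supp_in G1 ?U w0" "bd D1 w0 = (\<lambda>h. - z h)"
        using Dz1(8)[OF m0 m1 m2] by blast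
      obtain c1 :: "'v gen \<Rightarrow> 'k" where c1: "supp_in G1 ?U c1" "lab g \<notin> J \<Longrightarrow> aug c1 = 1"
        using Dz1(7)[of ?U] UJ supp0[of ?U] by (cases "lab g \<in> J") blast+
      \<comment> \<open>Exactness yields a chain with the prescribed boundary only; its augmentation
        is corrected by a multiple of the degree 0 part of \<open>c1\<close>, which does not affect
        the boundary.\<close>
      define a where "a = - aug (\<lambda>f. D2 f g) - aug w0"
      define w where "w h = w0 h + a * (if hdeg h = 0 then c1 h else 0)" for h
      have augw: "aug w = - aug (\<lambda>f. D2 f g)" if "lab g \<notin> J"
      proof -
        have "aug w = aug w0 + a * aug c1"
          unfolding aug_def sum_distrib_left sum.distrib[symmetric] by (intro sum.cong refl) (simp add: w_def)
        then show ?thesis using c1(2)[OF that] unfolding a_def by simp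
      qed
      have bdw: "bd D1 w h = - z h" for h
      proof -
        have "bd D1 w h = bd D1 w0 h"
          unfolding bd_def
        proof (intro sum.cong refl)
          fix f show "D1 h f * w f = D1 h f * w0 f"
            using Dz1(3)[of h f] unfolding w_def by (cases "D1 h f = 0") simp_all
        qed
        then show ?thesis using w0(2) by simp
      qed
      \<comment> \<open>The solution supplied by exactness need not be homogeneous. Only its
        component one degree below \<open>g\<close> is kept; \<open>z\<close> sits two degrees below
        \<open>g\<close>, so the equation survives.\<close>
      define r where "r h = (if hdeg g = Suc (hdeg h) then w h else 0)" for h
      have "supp_in G1 ?U r"
        using w0(1) c1(1) unfolding supp_in_def r_def w_def by (metis add_0 mult_zero_right)
      moreover have "bd D1 r h = - z h" for h
      proof (cases "hdeg g = Suc (Suc (hdeg h))")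
        case T: True
        have "bd D1 r h = bd D1 w h" unfolding bd_def
        proof (intro sum.cong refl)
          fix f show "D1 h f * r f = D1 h f * w f"
            using Dz1(3)[of h f] T unfolding r_def by (cases "D1 h f = 0") simp_all
        qed
        then show ?thesis using bdw by simp
      next
        case F: False
        have "D1 h f * r f = 0" for f
          using Dz1(3)[of h f] F unfolding r_def by (cases "D1 h f = 0") simp_all
        then have "bd D1 r h = 0" unfolding bd_def by simp
        moreover have "z h = 0" using zdeg[of h] F by blast
        ultimately show ?thesis by simp
      qed
      moreover have "aug r = - aug (\<lambda>f. D2 f g)" if gJ: "lab g \<notin> J"
      proof (cases "hdeg g = Suc 0")
        case T: True
        have "aug r = aug w" unfolding aug_def by (intro sum.cong refl) (simp add: r_def T)
        then show ?thesis using augw[OF gJ] by simp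
      next
        case F: False
        have "aug r = 0" unfolding aug_def by (intro sum.neutral ballI) (simp add: r_def F)
        moreover have "aug (\<lambda>f. D2 f g) = 0"
          unfolding aug_def
        proof (intro sum.neutral ballI)
          fix f show "(if hdeg f = 0 then D2 f g else 0) = 0"
            using F Dz2(3)[of f g] by (cases "D2 f g = 0") simp_all
        qed
        ultimately show ?thesis by simp
      qed
      ultimately have "P t g r"
        unfolding P_def using gG vg by (simp add: z_def r_def)
      then show ?thesis by blast
    qed
  qed simp
  then show ?thesis unfolding P_def .
qed

text \<open>The horseshoe for colon and sum: \<open>G2\<close> resolves the quotient by
  \<open>I + x_v\<close>, and the copies of \<open>G1\<close> resolve the shifted colon quotient.
  The copies carry \<open>v\<close> in \<open>gm\<close>, not in \<open>gs\<close>, because the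
  shift enlarges the multidegree and leaves the homological degree alone. \<open>f1\<close> and
  \<open>f2\<close> keep the copies distinct from each other and from \<open>G2\<close>.\<close>

lemma lres_horseshoe:
  fixes D1 D2 :: "('v::finite) gen \<Rightarrow> 'v gen \<Rightarrow> 'k::field"
  assumes D1: "lres J1 G1 D1" and D2: "lres J2 G2 D2"
    and J1: "\<And>U. U \<in> J1 \<longleftrightarrow> insert v U \<in> J" and J2: "J2 = {U. U \<in> J \<or> v \<in> U}"
    and up: "up_closed J"
    and f1: "\<forall>g\<in>G1. v \<notin> lab g" and f2: "\<forall>g\<in>G2. v \<notin> gm g"
  shows "\<exists>D :: 'v gen \<Rightarrow> 'v gen \<Rightarrow> 'k. lres J (G2 \<union> ins_gm v ` G1) D"
proof -
  let ?G = "G2 \<union> ins_gm v ` G1"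
  note Dz1 = lresD[OF D1] and Dz2 = lresD[OF D2]
  note f1 = bspec[OF f1] and f2 = bspec[OF f2]
  obtain t :: "'v gen \<Rightarrow> 'v gen \<Rightarrow> 'k" where
    t: "\<forall>g. (g \<notin> G2 \<longrightarrow> t g = (\<lambda>_. 0)) \<and> supp_in G1 (lab g - {v}) (t g) \<and>
      (v \<notin> lab g \<longrightarrow> t g = (\<lambda>_. 0)) \<and> (\<forall>h. t g h \<noteq> 0 \<longrightarrow> hdeg g = Suc (hdeg h)) \<and>
      (\<forall>h. bd D1 (t g) h = - (\<Sum>f\<in>UNIV. D2 f g * t f h)) \<and>
      (lab g \<notin> J \<longrightarrow> aug (t g) = - aug (\<lambda>f. D2 f g))"
    using connecting_map[OF D1 D2 J1 J2 up] by (elim exE)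
  have t1: "t g = (\<lambda>_. 0)" if "g \<notin> G2" for g using t that by blast
  have t2: "supp_in G1 (lab g - {v}) (t g)" for g using t by blast
  have t3: "t g = (\<lambda>_. 0)" if "v \<notin> lab g" for g using t that by blast
  have t4: "hdeg g = Suc (hdeg h)" if "t g h \<noteq> 0" for g h using t that by blast
  have t5: "bd D1 (t g) h = - (\<Sum>f\<in>UNIV. D2 f g * t f h)" for g h using t by blast
  have t6: "aug (t g) = - aug (\<lambda>f. D2 f g)" if "lab g \<notin> J" for g using t that by blast
  have m1: "D1 h g = 0" if "v \<in> gm h \<or> v \<in> gm g" for h g
  proof (rule ccontr)
    assume "D1 h g \<noteq> 0"
    then have "v \<notin> lab h" "v \<notin> lab g" using f1[OF Dz1(1)] f1[OF Dz1(2)] by simp_all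
    then show False using that unfolding lab_def by simp
  qed
  have m2: "D2 h g = 0" if "v \<in> gm h \<or> v \<in> gm g" for h g
  proof (rule ccontr)
    assume "D2 h g \<noteq> 0"
    then have "v \<notin> gm h" "v \<notin> gm g" using f2[OF Dz2(1)] f2[OF Dz2(2)] by simp_all
    then show False using that by simp
  qed
  have mt: "t g h = 0" if "v \<in> gm h \<or> v \<in> gm g" for g h
  proof (rule ccontr)
    assume a: "t g h \<noteq> 0"
    then have "h \<in> G1" using t2[of g] unfolding supp_in_def by blast
    moreover have "g \<in> G2" using a t1[of g] by metis
    ultimately have "v \<notin> lab h" "v \<notin> gm g" using f1 f2 by simp_all
    then show False using that unfolding lab_def by simp
  qed
  \<comment> \<open>Block triangular: \<open>D1\<close> on the copies, \<open>D2\<close> on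
    \<open>G2\<close>, and \<open>t\<close> leading from \<open>G2\<close> into the copies.\<close>
  define D where "D h g = (if v \<in> gm g then (if v \<in> gm h then D1 (del_gm v h) (del_gm v g) else 0)
      else (if v \<in> gm h then t g (del_gm v h) else D2 h g))" for h g
  note mem [simp] = mem_ins_gm[of v] and del [simp] = del_ins_gm[of v]
  have E1: "D h g = D2 h g" if "v \<notin> gm h" "v \<notin> gm g" for h g using that unfolding D_def by simp
  have E2: "D h (ins_gm v g) = 0" if "v \<notin> gm h" for h g using that unfolding D_def by simp
  have E3: "D (ins_gm v h) (ins_gm v g) = D1 h g" if "v \<notin> gm h" "v \<notin> gm g" for h g
    using that unfolding D_def by simp
  have E4: "D (ins_gm v h) g = t g h" if "v \<notin> gm h" "v \<notin> gm g" for h g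
    using that unfolding D_def by simp
  have b1: "bd D c h = bd D2 c h" if h: "v \<notin> gm h" for c h
    unfolding bd_def
  proof (intro sum.cong refl)
    fix g
    show "D h g * c g = D2 h g * c g"
      by (rule all_mark_gm[where z=v and g=g]) (use h E1 E2 m2 in simp_all)
  qed
  have b2: "bd D c (ins_gm v h) = bd D1 (\<lambda>g. c (ins_gm v g)) h + (\<Sum>g\<in>UNIV. t g h * c g)"
    if h: "v \<notin> gm h" for c h
  proof -
    have "bd D c (ins_gm v h) = (\<Sum>g\<in>UNIV. D1 h g * c (ins_gm v g) + t g h * c g)"
      unfolding bd_def
    proof (rule trans[OF sum_mark_gm[of _ v]], intro sum.cong refl)
      fix g
      show "(if v \<in> gm g then 0 else D (ins_gm v h) g * c g + D (ins_gm v h) (ins_gm v g) * c (ins_gm v g))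
        = D1 h g * c (ins_gm v g) + t g h * c g"
        using E3[OF h, of g] E4[OF h, of g] m1[of h g] mt[of h g] by (cases "v \<in> gm g") simp_all
    qed
    then show ?thesis unfolding sum.distrib bd_def .
  qed
  have aug_split: "aug c = aug (\<lambda>g. if v \<in> gm g then 0 else c g) + aug (\<lambda>g. if v \<in> gm g then 0 else c (ins_gm v g))"
    for c :: "'v gen \<Rightarrow> 'k"
    unfolding aug_def sum.distrib[symmetric]
    by (rule trans[OF sum_mark_gm[of _ v]], intro sum.cong refl) (simp add: hdeg_ins_gm)
  have cong2: "bd D2 c h = bd D2 c' h" if "\<And>g. v \<notin> gm g \<Longrightarrow> c g = c' g" for c c' h
    unfolding bd_def
  proof (intro sum.cong refl)
    fix g show "D2 h g * c g = D2 h g * c' g" using that[of g] m2[of h g] by (cases "v \<in> gm g") simp_all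
  qed
  have cong1: "bd D1 c h = bd D1 c' h" if "\<And>g. v \<notin> gm g \<Longrightarrow> c g = c' g" for c c' h
    unfolding bd_def
  proof (intro sum.cong refl)
    fix g show "D1 h g * c g = D1 h g * c' g" using that[of g] m1[of h g] by (cases "v \<in> gm g") simp_all
  qed
  have congt: "(\<Sum>g\<in>UNIV. t g h * c g) = (\<Sum>g\<in>UNIV. t g h * c' g)" if "\<And>g. v \<notin> gm g \<Longrightarrow> c g = c' g" for c c' h
  proof (intro sum.cong refl)
    fix g show "t g h * c g = t g h * c' g" using that[of g] mt[of h g] by (cases "v \<in> gm g") simp_all
  qed
  have dd1: "bd D1 (\<lambda>f. D1 f g) h = 0" for h g unfolding bd_def by (rule Dz1(5))
  have dd2: "bd D2 (\<lambda>f. D2 f g) h = 0" for h g unfolding bd_def by (rule Dz2(5))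
  have bd0: "bd D1 (\<lambda>_. 0) h = 0" "bd D2 (\<lambda>_. 0) h = 0" for h unfolding bd_def by simp_all
  show ?thesis
  proof (rule exI[of _ D], rule lresI)
    fix h g
    have "D h g \<noteq> 0 \<longrightarrow> h \<in> ?G \<and> g \<in> ?G \<and> hdeg g = Suc (hdeg h) \<and> lab h \<subseteq> lab g"
    proof (rule all_mark_gm[where z=v and g=g]; rule all_mark_gm[where z=v and g=h])
      fix h g :: "'v gen" assume hg: "v \<notin> gm g" "v \<notin> gm h"
      show "D h g \<noteq> 0 \<longrightarrow> h \<in> ?G \<and> g \<in> ?G \<and> hdeg g = Suc (hdeg h) \<and> lab h \<subseteq> lab g"
        unfolding E1[OF hg(2,1)] using Dz2(1-4)[of h g] by simp
      show "D h (ins_gm v g) \<noteq> 0 \<longrightarrow> h \<in> ?G \<and> ins_gm v g \<in> ?G \<and> hdeg (ins_gm v g) = Suc (hdeg h) \<and> lab h \<subseteq> lab (ins_gm v g)"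
        unfolding E2[OF hg(2)] by simp
      show "D (ins_gm v h) (ins_gm v g) \<noteq> 0 \<longrightarrow> ins_gm v h \<in> ?G \<and> ins_gm v g \<in> ?G \<and> hdeg (ins_gm v g) = Suc (hdeg (ins_gm v h)) \<and> lab (ins_gm v h) \<subseteq> lab (ins_gm v g)"
        unfolding E3[OF hg(2,1)] hdeg_ins_gm lab_ins_gm using Dz1(1-4)[of h g] by auto
      show "D (ins_gm v h) g \<noteq> 0 \<longrightarrow> ins_gm v h \<in> ?G \<and> g \<in> ?G \<and> hdeg g = Suc (hdeg (ins_gm v h)) \<and> lab (ins_gm v h) \<subseteq> lab g"
        unfolding E4[OF hg(2,1)] hdeg_ins_gm lab_ins_gm
      proof
        assume a: "t g h \<noteq> 0"
        have "h \<in> G1" "lab h \<subseteq> lab g - {v}" using a t2[of g] unfolding supp_in_def by blast+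
        moreover have "g \<in> G2" using a t1[of g] by metis
        moreover have "v \<in> lab g" using a t3[of g] by metis
        ultimately show "ins_gm v h \<in> ?G \<and> g \<in> ?G \<and> hdeg g = Suc (hdeg h) \<and> insert v (lab h) \<subseteq> lab g"
          using t4[OF a] by blast
      qed
    qed
    then show "D h g \<noteq> 0 \<Longrightarrow> h \<in> ?G \<and> g \<in> ?G \<and> hdeg g = Suc (hdeg h) \<and> lab h \<subseteq> lab g" by (rule mp)
  next
    fix h g
    have "bd D (\<lambda>f. D f g) h = 0"
    proof (rule all_mark_gm[where z=v and g=g]; rule all_mark_gm[where z=v and g=h])
      fix h g :: "'v gen" assume hg: "v \<notin> gm g" "v \<notin> gm h"
      have e1: "bd D2 (\<lambda>f. D f g) h = bd D2 (\<lambda>f. D2 f g) h" by (rule cong2) (rule E1[OF _ hg(1)])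
      show "bd D (\<lambda>f. D f g) h = 0" unfolding b1[OF hg(2)] e1 by (rule dd2)
      have e2: "bd D1 (\<lambda>f. D (ins_gm v f) g) h = bd D1 (t g) h" by (rule cong1) (rule E4[OF _ hg(1)])
      have e3: "(\<Sum>f\<in>UNIV. t f h * D f g) = (\<Sum>f\<in>UNIV. t f h * D2 f g)" by (rule congt) (rule E1[OF _ hg(1)])
      show "bd D (\<lambda>f. D f g) (ins_gm v h) = 0" unfolding b2[OF hg(2)] e2 e3 t5 by (simp add: mult.commute)
      have e4: "bd D2 (\<lambda>f. D f (ins_gm v g)) h = bd D2 (\<lambda>f. 0) h" by (rule cong2) (rule E2)
      show "bd D (\<lambda>f. D f (ins_gm v g)) h = 0" unfolding b1[OF hg(2)] e4 by (rule bd0)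
      have e5: "bd D1 (\<lambda>f. D (ins_gm v f) (ins_gm v g)) h = bd D1 (\<lambda>f. D1 f g) h" by (rule cong1) (rule E3[OF _ hg(1)])
      have e6: "(\<Sum>f\<in>UNIV. t f h * D f (ins_gm v g)) = (\<Sum>f\<in>UNIV. t f h * 0)" by (rule congt) (rule E2)
      show "bd D (\<lambda>f. D f (ins_gm v g)) (ins_gm v h) = 0" unfolding b2[OF hg(2)] e5 e6 dd1 by simp
    qed
    then show "(\<Sum>f\<in>UNIV. D h f * D f g) = 0" unfolding bd_def .
  next
    fix g
    have "lab g \<notin> J \<longrightarrow> aug (\<lambda>h. D h g) = 0"
    proof (rule all_mark_gm[where z=v and g=g])
      fix g :: "'v gen" assume g: "v \<notin> gm g"
      show "lab g \<notin> J \<longrightarrow> aug (\<lambda>h. D h g) = 0"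
      proof
        assume gJ: "lab g \<notin> J"
        have "(\<lambda>h. if v \<in> gm h then 0 else D h g) = (\<lambda>h. D2 h g)"
        proof
          fix h show "(if v \<in> gm h then 0 else D h g) = D2 h g" using E1[OF _ g, of h] m2[of h g] by simp
        qed
        moreover have "(\<lambda>h. if v \<in> gm h then 0 else D (ins_gm v h) g) = t g"
        proof
          fix h show "(if v \<in> gm h then 0 else D (ins_gm v h) g) = t g h" using E4[OF _ g, of h] mt[of h g] by simp
        qed
        ultimately show "aug (\<lambda>h. D h g) = 0" unfolding aug_split[of "\<lambda>h. D h g"] using t6[OF gJ] by simp
      qed
      show "lab (ins_gm v g) \<notin> J \<longrightarrow> aug (\<lambda>h. D h (ins_gm v g)) = 0"
      proof
        assume gJ: "lab (ins_gm v g) \<notin> J"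
        have "(\<lambda>h. if v \<in> gm h then 0 else D h (ins_gm v g)) = (\<lambda>h. 0)"
        proof
          fix h show "(if v \<in> gm h then 0 else D h (ins_gm v g)) = 0" using E2[of h g] by simp
        qed
        moreover have "(\<lambda>h. if v \<in> gm h then 0 else D (ins_gm v h) (ins_gm v g)) = (\<lambda>h. D1 h g)"
        proof
          fix h show "(if v \<in> gm h then 0 else D (ins_gm v h) (ins_gm v g)) = D1 h g" using E3[OF _ g, of h] m1[of h g] by simp
        qed
        moreover have "aug (\<lambda>h. D1 h g) = 0" by (rule Dz1(6)) (use gJ in \<open>simp add: J1 lab_ins_gm\<close>)
        ultimately show "aug (\<lambda>h. D h (ins_gm v g)) = 0"
          unfolding aug_split[of "\<lambda>h. D h (ins_gm v g)"] by (simp add: aug_def)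
      qed
    qed
    then show "lab g \<notin> J \<Longrightarrow> aug (\<lambda>h. D h g) = 0" by (rule mp)
  next
    fix U assume U: "U \<notin> J"
    show "\<exists>c. supp_in ?G U c \<and> aug c = (1::'k)"
    proof (cases "v \<in> U")
      case False
      then obtain c where "supp_in G2 U c" "aug c = (1::'k)" using Dz2(7)[of U] U J2 by auto
      then show ?thesis unfolding supp_in_def by blast
    next
      case True
      \<comment> \<open>Here \<open>U\<close> belongs to \<open>J2\<close>, so the second complex
        offers no chain of augmentation 1; one is taken from the colon complex and marked.\<close>
      then have "U - {v} \<notin> J1" using U unfolding J1 by (simp add: insert_absorb)
      then obtain c where c: "supp_in G1 (U - {v}) c" "aug c = (1::'k)" using Dz1(7)[of "U - {v}"] by blast
      define c' where "c' g = (if v \<in> gm g then c (del_gm v g) else 0)" for g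
      have c0: "c g = 0" if "v \<in> gm g" for g
        using c(1) f1[of g] that unfolding supp_in_def lab_def by blast
      have "(\<lambda>g. if v \<in> gm g then 0 else c' g) = (\<lambda>_. 0)" unfolding c'_def by auto
      moreover have "(\<lambda>g. if v \<in> gm g then 0 else c' (ins_gm v g)) = c"
        using c0 unfolding c'_def by auto
      ultimately have "aug c' = 1" unfolding aug_split[of c'] using c(2) by (simp add: aug_def)
      moreover have "c' g \<noteq> 0 \<longrightarrow> g \<in> ?G \<and> lab g \<subseteq> U" for g
      proof (rule all_mark_gm[where z=v and g=g])
        fix g :: "'v gen" assume g: "v \<notin> gm g"
        show "c' g \<noteq> 0 \<longrightarrow> g \<in> ?G \<and> lab g \<subseteq> U" using g unfolding c'_def by simp
        show "c' (ins_gm v g) \<noteq> 0 \<longrightarrow> ins_gm v g \<in> ?G \<and> lab (ins_gm v g) \<subseteq> U"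
          unfolding lab_ins_gm c'_def using g c(1) True unfolding supp_in_def by auto
      qed
      ultimately show ?thesis unfolding supp_in_def by blast
    qed
  next
    fix U :: "'v set" and c :: "'v gen \<Rightarrow> 'k"
    assume c: "supp_in ?G U c" "bd D c = (\<lambda>_. 0)" "U \<notin> J \<Longrightarrow> aug c = 0"
    define c2 where "c2 g = (if v \<in> gm g then 0 else c g)" for g
    define c1 where "c1 g = (if v \<in> gm g then 0 else c (ins_gm v g))" for g
    have ac: "aug c = aug c2 + aug c1" unfolding aug_split[of c] c1_def c2_def ..
    have s2: "supp_in G2 U c2"
      unfolding supp_in_def c2_def
    proof (intro allI impI)
      fix g assume "(if v \<in> gm g then 0 else c g) \<noteq> 0"
      then have g: "v \<notin> gm g" "c g \<noteq> 0" by (simp_all split: if_splits)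
      then have "g \<in> ?G" "lab g \<subseteq> U" using c(1) unfolding supp_in_def by blast+
      then show "g \<in> G2 \<and> lab g \<subseteq> U" using g(1) mem by blast
    qed
    have s1: "g \<in> G1 \<and> insert v (lab g) \<subseteq> U" if "c1 g \<noteq> 0" for g
    proof -
      have g: "v \<notin> gm g" "c (ins_gm v g) \<noteq> 0" using that unfolding c1_def by (simp_all split: if_splits)
      then have i: "ins_gm v g \<in> ?G" "insert v (lab g) \<subseteq> U" using c(1) lab_ins_gm[of v g] unfolding supp_in_def by metis+
      have "ins_gm v g \<notin> G2" using f2[of "ins_gm v g"] by auto
      then obtain g' where g': "ins_gm v g = ins_gm v g'" "g' \<in> G1" using i(1) by blast
      have "v \<notin> gm g'" using f1[OF g'(2)] unfolding lab_def by simp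
      then have "g = g'" using g'(1) del[OF g(1)] del[of g'] by metis
      then show ?thesis using g'(2) i(2) by simp
    qed
    have z2: "bd D2 c2 = (\<lambda>_. 0)"
    proof
      fix h
      show "bd D2 c2 h = 0"
      proof (cases "v \<in> gm h")
        case True then show ?thesis using m2 unfolding bd_def by simp
      next
        case False
        have "bd D2 c2 h = bd D2 c h" by (rule cong2) (simp add: c2_def)
        then show ?thesis using b1[OF False, of c] c(2) by simp
      qed
    qed
    have z1: "bd D1 c1 h = - (\<Sum>g\<in>UNIV. t g h * c2 g)" if h: "v \<notin> gm h" for h
    proof -
      have "bd D1 c1 h = bd D1 (\<lambda>g. c (ins_gm v g)) h" by (rule cong1) (simp add: c1_def)
      moreover have "(\<Sum>g\<in>UNIV. t g h * c2 g) = (\<Sum>g\<in>UNIV. t g h * c g)" by (rule congt) (simp add: c2_def)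
      ultimately show ?thesis using b2[OF h, of c] c(2) by (simp add: add_eq_0_iff)
    qed
    show "\<exists>w. supp_in ?G U w \<and> bd D w = c"
    proof (cases "v \<in> U")
      case False
      \<comment> \<open>No copy has a label inside \<open>U\<close>, so the whole problem is that of
        the second complex, and \<open>t\<close> vanishes on all labels that occur.\<close>
      have c10: "c1 g = 0" for g using s1[of g] False by blast
      have "aug c2 = 0" if "U \<notin> J2"
      proof -
        have "U \<notin> J" using that J2 by simp
        moreover have "aug c1 = 0" unfolding aug_def c10 by simp
        ultimately show ?thesis using c(3) ac by simp
      qed
      then obtain w where w: "supp_in G2 U w" "bd D2 w = c2" using Dz2(8)[OF s2 z2] by blast
      have wt: "t g h * w g = 0" for g h
      proof (cases "w g = 0")
        case F: False
        then have "v \<notin> lab g" using w(1) False unfolding supp_in_def by blast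
        then show ?thesis using t3 by simp
      qed simp
      have w0: "w (ins_gm v g) = 0" for g
        using w(1) False lab_ins_gm[of v g] unfolding supp_in_def by auto
      have "bd D w h = c h" for h
      proof (rule all_mark_gm[where z=v and g=h])
        fix h :: "'v gen" assume h: "v \<notin> gm h"
        show "bd D w h = c h" unfolding b1[OF h] w(2) using h by (simp add: c2_def)
        have "c (ins_gm v h) = 0" using c10[of h] h unfolding c1_def by simp
        then show "bd D w (ins_gm v h) = c (ins_gm v h)" unfolding b2[OF h] wt w0 bd0 by simp
      qed
      then have "bd D w = c" by (rule ext)
      moreover have "supp_in ?G U w" using w(1) unfolding supp_in_def by blast
      ultimately show ?thesis by blast
    next
      case True
      then have "U \<in> J2" using J2 by simp
      then obtain w2 where w2: "supp_in G2 U w2" "bd D2 w2 = c2" using Dz2(8)[OF s2 z2] by blast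
      \<comment> \<open>Since \<open>U \<in> J2\<close>, the unmarked part bounds some
        \<open>w2\<close> without any condition on its augmentation. What is left for the copies is
        the marked part of \<open>c\<close> corrected by the image of \<open>w2\<close> under
        \<open>t\<close>.\<close>
      define y where "y h = c1 h - (\<Sum>g\<in>UNIV. w2 g * t g h)" for h
      have supp_y: "supp_in G1 (U - {v}) y"
        unfolding supp_in_def
      proof (intro allI impI)
        fix h assume "y h \<noteq> 0"
        then have "c1 h \<noteq> 0 \<or> (\<Sum>g\<in>UNIV. w2 g * t g h) \<noteq> 0" unfolding y_def by auto
        then show "h \<in> G1 \<and> lab h \<subseteq> U - {v}"
        proof
          assume "c1 h \<noteq> 0"
          then show ?thesis using s1[of h] f1[of h] by blast
        next
          assume "(\<Sum>g\<in>UNIV. w2 g * t g h) \<noteq> 0"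
          then obtain g where "w2 g * t g h \<noteq> 0" by (rule sum.not_neutral_contains_not_neutral)
          then have g: "w2 g \<noteq> 0" "t g h \<noteq> 0" by auto
          have "lab g \<subseteq> U" using w2(1) g(1) unfolding supp_in_def by blast
          then show ?thesis using t2[of g] g(2) unfolding supp_in_def by blast
        qed
      qed
      have bd_y: "bd D1 y = (\<lambda>_. 0)"
      proof
        fix h
        show "bd D1 y h = 0"
        proof (cases "v \<in> gm h")
          case True then show ?thesis using m1 unfolding bd_def by simp
        next
          case False
          have "bd D1 (\<lambda>h. \<Sum>g\<in>UNIV. w2 g * t g h) h = (\<Sum>g\<in>UNIV. w2 g * bd D1 (t g) h)"
            by (rule bd_sum_smult)
          also have "\<dots> = - (\<Sum>g\<in>UNIV. \<Sum>f\<in>UNIV. t f h * (D2 f g * w2 g))"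
            unfolding t5 mult_minus_right sum_negf sum_distrib_left by (simp add: mult_ac)
          also have "\<dots> = - (\<Sum>f\<in>UNIV. \<Sum>g\<in>UNIV. t f h * (D2 f g * w2 g))" by (subst sum.swap) (rule refl)
          also have "\<dots> = - (\<Sum>f\<in>UNIV. t f h * bd D2 w2 f)" unfolding bd_def sum_distrib_left ..
          also have "\<dots> = - (\<Sum>f\<in>UNIV. t f h * c2 f)" unfolding w2(2) ..
          finally show ?thesis unfolding y_def bd_minus z1[OF False] by simp
        qed
      qed
      have aug_y: "aug y = 0" if "U - {v} \<notin> J1"
      proof -
        have UJ: "U \<notin> J" using that True unfolding J1 by (simp add: insert_absorb)
        have "aug (\<lambda>h. \<Sum>g\<in>UNIV. w2 g * t g h) = (\<Sum>g\<in>UNIV. w2 g * aug (t g))" by (rule aug_sum_smult)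
        also have "\<dots> = (\<Sum>g\<in>UNIV. w2 g * - aug (\<lambda>f. D2 f g))"
        proof (intro sum.cong refl)
          fix g show "w2 g * aug (t g) = w2 g * - aug (\<lambda>f. D2 f g)"
          proof (cases "w2 g = 0")
            case False
            then have "lab g \<subseteq> U" using w2(1) unfolding supp_in_def by blast
            then have "lab g \<notin> J" using UJ up_closedD[OF up, of "lab g" U] by blast
            then show ?thesis using t6[of g] by simp
          qed simp
        qed
        also have "\<dots> = - (\<Sum>g\<in>UNIV. w2 g * aug (\<lambda>f. D2 f g))" by (simp add: sum_negf)
        also have "\<dots> = - aug (\<lambda>f. \<Sum>g\<in>UNIV. w2 g * D2 f g)"
          using aug_sum_smult[where A=UNIV and a=w2 and t="\<lambda>g f. D2 f g"] by simp
        also have "(\<lambda>f. \<Sum>g\<in>UNIV. w2 g * D2 f g) = c2"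
          unfolding w2(2)[symmetric] bd_def by (simp add: mult.commute)
        \<comment> \<open>The compatibility of \<open>t\<close> with the augmentations turns the
          correction into \<open>aug c2\<close>; so only the total augmentation of \<open>c\<close>,
          which is zero, has to vanish.\<close>
        finally have "aug y = aug c1 + aug c2" unfolding y_def aug_minus by simp
        then show ?thesis using c(3)[OF UJ] ac by (simp add: add.commute)
      qed
      obtain w1 where w1: "supp_in G1 (U - {v}) w1" "bd D1 w1 = y"
        using Dz1(8)[OF supp_y bd_y aug_y] by blast
      define w where "w g = (if v \<in> gm g then w1 (del_gm v g) else w2 g)" for g
      have wi: "w (ins_gm v g) = w1 g" if "v \<notin> gm g" for g using that unfolding w_def by simp
      have wu: "w g = w2 g" if "v \<notin> gm g" for g using that unfolding w_def by simp
      have "w g \<noteq> 0 \<longrightarrow> g \<in> ?G \<and> lab g \<subseteq> U" for g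
      proof (rule all_mark_gm[where z=v and g=g])
        fix g :: "'v gen" assume g: "v \<notin> gm g"
        show "w g \<noteq> 0 \<longrightarrow> g \<in> ?G \<and> lab g \<subseteq> U" unfolding wu[OF g] using w2(1) unfolding supp_in_def by blast
        show "w (ins_gm v g) \<noteq> 0 \<longrightarrow> ins_gm v g \<in> ?G \<and> lab (ins_gm v g) \<subseteq> U"
          unfolding wi[OF g] lab_ins_gm using w1(1) True unfolding supp_in_def by blast
      qed
      then have "supp_in ?G U w" unfolding supp_in_def by (rule allI)
      moreover have "bd D w h = c h" for h
      proof (rule all_mark_gm[where z=v and g=h])
        fix h :: "'v gen" assume h: "v \<notin> gm h"
        have "bd D2 w h = bd D2 w2 h" by (rule cong2) (rule wu)
        then show "bd D w h = c h" unfolding b1[OF h] w2(2) using h by (simp add: c2_def)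
        have "bd D1 (\<lambda>g. w (ins_gm v g)) h = bd D1 w1 h" by (rule cong1) (rule wi)
        moreover have "(\<Sum>g\<in>UNIV. t g h * w g) = (\<Sum>g\<in>UNIV. t g h * w2 g)" by (rule congt) (rule wu)
        ultimately show "bd D w (ins_gm v h) = c (ins_gm v h)"
          unfolding b2[OF h] w1(2) y_def c1_def using h by (simp add: mult.commute)
      qed
      then have "bd D w = c" by (rule ext)
      ultimately show ?thesis by blast
    qed
  qed
qed

section \<open>Adjoining a set of variables, and the start of the construction\<close>

definition add_gs :: "'v set \<Rightarrow> 'v gen \<Rightarrow> 'v gen" where
  "add_gs T g = Gen (gm g) (gs g \<union> T)"

text \<open>Generators of the tensor product with the Koszul complex on \<open>Z\<close>;
  \<open>T\<close> is the exterior part, disjoint from \<open>gs g\<close> in all uses.\<close>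

definition add_vars :: "'v set \<Rightarrow> 'v gen set \<Rightarrow> 'v gen set" where
  "add_vars Z G = (\<lambda>(g, T). add_gs T g) ` (G \<times> Pow Z)"

lemma add_varsE:
  assumes "h \<in> add_vars Z G"
  obtains g T where "g \<in> G" "T \<subseteq> Z" "h = add_gs T g"
proof -
  obtain p where p: "h = (\<lambda>(g, T). add_gs T g) p" "p \<in> G \<times> Pow Z"
    using assms unfolding add_vars_def by (rule imageE)
  show thesis by (rule that[of "fst p" "snd p"]) (use p in auto)
qed

lemma add_varsI: "g \<in> G \<Longrightarrow> T \<subseteq> Z \<Longrightarrow> add_gs T g \<in> add_vars Z G"
  unfolding add_vars_def by (rule image_eqI[of _ _ "(g, T)"]) simp_all

lemma lab_add_gs: "lab (add_gs T g) = lab g \<union> T"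
  unfolding lab_def add_gs_def by auto

lemma add_vars_insert: "add_vars (insert z Z) G = add_vars Z G \<union> ins_gs z ` add_vars Z G"
proof (intro subset_antisym subsetI)
  fix h assume "h \<in> add_vars (insert z Z) G"
  then obtain g T where h: "g \<in> G" "T \<subseteq> insert z Z" "h = add_gs T g" by (rule add_varsE)
  show "h \<in> add_vars Z G \<union> ins_gs z ` add_vars Z G"
  proof (cases "z \<in> T")
    case True
    then have "T = insert z (T - {z})" by blast
    then have "gs g \<union> T = insert z (gs g \<union> (T - {z}))" by blast
    then have "h = ins_gs z (add_gs (T - {z}) g)" unfolding h(3) by (simp add: ins_gs_def add_gs_def)
    moreover have "add_gs (T - {z}) g \<in> add_vars Z G" by (rule add_varsI) (use h in auto)
    ultimately show ?thesis by blast
  next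
    case False
    then have "h \<in> add_vars Z G" unfolding h(3) by (intro add_varsI) (use h in auto)
    then show ?thesis by simp
  qed
next
  fix h assume "h \<in> add_vars Z G \<union> ins_gs z ` add_vars Z G"
  then show "h \<in> add_vars (insert z Z) G"
  proof
    assume "h \<in> add_vars Z G"
    then obtain g T where h: "g \<in> G" "T \<subseteq> Z" "h = add_gs T g" by (rule add_varsE)
    show ?thesis unfolding h(3) by (rule add_varsI) (use h in auto)
  next
    assume "h \<in> ins_gs z ` add_vars Z G"
    then obtain h' where h': "h = ins_gs z h'" "h' \<in> add_vars Z G" by (rule imageE)
    from h'(2) obtain g T where h: "g \<in> G" "T \<subseteq> Z" "h' = add_gs T g" by (rule add_varsE)
    have "h = add_gs (insert z T) g" unfolding h'(1) h(3) by (simp add: ins_gs_def add_gs_def)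
    moreover have "add_gs (insert z T) g \<in> add_vars (insert z Z) G" by (rule add_varsI) (use h in auto)
    ultimately show ?thesis by simp
  qed
qed

lemma lres_add_vars:
  fixes D :: "('v::finite) gen \<Rightarrow> 'v gen \<Rightarrow> 'k::field"
  assumes D: "lres J G D" and Z: "\<forall>g\<in>G. lab g \<inter> Z = {}"
  shows "\<exists>D' :: 'v gen \<Rightarrow> 'v gen \<Rightarrow> 'k. lres {U. U \<in> J \<or> U \<inter> Z \<noteq> {}} (add_vars Z G) D'"
proof -
  have "finite Z" by simp
  then show ?thesis using Z
  proof (induction Z)
    case empty
    have "add_gs {} g = g" for g :: "'v gen" unfolding add_gs_def by simp
    then have "add_vars {} G = G" unfolding add_vars_def by (auto simp: image_iff)
    then show ?case using D by auto
  next
    case (insert z Z)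
    have "\<forall>g\<in>G. lab g \<inter> Z = {}" using insert.prems by blast
    from insert.IH[OF this] obtain D' :: "'v gen \<Rightarrow> 'v gen \<Rightarrow> 'k"
      where D': "lres {U. U \<in> J \<or> U \<inter> Z \<noteq> {}} (add_vars Z G) D'"
      by (elim exE)
    have "\<forall>h\<in>add_vars Z G. z \<notin> lab h"
    proof
      fix h assume h: "h \<in> add_vars Z G"
      obtain g T where g: "g \<in> G" "T \<subseteq> Z" "h = add_gs T g" using h by (rule add_varsE)
      show "z \<notin> lab h" unfolding g(3) lab_add_gs using insert.prems g(1,2) insert.hyps(2) by blast
    qed
    from lres_cone[OF D' this] obtain D'' :: "'v gen \<Rightarrow> 'v gen \<Rightarrow> 'k"
      where "lres {U. U \<in> {U. U \<in> J \<or> U \<inter> Z \<noteq> {}} \<or> z \<in> U} (add_vars Z G \<union> ins_gs z ` add_vars Z G) D''"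
      by (elim exE)
    moreover have "{U. U \<in> {U. U \<in> J \<or> U \<inter> Z \<noteq> {}} \<or> z \<in> U} = {U. U \<in> J \<or> U \<inter> insert z Z \<noteq> {}}"
      by auto
    ultimately show ?case unfolding add_vars_insert by auto
  qed
qed

text \<open>The ring itself, resolved by one generator of degree 0; the zero ideal corresponds to
  the empty family of supports.\<close>

lemma lres_trivial:
  shows "lres {} {Gen {} {}} (\<lambda>(_ :: ('v::finite) gen) _. 0 :: 'k::field)"
proof (rule lresI)
  let ?e = "Gen {} {} :: 'v gen"
  have aug_e: "aug c = c ?e" if c: "\<And>g. c g \<noteq> 0 \<Longrightarrow> g = ?e" for c :: "'v gen \<Rightarrow> 'k"
  proof -
    have "aug c = (\<Sum>g\<in>UNIV. if g = ?e then c ?e else 0)"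
      unfolding aug_def
    proof (intro sum.cong refl)
      fix g show "(if hdeg g = 0 then c g else 0) = (if g = ?e then c ?e else 0)"
        using c[of g] by (cases "g = ?e") (auto simp: hdeg_def)
    qed
    then show ?thesis by simp
  qed
  fix U :: "'v set"
  show "\<exists>c. supp_in {?e} U c \<and> aug c = (1::'k)"
    by (rule exI[of _ "\<lambda>g. if g = ?e then 1 else 0"], subst aug_e)
      (auto simp: supp_in_def lab_def split: if_splits)
  fix c :: "'v gen \<Rightarrow> 'k"
  assume c: "supp_in {?e} U c" "U \<notin> {} \<Longrightarrow> aug c = 0"
  have s: "g = ?e" if "c g \<noteq> 0" for g using c(1) that unfolding supp_in_def by blast
  have "c ?e = 0" using c(2) aug_e[of c] s by simp
  then have "c g = 0" for g using s[of g] by (cases "c g = 0") auto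
  then have "c = (\<lambda>_. 0)" by (rule ext)
  then show "\<exists>w. supp_in {?e} U w \<and> bd (\<lambda>_ _. 0) w = c"
    by (intro exI[of _ "\<lambda>_. 0"]) (simp add: supp_in_def bd_def fun_eq_iff)
qed (simp_all add: aug_def)

section \<open>Resolving the edge ideal\<close>

context finite_preorder
begin

text \<open>Supports of the monomials in the edge ideal of the subgraph on the pairs indexed by
  \<open>Q\<close>.\<close>

definition edgeJ :: "'n set \<Rightarrow> 'n vertex set set" where
  "edgeJ Q = {U. \<exists>i\<in>Q. \<exists>j\<in>Q. le i j \<and> X i \<in> U \<and> Y j \<in> U}"

definition W :: "'n set \<Rightarrow> 'n set \<Rightarrow> 'n vertex set" where
  "W Q D = X ` {i \<in> Q. \<forall>d\<in>D. le d i \<longrightarrow> le i d} \<union> Y ` {j \<in> Q. \<exists>d\<in>D. le d j}"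

text \<open>A generator whose mark is \<open>X ` M\<close> has homological degree at most
  \<open>|Q| + excess M\<close>. The set \<open>W Q D\<close> is the label of the generator that attains the bound for \<open>D\<close>.\<close>

definition bounded_gens :: "'n set \<Rightarrow> 'n vertex gen set \<Rightarrow> bool" where
  "bounded_gens Q G \<longleftrightarrow> (\<forall>g\<in>G. \<exists>Z M. gs g \<subseteq> Z \<and> Z \<subseteq> X ` Q \<union> Y ` Q \<and> gm g = X ` M \<and> M \<subseteq> Q \<and>
     antichain M \<and> Y ` M \<subseteq> Z \<and> Z \<inter> X ` M = {} \<and> card Z \<le> card Q + excess M)"

definition has_top :: "'n set \<Rightarrow> 'n vertex gen set \<Rightarrow> 'n set \<Rightarrow> bool" where
  "has_top Q G D \<longleftrightarrow> (\<exists>g\<in>G. lab g = W Q D \<and> hdeg g = card Q + excess D)"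

lemma bounded_gensE:
  assumes "bounded_gens Q G" "g \<in> G"
  obtains Z M where "gs g \<subseteq> Z" "Z \<subseteq> X ` Q \<union> Y ` Q" "gm g = X ` M" "M \<subseteq> Q"
     "antichain M" "Y ` M \<subseteq> Z" "Z \<inter> X ` M = {}" "card Z \<le> card Q + excess M"
proof -
  have "\<exists>Z M. gs g \<subseteq> Z \<and> Z \<subseteq> X ` Q \<union> Y ` Q \<and> gm g = X ` M \<and> M \<subseteq> Q \<and>
     antichain M \<and> Y ` M \<subseteq> Z \<and> Z \<inter> X ` M = {} \<and> card Z \<le> card Q + excess M"
    using assms unfolding bounded_gens_def by (rule bspec)
  then show thesis by (elim exE conjE) (rule that)
qed

lemma bounded_gens_lab:
  assumes "bounded_gens Q G" "g \<in> G" shows "lab g \<subseteq> X ` Q \<union> Y ` Q"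
proof -
  obtain Z M where "gs g \<subseteq> Z" "Z \<subseteq> X ` Q \<union> Y ` Q" "gm g = X ` M" "M \<subseteq> Q" "antichain M" "Y ` M \<subseteq> Z"
    "Z \<inter> X ` M = {}" "card Z \<le> card Q + excess M"
    by (rule bounded_gensE[OF assms])
  then show ?thesis unfolding lab_def by blast
qed

lemma excess_insert: "v \<notin> M \<Longrightarrow> excess (insert v M) = excess M + (card (cl v) - 1)"
  unfolding excess_def by (simp add: add.commute)

lemma card_XY: "card (X ` P \<union> Y ` U) = card P + card U" for P U :: "'n set"
proof -
  have "card (X ` P \<union> Y ` U) = card (X ` P) + card (Y ` U)" by (rule card_Un_disjoint) auto
  then show ?thesis by (simp add: card_image inj_on_def)
qed

lemma up_closed_edge: "up_closed {V. V \<in> edgeJ Q \<or> V \<inter> S \<noteq> {}}"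
  unfolding up_closed_def edgeJ_def by blast

text \<open>For \<open>i\<close> minimal in \<open>Q\<close>, the variables \<open>X v\<close> with \<open>v \<in> cl i\<close> are adjoined one at a time to
  \<open>edgeJ Q\<close>. Colon by \<open>X v\<close> removes everything above \<open>i\<close> from \<open>Q\<close> and adds variables, so the outer
  induction applies to it.\<close>

lemma edge_step:
  fixes Q :: "'n set"
  assumes Qcl: "\<And>i. i \<in> Q \<Longrightarrow> cl i \<subseteq> Q"
    and i: "i \<in> Q" "\<And>j. j \<in> Q \<Longrightarrow> le j i \<Longrightarrow> le i j"
    and IH: "\<And>Q'. Q' \<subset> Q \<Longrightarrow> \<forall>i\<in>Q'. cl i \<subseteq> Q' \<Longrightarrow>
      \<exists>G (D :: 'n vertex gen \<Rightarrow> 'n vertex gen \<Rightarrow> 'k::field).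
        lres (edgeJ Q') G D \<and> bounded_gens Q' G \<and> (\<forall>D\<subseteq>Q'. antichain D \<longrightarrow> has_top Q' G D)"
    and P: "P \<subseteq> cl i"
  shows "\<exists>G (D :: 'n vertex gen \<Rightarrow> 'n vertex gen \<Rightarrow> 'k).
      lres {V. V \<in> edgeJ Q \<or> V \<inter> X ` P \<noteq> {}} G D \<and> bounded_gens Q G \<and> (\<forall>g\<in>G. gm g \<inter> X ` P = {}) \<and>
      (\<forall>D\<subseteq>Q. antichain D \<longrightarrow> (P = cl i \<longrightarrow> D \<inter> cl i = {}) \<longrightarrow> has_top Q G D)"
  using P
\<comment> \<open>The induction runs downwards in \<open>P\<close>. It starts where the whole class
  has been adjoined, and the result for \<open>P\<close> is glued from the one for
  \<open>insert v P\<close> and from a colon ideal.\<close>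
proof (induction "card (cl i - P)" arbitrary: P rule: less_induct)
  case less
  let ?C = "cl i"
  have CQ: "?C \<subseteq> Q" using Qcl i(1) by blast
  have minC: "j \<in> ?C" if "j \<in> Q" "k \<in> ?C" "le j k" for j k
  proof -
    have "le j i" using that le_trans unfolding cl_def by blast
    then show ?thesis using i(2) that(1) unfolding cl_def by blast
  qed
  show ?case
  proof (cases "P = ?C")
    case True
    have QC: "Q - ?C \<subset> Q" using i(1) cl_self by blast
    have QC': "\<forall>j\<in>Q - ?C. cl j \<subseteq> Q - ?C"
    proof
      fix j assume j: "j \<in> Q - ?C"
      have "k \<notin> ?C" if "k \<in> cl j" for k
      proof
        assume "k \<in> ?C"
        then have "cl j = cl i" using that cl_eq by metis
        then show False using j cl_self by blast
      qed
      then show "cl j \<subseteq> Q - ?C" using Qcl[of j] j by blast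
    qed
    from IH[OF QC QC'] obtain G and D0 :: "'n vertex gen \<Rightarrow> 'n vertex gen \<Rightarrow> 'k" where
      G: "lres (edgeJ (Q - ?C)) G D0" "bounded_gens (Q - ?C) G" "\<forall>D\<subseteq>Q - ?C. antichain D \<longrightarrow> has_top (Q - ?C) G D"
      by (elim exE conjE)
    have lG: "lab g \<subseteq> X ` (Q - ?C) \<union> Y ` (Q - ?C)" if "g \<in> G" for g by (rule bounded_gens_lab[OF G(2) that])
    have "\<forall>g\<in>G. lab g \<inter> X ` ?C = {}" using lG by blast
    from lres_add_vars[OF G(1) this] obtain D1 :: "'n vertex gen \<Rightarrow> 'n vertex gen \<Rightarrow> 'k" where
      D1: "lres {U. U \<in> edgeJ (Q - ?C) \<or> U \<inter> X ` ?C \<noteq> {}} (add_vars (X ` ?C) G) D1" by (elim exE)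
    \<comment> \<open>Minimality of the class enters: an edge ending in \<open>Y j\<close> with
      \<open>j\<close> in the class starts at an \<open>X\<close>-vertex of the class. Once these
      \<open>X\<close>-variables are adjoined, only edges among the remaining pairs matter.\<close>
    have "V \<in> edgeJ (Q - ?C) \<or> V \<inter> X ` ?C \<noteq> {} \<longleftrightarrow> V \<in> edgeJ Q \<or> V \<inter> X ` P \<noteq> {}" for V
      unfolding True edgeJ_def using minC by blast
    then have J: "{U. U \<in> edgeJ (Q - ?C) \<or> U \<inter> X ` ?C \<noteq> {}} = {V. V \<in> edgeJ Q \<or> V \<inter> X ` P \<noteq> {}}" by simp
    have cQ: "card Q = card (Q - ?C) + card ?C" using CQ by (metis card_Diff_subset card_mono finite le_add_diff_inverse2)
    have b: "bounded_gens Q (add_vars (X ` ?C) G)"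
      unfolding bounded_gens_def
    proof
      fix h assume "h \<in> add_vars (X ` ?C) G"
      then obtain g T where g: "g \<in> G" "T \<subseteq> X ` ?C" "h = add_gs T g" by (rule add_varsE)
      obtain Z M where ZM: "gs g \<subseteq> Z" "Z \<subseteq> X ` (Q - ?C) \<union> Y ` (Q - ?C)" "gm g = X ` M" "M \<subseteq> Q - ?C"
         "antichain M" "Y ` M \<subseteq> Z" "Z \<inter> X ` M = {}" "card Z \<le> card (Q - ?C) + excess M"
        by (rule bounded_gensE[OF G(2) g(1)])
      have "card (Z \<union> X ` ?C) \<le> card Z + card (X ` ?C)" by (rule card_Un_le)
      then have c: "card (Z \<union> X ` ?C) \<le> card Q + excess M" using ZM(8) cQ by simp
      show "\<exists>Z M. gs h \<subseteq> Z \<and> Z \<subseteq> X ` Q \<union> Y ` Q \<and> gm h = X ` M \<and> M \<subseteq> Q \<and>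
         antichain M \<and> Y ` M \<subseteq> Z \<and> Z \<inter> X ` M = {} \<and> card Z \<le> card Q + excess M"
        by (rule exI[of _ "Z \<union> X ` ?C"], rule exI[of _ M])
          (use ZM g CQ c in \<open>auto simp: add_gs_def\<close>)
    qed
    have m: "gm h \<inter> X ` P = {}" if h: "h \<in> add_vars (X ` ?C) G" for h
    proof -
      obtain g T where g: "g \<in> G" "T \<subseteq> X ` ?C" "h = add_gs T g" by (rule add_varsE[OF h])
      have "gm h \<subseteq> lab g" unfolding g(3) add_gs_def lab_def by simp
      then show ?thesis using lG[OF g(1)] True by blast
    qed
    have top: "has_top Q (add_vars (X ` ?C) G) D" if D: "D \<subseteq> Q" "antichain D" "D \<inter> ?C = {}" for D
    proof -
      have "has_top (Q - ?C) G D" using G(3) D by blast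
      then obtain g where g: "g \<in> G" "lab g = W (Q - ?C) D" "hdeg g = card (Q - ?C) + excess D"
        unfolding has_top_def by blast
      have "lab (add_gs (X ` ?C) g) = W Q D"
      proof -
        \<comment> \<open>Nothing in \<open>D\<close> lies below the class, so passing from
          \<open>Q - cl i\<close> to \<open>Q\<close> adds to \<open>W\<close> precisely the
          \<open>X\<close>-vertices of the class.\<close>
        have "\<not> le d k" if "d \<in> D" "k \<in> ?C" for d k using minC[of d k] that D by blast
        then show ?thesis unfolding lab_add_gs g(2) W_def using CQ by blast
      qed
      moreover have "hdeg (add_gs (X ` ?C) g) = card Q + excess D"
      proof -
        have "gs g \<inter> X ` ?C = {}" using lG[OF g(1)] unfolding lab_def by blast
        then have "card (gs g \<union> X ` ?C) = card (gs g) + card ?C" by (simp add: card_Un_disjoint)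
        then show ?thesis using g(3) cQ unfolding hdeg_def add_gs_def by simp
      qed
      moreover have "add_gs (X ` ?C) g \<in> add_vars (X ` ?C) G" by (rule add_varsI[OF g(1)]) simp
      ultimately show ?thesis unfolding has_top_def by blast
    qed
    show ?thesis
      by (rule exI[of _ "add_vars (X ` ?C) G"], rule exI[of _ D1])
        (use D1 b m top True in \<open>simp add: J\<close>)
  next
    case False
    then obtain v where v: "v \<in> ?C" "v \<notin> P" using less.prems by blast
    \<comment> \<open>For \<open>j\<close> above the class the product of \<open>X v\<close> and
      \<open>Y j\<close> is an edge, so the colon by \<open>X v\<close> contains \<open>Y j\<close>
      for all \<open>j \<in> U\<close>. The pairs in \<open>U\<close> then drop out of the edge
      ideal.\<close>
    define U where "U = {j \<in> Q. le i j}"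
    have CU: "?C \<subseteq> U" using CQ unfolding U_def cl_def by blast
    have clv: "cl v = ?C" using v(1) by (rule cl_eq)
    have Uv: "j \<in> U \<longleftrightarrow> j \<in> Q \<and> le v j" for j
      using v(1) le_trans unfolding U_def cl_def by blast
    have PQ: "P \<subseteq> U" using less.prems CU by blast
    have "?C - insert v P \<subset> ?C - P" using v by blast
    then have "card (?C - insert v P) < card (?C - P)" by (intro psubset_card_mono) simp_all
    then have "\<exists>G (D :: 'n vertex gen \<Rightarrow> 'n vertex gen \<Rightarrow> 'k).
      lres {V. V \<in> edgeJ Q \<or> V \<inter> X ` insert v P \<noteq> {}} G D \<and> bounded_gens Q G \<and> (\<forall>g\<in>G. gm g \<inter> X ` insert v P = {}) \<and>
      (\<forall>D\<subseteq>Q. antichain D \<longrightarrow> (insert v P = ?C \<longrightarrow> D \<inter> ?C = {}) \<longrightarrow> has_top Q G D)"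
      by (rule less.hyps) (use v less.prems in blast)
    then obtain G2 and D2 :: "'n vertex gen \<Rightarrow> 'n vertex gen \<Rightarrow> 'k" where
      G2: "lres {V. V \<in> edgeJ Q \<or> V \<inter> X ` insert v P \<noteq> {}} G2 D2" "bounded_gens Q G2"
        "\<forall>g\<in>G2. gm g \<inter> X ` insert v P = {}"
        "\<forall>D\<subseteq>Q. antichain D \<longrightarrow> (insert v P = ?C \<longrightarrow> D \<inter> ?C = {}) \<longrightarrow> has_top Q G2 D"
      by (elim exE conjE)
    have QU: "Q - U \<subset> Q" using i(1) le_refl unfolding U_def by blast
    have QU': "\<forall>j\<in>Q - U. cl j \<subseteq> Q - U"
      using Qcl le_trans unfolding U_def cl_def by blast
    from IH[OF QU QU'] obtain G and D0 :: "'n vertex gen \<Rightarrow> 'n vertex gen \<Rightarrow> 'k" where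
      G: "lres (edgeJ (Q - U)) G D0" "bounded_gens (Q - U) G" "\<forall>D\<subseteq>Q - U. antichain D \<longrightarrow> has_top (Q - U) G D"
      by (elim exE conjE)
    have lG: "lab g \<subseteq> X ` (Q - U) \<union> Y ` (Q - U)" if "g \<in> G" for g by (rule bounded_gens_lab[OF G(2) that])
    let ?S = "X ` P \<union> Y ` U"
    let ?G1 = "add_vars ?S G"
    have "\<forall>g\<in>G. lab g \<inter> ?S = {}" using lG PQ by blast
    from lres_add_vars[OF G(1) this] obtain D1 :: "'n vertex gen \<Rightarrow> 'n vertex gen \<Rightarrow> 'k" where
      D1: "lres {V. V \<in> edgeJ (Q - U) \<or> V \<inter> ?S \<noteq> {}} ?G1 D1" by (elim exE)
    have vUQ: "v \<in> U" "v \<in> Q" using v(1) CU CQ by blast+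
    \<comment> \<open>The colon by \<open>X v\<close>: an edge ending outside \<open>U\<close> also
      starts outside \<open>U\<close>, because \<open>U\<close> is closed upwards in
      \<open>Q\<close>. Such an edge does not involve \<open>X v\<close> and remains an edge over
      \<open>Q - U\<close>.\<close>
    have J1: "V \<in> {V. V \<in> edgeJ (Q - U) \<or> V \<inter> ?S \<noteq> {}} \<longleftrightarrow> insert (X v) V \<in> {V. V \<in> edgeJ Q \<or> V \<inter> X ` P \<noteq> {}}" for V
    proof
      assume "V \<in> {V. V \<in> edgeJ (Q - U) \<or> V \<inter> ?S \<noteq> {}}"
      then consider "V \<in> edgeJ (Q - U)" | "V \<inter> X ` P \<noteq> {}" | j where "j \<in> U" "Y j \<in> V" by blast
      then show "insert (X v) V \<in> {V. V \<in> edgeJ Q \<or> V \<inter> X ` P \<noteq> {}}"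
      proof cases
        case 1 then show ?thesis unfolding edgeJ_def by blast
      next
        case 2 then show ?thesis by blast
      next
        case 3
        then have "insert (X v) V \<in> edgeJ Q" unfolding edgeJ_def using Uv[of j] vUQ by blast
        then show ?thesis by simp
      qed
    next
      assume "insert (X v) V \<in> {V. V \<in> edgeJ Q \<or> V \<inter> X ` P \<noteq> {}}"
      then consider a b where "a \<in> Q" "b \<in> Q" "le a b" "X a \<in> insert (X v) V" "Y b \<in> V" | "V \<inter> X ` P \<noteq> {}"
        using v(2) unfolding edgeJ_def by blast
      then show "V \<in> {V. V \<in> edgeJ (Q - U) \<or> V \<inter> ?S \<noteq> {}}"
      proof cases
        case 1
        show ?thesis
        proof (cases "b \<in> U")
          case True then show ?thesis using 1 by blast
        next
          case bU: False
          have "a \<notin> U" using 1 bU le_trans unfolding U_def by blast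
          then have "X a \<in> V" using 1 vUQ by auto
          then show ?thesis using 1 bU \<open>a \<notin> U\<close> unfolding edgeJ_def by blast
        qed
      next
        case 2 then show ?thesis by blast
      qed
    qed
    have J2: "{V. V \<in> edgeJ Q \<or> V \<inter> X ` insert v P \<noteq> {}} = {V. V \<in> {V. V \<in> edgeJ Q \<or> V \<inter> X ` P \<noteq> {}} \<or> X v \<in> V}"
      by auto
    have f1: "\<forall>h\<in>?G1. X v \<notin> lab h"
    proof
      fix h assume h: "h \<in> ?G1"
      obtain g T where g: "g \<in> G" "T \<subseteq> ?S" "h = add_gs T g" by (rule add_varsE[OF h])
      show "X v \<notin> lab h" unfolding g(3) lab_add_gs using lG[OF g(1)] g(2) v(2) vUQ(1) by auto
    qed
    have f2: "\<forall>g\<in>G2. X v \<notin> gm g" using G2(3) by blast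
    from lres_horseshoe[OF D1 G2(1) J1 J2 up_closed_edge f1 f2]
    obtain D :: "'n vertex gen \<Rightarrow> 'n vertex gen \<Rightarrow> 'k" where
      D: "lres {V. V \<in> edgeJ Q \<or> V \<inter> X ` P \<noteq> {}} (G2 \<union> ins_gm (X v) ` ?G1) D" by (elim exE)
    let ?G = "G2 \<union> ins_gm (X v) ` ?G1"
    have cQ: "card Q = card (Q - U) + card U"
      by (metis U_def card_Diff_subset card_mono finite le_add_diff_inverse2 mem_Collect_eq subsetI)
    \<comment> \<open>The variable \<open>v\<close> itself is not among those already adjoined. The
      resulting bound is exactly what \<open>v\<close> contributes to the excess of a mark.\<close>
    have cP: "card P \<le> card ?C - 1"
    proof -
      have "P \<subseteq> ?C - {v}" using less.prems v by blast
      then have "card P \<le> card (?C - {v})" by (intro card_mono) simp_all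
      then show ?thesis using v(1) by simp
    qed
    have b: "bounded_gens Q ?G"
      unfolding bounded_gens_def
    proof
      fix k assume "k \<in> ?G"
      then show "\<exists>Z M. gs k \<subseteq> Z \<and> Z \<subseteq> X ` Q \<union> Y ` Q \<and> gm k = X ` M \<and> M \<subseteq> Q \<and>
         antichain M \<and> Y ` M \<subseteq> Z \<and> Z \<inter> X ` M = {} \<and> card Z \<le> card Q + excess M"
      proof
        assume "k \<in> G2" then show ?thesis using G2(2) unfolding bounded_gens_def by (rule bspec[rotated])
      next
        assume "k \<in> ins_gm (X v) ` ?G1"
        then obtain h where k: "k = ins_gm (X v) h" and h: "h \<in> ?G1" by (rule imageE)
        obtain g T where g: "g \<in> G" "T \<subseteq> ?S" "h = add_gs T g" by (rule add_varsE[OF h])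
        obtain Z M where ZM: "gs g \<subseteq> Z" "Z \<subseteq> X ` (Q - U) \<union> Y ` (Q - U)" "gm g = X ` M" "M \<subseteq> Q - U"
           "antichain M" "Y ` M \<subseteq> Z" "Z \<inter> X ` M = {}" "card Z \<le> card (Q - U) + excess M"
          by (rule bounded_gensE[OF G(2) g(1)])
        have vM: "v \<notin> M" using ZM(4) vUQ by blast
        \<comment> \<open>Marks from the colon branch lie outside \<open>U\<close>, so they are not
          above \<open>v\<close>; by minimality of the class they are not below \<open>v\<close>
          either.\<close>
        have "antichain (insert v M)"
          unfolding antichain_def
        proof (intro ballI impI)
          fix a b assume ab: "a \<in> insert v M" "b \<in> insert v M" "le a b"
          have "\<not> le v m" if "m \<in> M" for m using ZM(4) that Uv[of m] by blast
          moreover have "\<not> le m v" if "m \<in> M" for m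
            using minC[of m v] ZM(4) that v(1) CU by blast
          ultimately show "a = b" using ab ZM(5) unfolding antichain_def by blast
        qed
        moreover have "card (Z \<union> ?S) \<le> card Q + excess (insert v M)"
        proof -
          have "card (Z \<union> ?S) \<le> card Z + card ?S" by (rule card_Un_le)
          then show ?thesis using ZM(8) cQ cP excess_insert[OF vM] unfolding card_XY clv by linarith
        qed
        moreover have "gs k \<subseteq> Z \<union> ?S" unfolding k g(3) ins_gm_def add_gs_def using ZM(1) g(2) by auto
        moreover have "Z \<union> ?S \<subseteq> X ` Q \<union> Y ` Q" using ZM(2) PQ U_def by blast
        moreover have "gm k = X ` insert v M" unfolding k g(3) ins_gm_def add_gs_def using ZM(3) by simp
        moreover have "insert v M \<subseteq> Q" using ZM(4) vUQ by blast
        moreover have "Y ` insert v M \<subseteq> Z \<union> ?S" using ZM(6) vUQ by blast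
        moreover have "(Z \<union> ?S) \<inter> X ` insert v M = {}" using ZM(2,4,7) vUQ v(2) PQ by auto
        ultimately show ?thesis by (intro exI[of _ "Z \<union> ?S"] exI[of _ "insert v M"] conjI)
      qed
    qed
    have m: "gm k \<inter> X ` P = {}" if "k \<in> ?G" for k
      using that
    proof
      assume "k \<in> G2" then show ?thesis using G2(3) by blast
    next
      assume "k \<in> ins_gm (X v) ` ?G1"
      then obtain h where k: "k = ins_gm (X v) h" and h: "h \<in> ?G1" by (rule imageE)
      obtain g T where g: "g \<in> G" "T \<subseteq> ?S" "h = add_gs T g" by (rule add_varsE[OF h])
      have "gm k \<subseteq> insert (X v) (lab g)" unfolding k g(3) ins_gm_def add_gs_def lab_def by auto
      then show ?thesis using lG[OF g(1)] PQ v(2) by auto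
    qed
    have top: "has_top Q ?G A" if A: "A \<subseteq> Q" "antichain A" for A
    proof (cases "insert v P = ?C \<longrightarrow> A \<inter> ?C = {}")
      case True
      then have "has_top Q G2 A" using G2(4) A by blast
      then show ?thesis unfolding has_top_def by blast
    next
      \<comment> \<open>\<open>A\<close> meets the class in \<open>d\<close>, and \<open>v\<close>
        is the last variable missing from \<open>P\<close> apart from none other in the class. The
        generator is built from the one for \<open>A - {d}\<close> over \<open>Q - U\<close>: take
        the full Koszul part on \<open>?S\<close> and mark it by \<open>X v\<close>. It is essential
        that \<open>P\<close> now has exactly one element less than the class.\<close>
      case F: False
      then obtain d where d: "d \<in> A" "d \<in> ?C" by blast
      have PC: "insert v P = ?C" using F by blast
      have le_dv: "le d j \<longleftrightarrow> le v j" for j using d(2) v(1) le_trans unfolding cl_def by blast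
      let ?A = "A - {d}"
      have "?A \<subseteq> Q - U"
      proof
        fix a assume a: "a \<in> ?A"
        have "\<not> le d a" using a d(1) A(2) unfolding antichain_def by blast
        then show "a \<in> Q - U" using a A(1) Uv[of a] le_dv[of a] by blast
      qed
      moreover have "antichain ?A" using A(2) unfolding antichain_def by blast
      ultimately have "has_top (Q - U) G ?A" using G(3) by blast
      then obtain g where g: "g \<in> G" "lab g = W (Q - U) ?A" "hdeg g = card (Q - U) + excess ?A"
        unfolding has_top_def by blast
      let ?k = "ins_gm (X v) (add_gs ?S g)"
      have kG: "?k \<in> ?G" using add_varsI[OF g(1), of ?S ?S] by blast
      have "lab ?k = insert (X v) (W (Q - U) ?A \<union> ?S)" unfolding lab_ins_gm lab_add_gs g(2) ..
      also have "\<dots> = W (Q - U) ?A \<union> X ` ?C \<union> Y ` U" unfolding PC[symmetric] by blast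
      also have "\<dots> = W Q A"
      proof -
        \<comment> \<open>Inside \<open>U\<close>, everything is above \<open>d\<close>, and being
          not strictly above \<open>A\<close> means lying in the class. Outside \<open>U\<close>,
          the element \<open>d\<close> imposes no condition.\<close>
        have x1: "k \<in> Q \<and> (\<forall>a\<in>A. le a k \<longrightarrow> le k a) \<longleftrightarrow> k \<in> ?C \<or> (k \<in> Q - U \<and> (\<forall>a\<in>?A. le a k \<longrightarrow> le k a))" for k
        proof (cases "k \<in> U")
          case True
          then have dk: "le d k" "k \<in> Q" using Uv le_dv by blast+
          have "k \<in> ?C" if "le k d"
            using minC[OF dk(2) d(2) that] .
          moreover have "le k a" if "k \<in> ?C" "a \<in> A" "le a k" for a
          proof -
            have "a \<in> ?C" using minC[of a k] that A(1) by blast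
            then show ?thesis using that(1) le_trans unfolding cl_def by blast
          qed
          ultimately show ?thesis using True dk d(1) by blast
        next
          case F: False
          then have "\<not> le d k \<or> k \<notin> Q" "k \<notin> ?C" using Uv le_dv CU by blast+
          then show ?thesis using F by blast
        qed
        have y1: "k \<in> Q \<and> (\<exists>a\<in>A. le a k) \<longleftrightarrow> k \<in> U \<or> (k \<in> Q - U \<and> (\<exists>a\<in>?A. le a k))" for k
          using Uv[of k] le_dv[of k] d(1) by blast
        show ?thesis unfolding W_def using x1 y1 by (auto simp: image_iff)
      qed
      finally have "lab ?k = W Q A" .
      moreover have "hdeg ?k = card Q + excess A"
      proof -
        have "gs g \<inter> ?S = {}" using lG[OF g(1)] PQ unfolding lab_def by blast
        then have "card (gs g \<union> ?S) = card (gs g) + (card P + card U)" by (simp add: card_Un_disjoint card_XY)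
        moreover have "card P = card ?C - 1"
        proof -
          have "P = ?C - {v}" using PC v(2) by blast
          then show ?thesis using v(1) by simp
        qed
        moreover have "excess A = excess ?A + (card ?C - 1)"
          using excess_insert[of d ?A] d cl_eq[OF d(2)] by (simp add: insert_absorb)
        ultimately show ?thesis using g(3) cQ unfolding hdeg_def ins_gm_def add_gs_def by simp
      qed
      ultimately show ?thesis unfolding has_top_def using kG by blast
    qed
    show ?thesis
    proof (rule exI[of _ ?G], rule exI[of _ D], intro conjI)
      show "\<forall>k\<in>?G. gm k \<inter> X ` P = {}" using m by (rule ballI)
      show "\<forall>A\<subseteq>Q. antichain A \<longrightarrow> (P = ?C \<longrightarrow> A \<inter> ?C = {}) \<longrightarrow> has_top Q ?G A" using top by simp
    qed (rule D, rule b)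
  qed
qed

text \<open>Induction over sets that are unions of classes. A minimal element exists by
  \<open>ex_maximal\<close> for the reversed order, and the step is entered with
  \<open>P = {}\<close>; classes are nonempty, so its restriction on antichains is then
  vacuous.\<close>

theorem edge_resolution:
  assumes "\<forall>i\<in>Q. cl i \<subseteq> Q"
  shows "\<exists>G (D :: 'n vertex gen \<Rightarrow> 'n vertex gen \<Rightarrow> 'k::field).
        lres (edgeJ Q) G D \<and> bounded_gens Q G \<and> (\<forall>D\<subseteq>Q. antichain D \<longrightarrow> has_top Q G D)"
proof -
  have "finite Q" by simp
  then show ?thesis using assms
  proof (induction Q rule: finite_psubset_induct)
    case (psubset Q)
    show ?case
    proof (cases "Q = {}")
      case True
      have "edgeJ Q = {}" unfolding True edgeJ_def by simp
      moreover have "bounded_gens Q {Gen {} {}}" unfolding bounded_gens_def True antichain_def excess_def by simp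
      moreover have "has_top Q {Gen {} {}} D" if "D \<subseteq> Q" for D
        using that unfolding has_top_def True W_def lab_def hdeg_def excess_def by simp
      ultimately show ?thesis using lres_trivial[where 'v="'n vertex" and 'k='k]
        by (intro exI[of _ "{Gen {} {}}"] exI[of _ "\<lambda>_ _. 0"]) simp
    next
      case False
      interpret d: finite_preorder "\<lambda>i j. le j i" by unfold_locales (auto intro: le_refl le_trans)
      obtain a where "a \<in> Q" using False by blast
      from d.ex_maximal[OF this] obtain i where i: "i \<in> Q" "\<forall>j\<in>Q. le j i \<longrightarrow> le i j" by blast
      have "\<exists>G (D :: 'n vertex gen \<Rightarrow> 'n vertex gen \<Rightarrow> 'k).
        lres {V. V \<in> edgeJ Q \<or> V \<inter> X ` {} \<noteq> {}} G D \<and> bounded_gens Q G \<and> (\<forall>g\<in>G. gm g \<inter> X ` {} = {}) \<and>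
        (\<forall>D\<subseteq>Q. antichain D \<longrightarrow> ({} = cl i \<longrightarrow> D \<inter> cl i = {}) \<longrightarrow> has_top Q G D)"
      proof (rule edge_step)
        show "\<And>i. i \<in> Q \<Longrightarrow> cl i \<subseteq> Q" using psubset.prems by (rule bspec)
        show "\<And>j. j \<in> Q \<Longrightarrow> le j i \<Longrightarrow> le i j" using i(2) by simp
        show "\<exists>G (D :: 'n vertex gen \<Rightarrow> 'n vertex gen \<Rightarrow> 'k).
          lres (edgeJ Q') G D \<and> bounded_gens Q' G \<and> (\<forall>D\<subseteq>Q'. antichain D \<longrightarrow> has_top Q' G D)"
          if "Q' \<subset> Q" "\<forall>i\<in>Q'. cl i \<subseteq> Q'" for Q'
          by (rule psubset.IH[OF that])
      qed (use i(1) in simp_all)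
      moreover have "cl i \<noteq> {}" using cl_self by blast
      ultimately show ?thesis by simp
    qed
  qed
qed

end

section \<open>Multidegrees of the top generators\<close>

context finite_preorder
begin

lemma sum_card_cl: "(\<Sum>d\<in>A. card (cl d)) = excess A + card A"
proof -
  have "(\<Sum>d\<in>A. card (cl d)) = (\<Sum>d\<in>A. (card (cl d) - 1) + 1)"
  proof (rule sum.cong)
    fix i show "card (cl i) = (card (cl i) - 1) + 1" using cl_card_pos[of i] by linarith
  qed simp
  also have "\<dots> = excess A + (\<Sum>i\<in>A. 1)" unfolding excess_def by (rule sum.distrib)
  finally show ?thesis by simp
qed

text \<open>The index sets of the \<open>X\<close>-part and of the \<open>Y\<close>-part cover
  everything, since \<open>A\<close> is spanning, and overlap in the union of the classes of
  \<open>A\<close>, whose size is \<open>excess A + card A\<close>.\<close>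

lemma card_W:
  assumes A: "antichain A" and sp: "\<And>j. \<exists>d\<in>A. le j d \<or> le d j"
  shows "card (W UNIV A) = card (UNIV :: 'n set) + excess A + card A"
proof -
  let ?P = "{i. \<forall>d\<in>A. le d i \<longrightarrow> le i d}" and ?Q = "{j. \<exists>d\<in>A. le d j}"
  have U: "?P \<union> ?Q = UNIV" using sp by blast
  have "?P \<inter> ?Q = (\<Union>d\<in>A. cl d)"
  proof (intro subset_antisym subsetI)
    fix i assume "i \<in> ?P \<inter> ?Q" then show "i \<in> (\<Union>d\<in>A. cl d)" unfolding cl_def by blast
  next
    fix i assume "i \<in> (\<Union>d\<in>A. cl d)"
    then obtain d where d: "d \<in> A" "le d i" "le i d" unfolding cl_def by blast
    have "le i d'" if "d' \<in> A" "le d' i" for d'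
    proof -
      have "le d' d" using that(2) d(3) by (rule le_trans)
      then have "d' = d" using A that(1) d(1) unfolding antichain_def by blast
      then show ?thesis using d(3) by simp
    qed
    then show "i \<in> ?P \<inter> ?Q" using d by blast
  qed
  moreover have "card (\<Union>d\<in>A. cl d) = (\<Sum>d\<in>A. card (cl d))"
  proof (rule card_UN_disjoint)
    have "i = j" if "i \<in> A" "j \<in> A" "x \<in> cl i" "x \<in> cl j" for i j x
    proof -
      have "cl i = cl j" using cl_eq[OF that(3)] cl_eq[OF that(4)] by (rule trans[OF sym])
      then have "le i j" using cl_self[of j] unfolding cl_def by auto
      then show ?thesis using A that unfolding antichain_def by blast
    qed
    then show "\<forall>i\<in>A. \<forall>j\<in>A. i \<noteq> j \<longrightarrow> cl i \<inter> cl j = {}" by blast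
  qed auto
  ultimately have "card (?P \<inter> ?Q) = excess A + card A" using sum_card_cl by simp
  moreover have "card ?P + card ?Q = card (?P \<union> ?Q) + card (?P \<inter> ?Q)" by (rule card_Un_Int) auto
  ultimately show ?thesis unfolding W_def card_XY U by simp
qed

text \<open>The mark \<open>M\<close> of such an \<open>h\<close> would have one element more than
  \<open>A\<close>. All of them except a single \<open>c\<close> are equivalent to elements of
  \<open>A\<close>, and these exhaust \<open>A\<close>; but \<open>c\<close> lies below some element
  of \<open>A\<close>, hence below another element of the antichain \<open>M\<close>.\<close>

lemma no_cancellation:
  assumes A: "antichain A" and sp: "\<And>j. \<exists>d\<in>A. le j d \<or> le d j"
    and mx: "\<And>M. antichain M \<Longrightarrow> excess M \<le> excess A"
    and G: "bounded_gens UNIV G" "h \<in> G" and labh: "lab h = W UNIV A"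
  shows "Suc (hdeg h) \<noteq> card (UNIV :: 'n set) + excess A"
proof
  assume dh: "Suc (hdeg h) = card (UNIV :: 'n set) + excess A"
  obtain Z M where ZM: "gs h \<subseteq> Z" "Z \<subseteq> X ` UNIV \<union> Y ` UNIV" "gm h = X ` M" "M \<subseteq> UNIV"
     "antichain M" "Y ` M \<subseteq> Z" "Z \<inter> X ` M = {}" "card Z \<le> card (UNIV :: 'n set) + excess M"
    by (rule bounded_gensE[OF G])
  \<comment> \<open>This is where maximality of the excess of \<open>A\<close> is used:
    \<open>gs h\<close> omits at most one element of \<open>Z\<close>.\<close>
  have cZ: "card Z \<le> Suc (card (gs h))" using ZM(8) mx[OF ZM(5)] dh unfolding hdeg_def by linarith
  have "card (lab h) = card (X ` M) + card (gs h)"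
    unfolding lab_def ZM(3) by (rule card_Un_disjoint) (use ZM(1,7) in auto)
  \<comment> \<open>The label has \<open>n + excess A + card A\<close> elements, of which
    \<open>gs h\<close> supplies \<open>n + excess A - 1\<close>; the mark supplies the
    rest.\<close>
  then have cM: "card M = Suc (card A)"
    using dh card_W[OF A sp] unfolding labh hdeg_def by (simp add: card_image inj_on_def)
  have WX: "X m \<in> W UNIV A \<longleftrightarrow> (\<forall>d\<in>A. le d m \<longrightarrow> le m d)" for m unfolding W_def by auto
  have WY: "Y m \<in> W UNIV A \<longleftrightarrow> (\<exists>d\<in>A. le d m)" for m unfolding W_def by auto
  have MW: "\<forall>d\<in>A. le d m \<longrightarrow> le m d" if "m \<in> M" for m
    using that labh ZM(3) WX[of m] unfolding lab_def by blast
  have up: "\<exists>d\<in>A. le m d" if "m \<in> M" for m using MW[OF that] sp[of m] by blast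
  have inj: "card N \<le> card A" if N: "N \<subseteq> M" "\<And>m. m \<in> N \<Longrightarrow> f m \<in> A \<and> le m (f m) \<and> le (f m) m" for N f
  proof (rule card_inj_on_le[of f])
    show "inj_on f N"
    proof (rule inj_onI)
      fix a b assume ab: "a \<in> N" "b \<in> N" "f a = f b"
      have "le a (f a)" "le (f a) b" using N(2)[OF ab(1)] N(2)[OF ab(2)] ab(3) by simp_all
      then have "le a b" by (rule le_trans)
      then show "a = b" using ZM(5) N(1) ab(1,2) unfolding antichain_def by blast
    qed
  qed (use N in auto)
  have "\<exists>c\<in>M. \<forall>d\<in>A. \<not> le d c"
  proof (rule ccontr)
    assume n: "\<not> (\<exists>c\<in>M. \<forall>d\<in>A. \<not> le d c)"
    have "\<forall>m\<in>M. \<exists>d. d \<in> A \<and> le m d \<and> le d m" using n MW by blast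
    from bchoice[OF this] obtain f where f: "\<forall>m\<in>M. f m \<in> A \<and> le m (f m) \<and> le (f m) m" by (elim exE)
    have "card M \<le> card A" by (rule inj[OF subset_refl]) (use f in blast)
    then show False using cM by simp
  qed
  then obtain c where c: "c \<in> M" "\<forall>d\<in>A. \<not> le d c" by blast
  \<comment> \<open>No element of \<open>A\<close> is below \<open>c\<close>, so \<open>Y c\<close>
    is outside the label, while marks always have their \<open>Y\<close>-vertex in \<open>Z\<close>.
    Thus \<open>Y c\<close> is the only element of \<open>Z\<close> omitted by
    \<open>gs h\<close>.\<close>
  have "Y c \<notin> gs h" using c(2) WY[of c] labh unfolding lab_def by blast
  moreover have "insert (Y c) (gs h) \<subseteq> Z" using ZM(1,6) c(1) by blast
  ultimately have Zeq: "insert (Y c) (gs h) = Z" using cZ by (intro card_seteq) simp_all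
  have "\<forall>m\<in>M - {c}. \<exists>d. d \<in> A \<and> le m d \<and> le d m"
  proof
    fix m assume m: "m \<in> M - {c}"
    then have "Y m \<in> gs h" using Zeq ZM(6) by blast
    then have "Y m \<in> W UNIV A" using labh unfolding lab_def by blast
    then obtain d where "d \<in> A" "le d m" using WY by blast
    then show "\<exists>d. d \<in> A \<and> le m d \<and> le d m" using MW[of m] m by blast
  qed
  from bchoice[OF this] obtain f where f: "\<forall>m\<in>M - {c}. f m \<in> A \<and> le m (f m) \<and> le (f m) m" by (elim exE)
  have finj: "inj_on f (M - {c})"
  proof (rule inj_onI)
    fix a b assume ab: "a \<in> M - {c}" "b \<in> M - {c}" "f a = f b"
    have "le a (f a)" "le (f a) b" using bspec[OF f ab(1)] bspec[OF f ab(2)] ab(3) by simp_all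
    then have "le a b" by (rule le_trans)
    then show "a = b" using ZM(5) ab(1,2) unfolding antichain_def by blast
  qed
  \<comment> \<open>An injection between sets of equal size, as \<open>M\<close> has exactly one
    element more than \<open>A\<close>.\<close>
  have "f ` (M - {c}) = A"
  proof (rule card_subset_eq)
    show "f ` (M - {c}) \<subseteq> A" using f by blast
    show "card (f ` (M - {c})) = card A" using card_image[OF finj] cM c(1) by simp
  qed simp
  moreover obtain d where d: "d \<in> A" "le c d" using up[OF c(1)] by blast
  ultimately obtain m where m: "m \<in> M - {c}" "d = f m" by blast
  have "le c m" using d(2) bspec[OF f m(1)] unfolding m(2) by (blast intro: le_trans)
  then show False using ZM(5) c(1) m(1) unfolding antichain_def by blast
qed

text \<open>For a spanning antichain, lying strictly above no member is the same as lying below some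
  member. Hence the label of a top generator determines the lattice element it comes from.\<close>

lemma W_X:
  assumes A: "antichain A" and sp: "\<And>j. \<exists>d\<in>A. le j d \<or> le d j"
  shows "W UNIV A \<inter> range X = X ` {i. \<exists>d\<in>A. le i d}"
proof -
  have "(\<forall>d\<in>A. le d i \<longrightarrow> le i d) \<longleftrightarrow> (\<exists>d\<in>A. le i d)" for i
  proof
    assume "\<forall>d\<in>A. le d i \<longrightarrow> le i d" then show "\<exists>d\<in>A. le i d" using sp[of i] by blast
  next
    assume "\<exists>d\<in>A. le i d"
    then obtain d where d: "d \<in> A" "le i d" by blast
    have "le i d'" if "d' \<in> A" "le d' i" for d'
    proof -
      have "le d' d" using that(2) d(2) by (rule le_trans)
      then have "d' = d" using A that(1) d(1) unfolding antichain_def by blast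
      then show ?thesis using d(2) by simp
    qed
    then show "\<forall>d\<in>A. le d i \<longrightarrow> le i d" by blast
  qed
  then have "{i \<in> UNIV. \<forall>d\<in>A. le d i \<longrightarrow> le i d} = {i. \<exists>d\<in>A. le i d}" by simp
  then have "W UNIV A = X ` {i. \<exists>d\<in>A. le i d} \<union> Y ` {j \<in> UNIV. \<exists>d\<in>A. le d j}" unfolding W_def by (rule arg_cong)
  then show ?thesis by auto
qed

end

context unmixed_bipartite
begin

theorem top_generators:
  assumes "B_set E \<noteq> {}"
  obtains s G S and D :: "'n vertex gen \<Rightarrow> 'n vertex gen \<Rightarrow> 'k::field"
  where "lres (edgeJ UNIV) G D" "\<forall>g\<in>G. hdeg g \<le> s" "0 < s" "S \<subseteq> G" "card S = card (B_set E)"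
    "\<forall>g\<in>S. hdeg g = s \<and> (\<forall>h. lab h = lab g \<longrightarrow> D h g = 0)"
proof -
  obtain G and D :: "'n vertex gen \<Rightarrow> 'n vertex gen \<Rightarrow> 'k" where
    G: "lres (edgeJ UNIV) G D" "bounded_gens UNIV G" "\<forall>A\<subseteq>UNIV. antichain A \<longrightarrow> has_top UNIV G A"
    using edge_resolution[of UNIV, OF ballI[OF subset_UNIV]] by (elim exE conjE)
  let ?n = "card (UNIV :: 'n set)"
  let ?P = "\<lambda>A p. antichain A \<and> spanning A \<and> p = X ` {i. \<exists>d\<in>A. le i d} \<and> (\<forall>M. antichain M \<longrightarrow> excess M \<le> excess A)"
  have PA: "\<exists>A. ?P A p" if p: "p \<in> B_set E" for p
  proof (rule B_set_antichain[OF p])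
    fix A assume "antichain A" "spanning A" "p = X ` {i. \<exists>d\<in>A. le i d}"
      "\<And>D'. antichain D' \<Longrightarrow> excess D' \<le> excess A"
    then show ?thesis by (intro exI[of _ A] conjI allI impI) simp_all
  qed
  from assms obtain p0 where p0: "p0 \<in> B_set E" by blast
  obtain A0 where A0: "?P A0 p0" using PA[OF p0] by (elim exE)
  define s where "s = ?n + excess A0"
  \<comment> \<open>Both antichains have the largest excess, so all generators obtained lie in the
    same homological degree.\<close>
  have s: "excess A = excess A0" if "?P A p" for A p using that A0 by (simp add: order_antisym)
  have "\<exists>g\<in>G. lab g \<inter> range X = p \<and> hdeg g = s \<and> (\<forall>h. lab h = lab g \<longrightarrow> D h g = 0)" if p: "p \<in> B_set E" for p
  proof -
    obtain A where A: "?P A p" using PA[OF p] by (elim exE)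
    have Aac: "antichain A" using A by simp
    have "spanning A" using A by simp
    then have sp: "\<exists>d\<in>A. le j d \<or> le d j" for j unfolding spanning_def by (rule spec)
    have mx: "excess M \<le> excess A" if "antichain M" for M using A that by simp
    have "has_top UNIV G A" using G(3) A by simp
    then obtain g where g: "g \<in> G" "lab g = W UNIV A" "hdeg g = ?n + excess A" unfolding has_top_def by blast
    have "D h g = 0" if lh: "lab h = lab g" for h
    proof (rule ccontr)
      assume nz: "D h g \<noteq> 0"
      have "h \<in> G" "hdeg g = Suc (hdeg h)" using lresD(1,3)[OF G(1) nz] by simp_all
      have "lab h = W UNIV A" unfolding lh g(2) ..
      from no_cancellation[OF Aac sp mx G(2) \<open>h \<in> G\<close> this] show False
        using g(3) \<open>hdeg g = Suc (hdeg h)\<close> by simp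
    qed
    moreover have "lab g \<inter> range X = p" unfolding g(2) W_X[OF Aac sp] using A by simp
    moreover have "hdeg g = s" unfolding g(3) s_def s[OF A] ..
    ultimately show ?thesis using g(1) by (intro bexI[of _ g]) simp_all
  qed
  then have "\<forall>p\<in>B_set E. \<exists>g. g \<in> G \<and> lab g \<inter> range X = p \<and> hdeg g = s \<and> (\<forall>h. lab h = lab g \<longrightarrow> D h g = 0)"
    unfolding Bex_def by (rule ballI)
  from bchoice[OF this] obtain f where
    f: "\<forall>p\<in>B_set E. f p \<in> G \<and> lab (f p) \<inter> range X = p \<and> hdeg (f p) = s \<and> (\<forall>h. lab h = lab (f p) \<longrightarrow> D h (f p) = 0)"
    by (elim exE)
  note f1 = bspec[OF f, THEN conjunct1] and f2 = bspec[OF f, THEN conjunct2, THEN conjunct1]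
    and f3 = bspec[OF f, THEN conjunct2, THEN conjunct2]
  \<comment> \<open>The lattice element is recovered from the \<open>X\<close>-part of the label, so
    different elements have different generators.\<close>
  have fi: "inj_on f (B_set E)"
  proof (rule inj_onI)
    fix p q assume p: "p \<in> B_set E" "q \<in> B_set E" and e: "f p = f q"
    have "p = lab (f p) \<inter> range X" using f2[OF p(1)] by (rule sym)
    also have "\<dots> = q" unfolding e by (rule f2[OF p(2)])
    finally show "p = q" .
  qed
  show thesis
  proof (rule that[OF G(1), of s "f ` B_set E"])
    show "\<forall>g\<in>G. hdeg g \<le> s"
    proof
      fix g assume g: "g \<in> G"
      obtain Z M where ZM: "gs g \<subseteq> Z" "Z \<subseteq> X ` UNIV \<union> Y ` UNIV" "gm g = X ` M" "M \<subseteq> UNIV"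
         "antichain M" "Y ` M \<subseteq> Z" "Z \<inter> X ` M = {}" "card Z \<le> ?n + excess M"
        by (rule bounded_gensE[OF G(2) g])
      have "card (gs g) \<le> card Z" using ZM(1) by (intro card_mono) simp_all
      also have "\<dots> \<le> ?n + excess M" by (rule ZM(8))
      also have "\<dots> \<le> s" unfolding s_def using A0 ZM(5) by simp
      finally show "hdeg g \<le> s" unfolding hdeg_def .
    qed
    show "0 < s" unfolding s_def by (simp add: card_gt_0_iff)
    show "f ` B_set E \<subseteq> G" by (intro image_subsetI) (rule f1)
    show "card (f ` B_set E) = card (B_set E)" by (rule card_image[OF fi])
    show "\<forall>g\<in>f ` B_set E. hdeg g = s \<and> (\<forall>h. lab h = lab g \<longrightarrow> D h g = 0)"
    proof
      fix g assume "g \<in> f ` B_set E"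
      then obtain p where p: "g = f p" "p \<in> B_set E" by (rule imageE)
      show "hdeg g = s \<and> (\<forall>h. lab h = lab g \<longrightarrow> D h g = 0)"
        unfolding p(1) by (rule f3[OF p(2)])
    qed
  qed
qed

end

section \<open>Comparison of resolutions\<close>

abbreviation rmod :: "('r::comm_ring_1, 'm) module \<Rightarrow> bool" where
  "rmod M \<equiv> Module.module (class_ring :: 'r ring) M"

abbreviation rhom :: "('r::comm_ring_1, 'm) module \<Rightarrow> ('r, 'n) module \<Rightarrow> ('m \<Rightarrow> 'n) set" where
  "rhom M N \<equiv> LinearCombinations.module_hom (class_ring :: 'r ring) M N"

lemma rmodD:
  fixes M :: "('r::comm_ring_1, 'm) module"
  assumes "rmod M"
  shows "\<zero>\<^bsub>M\<^esub> \<in> carrier M"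
    "x \<in> carrier M \<Longrightarrow> y \<in> carrier M \<Longrightarrow> x \<oplus>\<^bsub>M\<^esub> y \<in> carrier M"
    "x \<in> carrier M \<Longrightarrow> a \<odot>\<^bsub>M\<^esub> x \<in> carrier M"
    "x \<in> carrier M \<Longrightarrow> y \<in> carrier M \<Longrightarrow> z \<in> carrier M \<Longrightarrow> (x \<oplus>\<^bsub>M\<^esub> y) \<oplus>\<^bsub>M\<^esub> z = x \<oplus>\<^bsub>M\<^esub> (y \<oplus>\<^bsub>M\<^esub> z)"
    "x \<in> carrier M \<Longrightarrow> y \<in> carrier M \<Longrightarrow> x \<oplus>\<^bsub>M\<^esub> y = y \<oplus>\<^bsub>M\<^esub> x"
    "x \<in> carrier M \<Longrightarrow> \<zero>\<^bsub>M\<^esub> \<oplus>\<^bsub>M\<^esub> x = x"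
    "x \<in> carrier M \<Longrightarrow> x \<oplus>\<^bsub>M\<^esub> \<zero>\<^bsub>M\<^esub> = x"
    "x \<in> carrier M \<Longrightarrow> (a + b) \<odot>\<^bsub>M\<^esub> x = a \<odot>\<^bsub>M\<^esub> x \<oplus>\<^bsub>M\<^esub> b \<odot>\<^bsub>M\<^esub> x"
    "x \<in> carrier M \<Longrightarrow> y \<in> carrier M \<Longrightarrow> a \<odot>\<^bsub>M\<^esub> (x \<oplus>\<^bsub>M\<^esub> y) = a \<odot>\<^bsub>M\<^esub> x \<oplus>\<^bsub>M\<^esub> a \<odot>\<^bsub>M\<^esub> y"
    "x \<in> carrier M \<Longrightarrow> (a * b) \<odot>\<^bsub>M\<^esub> x = a \<odot>\<^bsub>M\<^esub> (b \<odot>\<^bsub>M\<^esub> x)"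
    "x \<in> carrier M \<Longrightarrow> 1 \<odot>\<^bsub>M\<^esub> x = x"
    "x \<in> carrier M \<Longrightarrow> 0 \<odot>\<^bsub>M\<^esub> x = \<zero>\<^bsub>M\<^esub>"
    "a \<odot>\<^bsub>M\<^esub> \<zero>\<^bsub>M\<^esub> = \<zero>\<^bsub>M\<^esub>"
proof -
  interpret Module.module "class_ring :: 'r ring" M by (rule assms)
  show "\<zero>\<^bsub>M\<^esub> \<in> carrier M" by (rule M.zero_closed)
  show "x \<in> carrier M \<Longrightarrow> y \<in> carrier M \<Longrightarrow> x \<oplus>\<^bsub>M\<^esub> y \<in> carrier M" by (rule M.add.m_closed)
  show "x \<in> carrier M \<Longrightarrow> a \<odot>\<^bsub>M\<^esub> x \<in> carrier M" using smult_closed[of a x] by simp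
  show "x \<in> carrier M \<Longrightarrow> y \<in> carrier M \<Longrightarrow> z \<in> carrier M \<Longrightarrow> (x \<oplus>\<^bsub>M\<^esub> y) \<oplus>\<^bsub>M\<^esub> z = x \<oplus>\<^bsub>M\<^esub> (y \<oplus>\<^bsub>M\<^esub> z)"
    by (rule M.a_assoc)
  show "x \<in> carrier M \<Longrightarrow> y \<in> carrier M \<Longrightarrow> x \<oplus>\<^bsub>M\<^esub> y = y \<oplus>\<^bsub>M\<^esub> x" by (rule M.a_comm)
  show "x \<in> carrier M \<Longrightarrow> \<zero>\<^bsub>M\<^esub> \<oplus>\<^bsub>M\<^esub> x = x" by (rule M.l_zero)
  show "x \<in> carrier M \<Longrightarrow> x \<oplus>\<^bsub>M\<^esub> \<zero>\<^bsub>M\<^esub> = x" by (rule M.r_zero)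
  show "x \<in> carrier M \<Longrightarrow> (a + b) \<odot>\<^bsub>M\<^esub> x = a \<odot>\<^bsub>M\<^esub> x \<oplus>\<^bsub>M\<^esub> b \<odot>\<^bsub>M\<^esub> x" using smult_l_distr[of a b x] by simp
  show "x \<in> carrier M \<Longrightarrow> y \<in> carrier M \<Longrightarrow> a \<odot>\<^bsub>M\<^esub> (x \<oplus>\<^bsub>M\<^esub> y) = a \<odot>\<^bsub>M\<^esub> x \<oplus>\<^bsub>M\<^esub> a \<odot>\<^bsub>M\<^esub> y"
    using smult_r_distr[of a x y] by simp
  show "x \<in> carrier M \<Longrightarrow> (a * b) \<odot>\<^bsub>M\<^esub> x = a \<odot>\<^bsub>M\<^esub> (b \<odot>\<^bsub>M\<^esub> x)" using smult_assoc1[of a b x] by simp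
  show "x \<in> carrier M \<Longrightarrow> 1 \<odot>\<^bsub>M\<^esub> x = x" using smult_one[of x] by simp
  show "x \<in> carrier M \<Longrightarrow> 0 \<odot>\<^bsub>M\<^esub> x = \<zero>\<^bsub>M\<^esub>" using smult_l_null[of x] by simp
  show "a \<odot>\<^bsub>M\<^esub> \<zero>\<^bsub>M\<^esub> = \<zero>\<^bsub>M\<^esub>" using smult_r_null[of a] by simp
qed

lemma rhomI:
  fixes M :: "('r::comm_ring_1, 'm) module"
  assumes "\<And>x. x \<in> carrier M \<Longrightarrow> f x \<in> carrier N"
    "\<And>x y. x \<in> carrier M \<Longrightarrow> y \<in> carrier M \<Longrightarrow> f (x \<oplus>\<^bsub>M\<^esub> y) = f x \<oplus>\<^bsub>N\<^esub> f y"
    "\<And>a x. x \<in> carrier M \<Longrightarrow> f (a \<odot>\<^bsub>M\<^esub> x) = a \<odot>\<^bsub>N\<^esub> f x"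
  shows "f \<in> rhom M N"
  using assms unfolding LinearCombinations.module_hom_def by simp

lemma rhomD:
  fixes M :: "('r::comm_ring_1, 'm) module"
  assumes "f \<in> rhom M N"
  shows "x \<in> carrier M \<Longrightarrow> f x \<in> carrier N"
    "x \<in> carrier M \<Longrightarrow> y \<in> carrier M \<Longrightarrow> f (x \<oplus>\<^bsub>M\<^esub> y) = f x \<oplus>\<^bsub>N\<^esub> f y"
    "x \<in> carrier M \<Longrightarrow> f (a \<odot>\<^bsub>M\<^esub> x) = a \<odot>\<^bsub>N\<^esub> f x"
  using assms unfolding LinearCombinations.module_hom_def by auto

lemma rhom_zero:
  fixes M :: "('r::comm_ring_1, 'm) module"
  assumes f: "f \<in> rhom M N" and M: "rmod M" and N: "rmod N"
  shows "f \<zero>\<^bsub>M\<^esub> = \<zero>\<^bsub>N\<^esub>"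
proof -
  have "f (0 \<odot>\<^bsub>M\<^esub> \<zero>\<^bsub>M\<^esub>) = 0 \<odot>\<^bsub>N\<^esub> f \<zero>\<^bsub>M\<^esub>" by (rule rhomD(3)[OF f rmodD(1)[OF M]])
  then show ?thesis using rmodD(12)[OF N rhomD(1)[OF f rmodD(1)[OF M]]] rmodD(13)[OF M, of 0] by simp
qed

lemma rhom_comp:
  fixes M :: "('r::comm_ring_1, 'm) module"
  assumes "f \<in> rhom M N" "g \<in> rhom N L"
  shows "(\<lambda>x. g (f x)) \<in> rhom M L"
  by (rule rhomI) (simp_all add: rhomD[OF assms(1)] rhomD[OF assms(2)])

lemma rmod_vec: "rmod (module_vec TYPE('r::comm_ring_1) n)"
proof -
  interpret vec_module "TYPE('r)" n .
  show ?thesis by (rule module_axioms)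
qed

lemma rhom_vec_eq:
  fixes N :: "('r::comm_ring_1, 'm) module"
  assumes f: "f \<in> rhom (module_vec TYPE('r) m) N" and g: "g \<in> rhom (module_vec TYPE('r) m) N" and N: "rmod N"
    and eq: "\<And>k. k < m \<Longrightarrow> f (unit_vec m k) = g (unit_vec m k)" and v: "v \<in> carrier_vec m"
  shows "f v = g v"
proof -
  let ?V = "module_vec TYPE('r) m"
  note f = f[THEN rhomD(1)] f[THEN rhomD(2)] f[THEN rhomD(3)] rhom_zero[OF f rmod_vec N]
  note g = g[THEN rhomD(1)] g[THEN rhomD(2)] g[THEN rhomD(3)] rhom_zero[OF g rmod_vec N]
  note f = f[unfolded module_vec_simps] and g = g[unfolded module_vec_simps]
  \<comment> \<open>Agreement on \<open>v\<close> is proved by building \<open>v\<close> up one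
    coordinate at a time.\<close>
  define tr where "tr k = vec m (\<lambda>i. if i < k then v $ i else 0)" for k
  have "k \<le> m \<Longrightarrow> f (tr k) = g (tr k)" for k
  proof (induction k)
    case 0
    have "tr 0 = 0\<^sub>v m" unfolding tr_def by (rule eq_vecI) simp_all
    then show ?case using f(4) g(4) by simp
  next
    case (Suc k)
    have "tr (Suc k) = tr k + v $ k \<cdot>\<^sub>v unit_vec m k"
      unfolding tr_def by (rule eq_vecI) (use Suc.prems in \<open>auto simp: less_Suc_eq\<close>)
    moreover have "tr k \<in> carrier_vec m" unfolding tr_def by simp
    ultimately show ?case using Suc f(2,3) g(2,3) eq[of k] by simp
  qed
  then have "f (tr m) = g (tr m)" by simp
  moreover have "tr m = v" unfolding tr_def by (rule eq_vecI) (use v in auto)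
  ultimately show ?thesis by simp
qed

lemma ex_rhom_vec:
  fixes L :: "('r::comm_ring_1, 'm) module"
  assumes L: "rmod L" and c: "\<And>k. k < m \<Longrightarrow> c k \<in> carrier L"
  shows "\<exists>f \<in> rhom (module_vec TYPE('r) m) L. \<forall>k<m. f (unit_vec m k) = c k"
proof -
  note Ld = rmodD[OF L]
  \<comment> \<open>\<open>S k v\<close> is the partial sum of the first \<open>k\<close> terms of
    the linear combination with coefficients \<open>v\<close> and vectors \<open>c\<close>.\<close>
  define S where "S = rec_nat (\<lambda>v :: 'r vec. \<zero>\<^bsub>L\<^esub>) (\<lambda>k r v. r v \<oplus>\<^bsub>L\<^esub> (v $ k \<odot>\<^bsub>L\<^esub> c k))"
  have S0: "S 0 v = \<zero>\<^bsub>L\<^esub>" for v unfolding S_def by simp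
  have SS: "S (Suc k) v = S k v \<oplus>\<^bsub>L\<^esub> (v $ k \<odot>\<^bsub>L\<^esub> c k)" for k v unfolding S_def by simp
  have cl: "k \<le> m \<Longrightarrow> S k v \<in> carrier L" for k v
    by (induction k) (simp_all add: S0 SS Ld c)
  have add: "S k (v + w) = S k v \<oplus>\<^bsub>L\<^esub> S k w" if "k \<le> m" "v \<in> carrier_vec m" "w \<in> carrier_vec m" for k v w
    using that(1)
  proof (induction k)
    case 0 then show ?case by (simp add: S0 Ld)
  next
    case (Suc k)
    have km: "k < m" using Suc.prems by simp
    let ?a = "v $ k \<odot>\<^bsub>L\<^esub> c k" and ?b = "w $ k \<odot>\<^bsub>L\<^esub> c k"
    have in': "S k v \<in> carrier L" "S k w \<in> carrier L" "?a \<in> carrier L" "?b \<in> carrier L"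
      using cl km Ld(3)[OF c[OF km]] by simp_all
    have "S (Suc k) (v + w) = (S k v \<oplus>\<^bsub>L\<^esub> S k w) \<oplus>\<^bsub>L\<^esub> (?a \<oplus>\<^bsub>L\<^esub> ?b)"
      using Suc that km by (simp add: SS Ld(8)[OF c[OF km]])
    also have "\<dots> = (S k v \<oplus>\<^bsub>L\<^esub> ?a) \<oplus>\<^bsub>L\<^esub> (S k w \<oplus>\<^bsub>L\<^esub> ?b)"
    proof -
      have "(S k v \<oplus>\<^bsub>L\<^esub> S k w) \<oplus>\<^bsub>L\<^esub> (?a \<oplus>\<^bsub>L\<^esub> ?b) = S k v \<oplus>\<^bsub>L\<^esub> ((S k w \<oplus>\<^bsub>L\<^esub> ?a) \<oplus>\<^bsub>L\<^esub> ?b)"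
        using in' by (simp add: Ld(2,4))
      also have "S k w \<oplus>\<^bsub>L\<^esub> ?a = ?a \<oplus>\<^bsub>L\<^esub> S k w" using in' by (simp add: Ld(5))
      finally show ?thesis using in' by (simp add: Ld(2,4))
    qed
    finally show ?case unfolding SS .
  qed
  have sm: "S k (a \<cdot>\<^sub>v v) = a \<odot>\<^bsub>L\<^esub> S k v" if "k \<le> m" "v \<in> carrier_vec m" for k a v
    using that(1)
  proof (induction k)
    case 0 then show ?case by (simp add: S0 Ld)
  next
    case (Suc k)
    have km: "k < m" using Suc.prems by simp
    have "S (Suc k) (a \<cdot>\<^sub>v v) = a \<odot>\<^bsub>L\<^esub> S k v \<oplus>\<^bsub>L\<^esub> (a * v $ k) \<odot>\<^bsub>L\<^esub> c k"
      using Suc that km by (simp add: SS)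
    then show ?case using km cl[of k v] Ld(3)[OF c[OF km]] by (simp add: SS Ld(9) Ld(10)[OF c[OF km]])
  qed
  have un: "S k (unit_vec m j) = (if j < k then c j else \<zero>\<^bsub>L\<^esub>)" if "k \<le> m" "j < m" for k j
    using that(1)
  proof (induction k)
    case 0 then show ?case by (simp add: S0)
  next
    case (Suc k)
    have km: "k < m" using Suc.prems by simp
    show ?case using Suc km that(2) Ld(11,12)[OF c[OF km]] Ld(6,7)[OF c[OF that(2)]] Ld(6)[OF Ld(1)] Ld(6)[OF c[OF km]]
      by (auto simp: SS less_Suc_eq)
  qed
  show ?thesis
  proof (rule bexI[of _ "S m"])
    show "S m \<in> rhom (module_vec TYPE('r) m) L"
      by (rule rhomI) (simp_all add: module_vec_simps cl add sm)
    show "\<forall>k<m. S m (unit_vec m k) = c k" using un[of m] by simp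
  qed
qed

lemma lift_free:
  fixes L :: "('r::comm_ring_1, 'l) module" and N :: "('r, 'm) module"
  assumes L: "rmod L" and N: "rmod N" and g: "g \<in> rhom L N"
    and f: "f \<in> rhom (module_vec TYPE('r) m) N" and im: "\<forall>v\<in>carrier_vec m. f v \<in> g ` carrier L"
  shows "\<exists>h \<in> rhom (module_vec TYPE('r) m) L. \<forall>v\<in>carrier_vec m. g (h v) = f v"
proof -
  have "\<exists>c. c \<in> carrier L \<and> g c = f (unit_vec m k)" for k
  proof -
    have "f (unit_vec m k) \<in> g ` carrier L" using im by simp
    then show ?thesis by (auto simp: image_iff)
  qed
  then obtain c where c: "\<And>k. c k \<in> carrier L" "\<And>k. g (c k) = f (unit_vec m k)" by metis
  from ex_rhom_vec[OF L, of m c] c(1) obtain h where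
    h: "h \<in> rhom (module_vec TYPE('r) m) L" "\<forall>k<m. h (unit_vec m k) = c k" by auto
  have "g (h v) = f v" if "v \<in> carrier_vec m" for v
    by (rule rhom_vec_eq[OF rhom_comp[OF h(1) g] f N _ that]) (use h(2) c(2) in simp)
  then show ?thesis using h(1) by blast
qed

text \<open>Precomposing with the retraction \<open>t\<close> reduces the problem to a free module;
  composing the lift with the section \<open>s\<close> returns to \<open>P\<close>.\<close>

lemma lift_projective:
  fixes P :: "('r::comm_ring_1, 'p) module" and L :: "('r, 'l) module" and N :: "('r, 'm) module"
  assumes P: "fg_projective P" and L: "rmod L" and N: "rmod N" and g: "g \<in> rhom L N"
    and f: "f \<in> rhom P N" and im: "\<forall>v\<in>carrier P. f v \<in> g ` carrier L"
  shows "\<exists>h \<in> rhom P L. \<forall>v\<in>carrier P. g (h v) = f v"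
proof -
  obtain m s t where s: "s \<in> rhom P (module_vec TYPE('r) m)" and t: "t \<in> rhom (module_vec TYPE('r) m) P"
    and st: "\<forall>v\<in>carrier P. t (s v) = v"
    using P unfolding fg_projective_def by (elim conjE exE bexE)
  have s1: "s v \<in> carrier_vec m" if "v \<in> carrier P" for v using rhomD(1)[OF s that] by (simp add: module_vec_simps)
  have t1: "t v \<in> carrier P" if "v \<in> carrier_vec m" for v using rhomD(1)[OF t] that by (simp add: module_vec_simps)
  have "\<forall>v\<in>carrier_vec m. f (t v) \<in> g ` carrier L" using im t1 by simp
  from lift_free[OF L N g rhom_comp[OF t f] this]
  obtain h where h: "h \<in> rhom (module_vec TYPE('r) m) L" "\<forall>v\<in>carrier_vec m. g (h v) = f (t v)" by blast
  show ?thesis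
    by (rule bexI[OF _ rhom_comp[OF s h(1)]]) (use h(2) s1 st in simp)
qed

lemma fg_projective_vec: "fg_projective (module_vec TYPE('r::comm_ring_1) n)"
  unfolding fg_projective_def
proof (intro conjI)
  let ?V = "module_vec TYPE('r) n"
  have i: "(\<lambda>v. v) \<in> rhom ?V ?V" by (rule rhomI) simp_all
  show "\<exists>m. \<exists>s\<in>rhom ?V (module_vec TYPE('r) m). \<exists>t\<in>rhom (module_vec TYPE('r) m) ?V. \<forall>v\<in>carrier ?V. t (s v) = v"
    by (rule exI[of _ n], rule bexI[OF _ i], rule bexI[OF _ i]) simp
qed (rule rmod_vec)

lemma a_kernel_iff: "x \<in> a_kernel M N h \<longleftrightarrow> x \<in> carrier M \<and> h x = \<zero>\<^bsub>N\<^esub>"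
  unfolding a_kernel_def Coset.kernel_def by simp

lemma resolutionD:
  fixes M :: "('r::comm_ring_1, 'm) module"
  assumes "is_resolution P \<delta> \<epsilon> M"
  shows "rmod (P i)" "\<delta> i \<in> rhom (P (Suc i)) (P i)" "\<epsilon> \<in> rhom (P 0) M" "\<epsilon> ` carrier (P 0) = carrier M"
    "x \<in> carrier (P 0) \<Longrightarrow> \<epsilon> x = \<zero>\<^bsub>M\<^esub> \<Longrightarrow> x \<in> \<delta> 0 ` carrier (P (Suc 0))"
    "x \<in> carrier (P (Suc i)) \<Longrightarrow> \<delta> i x = \<zero>\<^bsub>P i\<^esub> \<Longrightarrow> x \<in> \<delta> (Suc i) ` carrier (P (Suc (Suc i)))"
    "x \<in> carrier (P (Suc 0)) \<Longrightarrow> \<epsilon> (\<delta> 0 x) = \<zero>\<^bsub>M\<^esub>"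
    "x \<in> carrier (P (Suc (Suc i))) \<Longrightarrow> \<delta> i (\<delta> (Suc i) x) = \<zero>\<^bsub>P i\<^esub>"
proof -
  note a = assms[unfolded is_resolution_def]
  note a1 = a[THEN conjunct1, rule_format] and b1 = a[THEN conjunct2]
  note a2 = b1[THEN conjunct1, rule_format] and b2 = b1[THEN conjunct2]
  note a3 = b2[THEN conjunct1] and b3 = b2[THEN conjunct2]
  note a4 = b3[THEN conjunct1] and b4 = b3[THEN conjunct2]
  note a5 = b4[THEN conjunct1] and a6 = b4[THEN conjunct2, rule_format]
  show "rmod (P i)" by (rule a1)
  show "\<delta> i \<in> rhom (P (Suc i)) (P i)" by (rule a2)
  show "\<epsilon> \<in> rhom (P 0) M" by (rule a3)
  show "\<epsilon> ` carrier (P 0) = carrier M" by (rule a4)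
  show "x \<in> carrier (P 0) \<Longrightarrow> \<epsilon> x = \<zero>\<^bsub>M\<^esub> \<Longrightarrow> x \<in> \<delta> 0 ` carrier (P (Suc 0))"
    using a5 a_kernel_iff[of x "P 0" M \<epsilon>] by simp
  show "x \<in> carrier (P (Suc i)) \<Longrightarrow> \<delta> i x = \<zero>\<^bsub>P i\<^esub> \<Longrightarrow> x \<in> \<delta> (Suc i) ` carrier (P (Suc (Suc i)))"
    using a6[of i] a_kernel_iff[of x "P (Suc i)" "P i" "\<delta> i"] by simp
  show "\<epsilon> (\<delta> 0 x) = \<zero>\<^bsub>M\<^esub>" if "x \<in> carrier (P (Suc 0))"
  proof -
    have "\<delta> 0 x \<in> a_kernel (P 0) M \<epsilon>" unfolding a5 using that by simp
    then show ?thesis unfolding a_kernel_iff by simp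
  qed
  show "\<delta> i (\<delta> (Suc i) x) = \<zero>\<^bsub>P i\<^esub>" if "x \<in> carrier (P (Suc (Suc i)))"
  proof -
    have "\<delta> (Suc i) x \<in> a_kernel (P (Suc i)) (P i) (\<delta> i)" unfolding a6 using that by simp
    then show ?thesis unfolding a_kernel_iff by simp
  qed
qed

section \<open>Chain maps and homotopies between resolutions\<close>

lemma comparison_map:
  fixes M :: "('r::comm_ring_1, 'm) module" and P :: "nat \<Rightarrow> ('r, 'p) module" and Q :: "nat \<Rightarrow> ('r, 'q) module"
  assumes M: "rmod M" and P: "is_resolution P \<delta> \<epsilon> M" and proj: "\<forall>i. fg_projective (P i)"
    and Q: "is_resolution Q \<delta>' \<epsilon>' M"
  shows "\<exists>\<phi>. (\<forall>i. \<phi> i \<in> rhom (P i) (Q i)) \<and> (\<forall>v\<in>carrier (P 0). \<epsilon>' (\<phi> 0 v) = \<epsilon> v) \<and>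
    (\<forall>i. \<forall>v\<in>carrier (P (Suc i)). \<delta>' i (\<phi> (Suc i) v) = \<phi> i (\<delta> i v))"
proof -
  note Pd = resolutionD[OF P] and Qd = resolutionD[OF Q]
  \<comment> \<open>The last conjunct is the invariant that permits the next lift: after the
    differential of \<open>P\<close>, the map constructed so far lands in the image of the
    differential of \<open>Q\<close>.\<close>
  define R where "R n \<phi> \<longleftrightarrow> \<phi> \<in> rhom (P n) (Q n) \<and> (n = 0 \<longrightarrow> (\<forall>v\<in>carrier (P 0). \<epsilon>' (\<phi> v) = \<epsilon> v)) \<and>
    (\<forall>v\<in>carrier (P (Suc n)). \<phi> (\<delta> n v) \<in> \<delta>' n ` carrier (Q (Suc n)))" for n \<phi>
  have "\<exists>f. \<forall>n. R n (f n) \<and> (\<forall>v\<in>carrier (P (Suc n)). \<delta>' n (f (Suc n) v) = f n (\<delta> n v))"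
  proof (rule dependent_nat_choice)
    have "\<forall>v\<in>carrier (P 0). \<epsilon> v \<in> \<epsilon>' ` carrier (Q 0)"
      using rhomD(1)[OF Pd(3)] Qd(4) by simp
    from lift_projective[OF spec[OF proj] Qd(1) M Qd(3) Pd(3) this]
    obtain h where h: "h \<in> rhom (P 0) (Q 0)" "\<forall>v\<in>carrier (P 0). \<epsilon>' (h v) = \<epsilon> v" by (elim bexE)
    have "h (\<delta> 0 v) \<in> \<delta>' 0 ` carrier (Q (Suc 0))" if v: "v \<in> carrier (P (Suc 0))" for v
    proof (rule Qd(5))
      have dv: "\<delta> 0 v \<in> carrier (P 0)" by (rule rhomD(1)[OF Pd(2) v])
      show "h (\<delta> 0 v) \<in> carrier (Q 0)" by (rule rhomD(1)[OF h(1) dv])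
      show "\<epsilon>' (h (\<delta> 0 v)) = \<zero>\<^bsub>M\<^esub>" using h(2) dv Pd(7)[OF v] by simp
    qed
    then show "\<exists>x. R 0 x" unfolding R_def using h by blast
  next
    fix x n assume x: "R n x"
    have xh: "x \<in> rhom (P n) (Q n)" using x unfolding R_def by simp
    have xi: "\<forall>v\<in>carrier (P (Suc n)). x (\<delta> n v) \<in> \<delta>' n ` carrier (Q (Suc n))"
      using x unfolding R_def by simp
    from lift_projective[OF spec[OF proj] Qd(1) Qd(1) Qd(2) rhom_comp[OF Pd(2) xh] xi]
    obtain h where h: "h \<in> rhom (P (Suc n)) (Q (Suc n))" "\<forall>v\<in>carrier (P (Suc n)). \<delta>' n (h v) = x (\<delta> n v)"
      by (elim bexE)
    have "h (\<delta> (Suc n) v) \<in> \<delta>' (Suc n) ` carrier (Q (Suc (Suc n)))" if v: "v \<in> carrier (P (Suc (Suc n)))" for v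
    proof (rule Qd(6))
      have dv: "\<delta> (Suc n) v \<in> carrier (P (Suc n))" by (rule rhomD(1)[OF Pd(2) v])
      show "h (\<delta> (Suc n) v) \<in> carrier (Q (Suc n))" by (rule rhomD(1)[OF h(1) dv])
      show "\<delta>' n (h (\<delta> (Suc n) v)) = \<zero>\<^bsub>Q n\<^esub>" 
        using h(2) dv Pd(8)[OF v] rhom_zero[OF xh Pd(1) Qd(1)] by simp
    qed
    then show "\<exists>y. R (Suc n) y \<and> (\<forall>v\<in>carrier (P (Suc n)). \<delta>' n (y v) = x (\<delta> n v))"
      unfolding R_def using h by blast
  qed
  then obtain f where f: "\<forall>n. R n (f n) \<and> (\<forall>v\<in>carrier (P (Suc n)). \<delta>' n (f (Suc n) v) = f n (\<delta> n v))"
    by (elim exE)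
  show ?thesis
  proof (rule exI[of _ f], intro conjI allI)
    show "f i \<in> rhom (P i) (Q i)" for i using f[THEN spec, THEN conjunct1, of i] unfolding R_def by simp
    show "\<forall>v\<in>carrier (P 0). \<epsilon>' (f 0 v) = \<epsilon> v" using f[THEN spec, THEN conjunct1, of 0] unfolding R_def by simp
    show "\<forall>v\<in>carrier (P (Suc i)). \<delta>' i (f (Suc i) v) = f i (\<delta> i v)" for i
      by (rule f[THEN spec, THEN conjunct2])
  qed
qed

lemma mult_mat_vec_smult:
  fixes A :: "'r::comm_ring_1 mat"
  assumes "A \<in> carrier_mat n m" "v \<in> carrier_vec m"
  shows "A *\<^sub>v (a \<cdot>\<^sub>v v) = a \<cdot>\<^sub>v (A *\<^sub>v v)"
proof (rule eq_vecI)
  fix i assume "i < dim_vec (a \<cdot>\<^sub>v (A *\<^sub>v v))"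
  then have i: "i < dim_row A" by simp
  have "row A i \<in> carrier_vec m" using assms(1) i by auto
  then show "(A *\<^sub>v (a \<cdot>\<^sub>v v)) $ i = (a \<cdot>\<^sub>v (A *\<^sub>v v)) $ i"
    using i assms(2) by simp
qed simp

lemma mult_mat_vec_rhom:
  fixes A :: "'r::comm_ring_1 mat"
  assumes "A \<in> carrier_mat n m"
  shows "(\<lambda>v. A *\<^sub>v v) \<in> rhom (module_vec TYPE('r) m) (module_vec TYPE('r) n)"
  by (rule rhomI) (use assms in \<open>simp_all add: module_vec_simps mult_add_distrib_mat_vec[OF assms] mult_mat_vec_smult[OF assms]\<close>)

lemma rhom_minus:
  fixes f :: "'m \<Rightarrow> 'r::comm_ring_1 vec"
  assumes f: "f \<in> rhom M (module_vec TYPE('r) n)" and g: "g \<in> rhom M (module_vec TYPE('r) n)"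
  shows "(\<lambda>v. f v - g v) \<in> rhom M (module_vec TYPE('r) n)"
proof -
  note fd = rhomD[OF f, unfolded module_vec_simps] and gd = rhomD[OF g, unfolded module_vec_simps]
  show ?thesis
  proof (rule rhomI; unfold module_vec_simps)
    fix x assume x: "x \<in> carrier M"
    note dims = carrier_vecD[OF fd(1)] carrier_vecD[OF gd(1)]
    show "f x - g x \<in> carrier_vec n" using fd(1)[OF x] gd(1)[OF x] by simp
    fix a show "f (a \<odot>\<^bsub>M\<^esub> x) - g (a \<odot>\<^bsub>M\<^esub> x) = a \<cdot>\<^sub>v (f x - g x)"
      unfolding fd(3)[OF x] gd(3)[OF x]
      by (rule eq_vecI) (simp_all add: dims[OF x] right_diff_distrib)
    fix y assume y: "y \<in> carrier M"
    show "f (x \<oplus>\<^bsub>M\<^esub> y) - g (x \<oplus>\<^bsub>M\<^esub> y) = f x - g x + (f y - g y)"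
      unfolding fd(2)[OF x y] gd(2)[OF x y]
      by (rule eq_vecI) (simp_all add: dims[OF x] dims[OF y])
  qed
qed

text \<open>A chain endomorphism over the zero map of \<open>M\<close> is null-homotopic. The
  homotopy identity is recorded in positive degrees; in degree 0 the equation
  \<open>d 0 h = \<chi> 0\<close> serves as the start of the construction.\<close>

lemma homotopy:
  fixes M :: "('r::comm_ring_1, 'm) module" and \<chi> :: "nat \<Rightarrow> 'r vec \<Rightarrow> 'r vec"
  assumes M: "rmod M" and F: "free_resolution b d \<epsilon> M"
    and \<chi>': "\<forall>i. \<chi> i \<in> rhom (module_vec TYPE('r) (b i)) (module_vec TYPE('r) (b i))"
    and \<chi>0': "\<forall>v\<in>carrier_vec (b 0). \<epsilon> (\<chi> 0 v) = \<zero>\<^bsub>M\<^esub>"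
    and \<chi>d': "\<forall>i. \<forall>v\<in>carrier_vec (b (Suc i)). d i *\<^sub>v \<chi> (Suc i) v = \<chi> i (d i *\<^sub>v v)"
  shows "\<exists>h. (\<forall>i. h i \<in> rhom (module_vec TYPE('r) (b i)) (module_vec TYPE('r) (b (Suc i)))) \<and>
    (\<forall>i. \<forall>v\<in>carrier_vec (b (Suc i)). d (Suc i) *\<^sub>v h (Suc i) v + h i (d i *\<^sub>v v) = \<chi> (Suc i) v)"
proof -
  let ?V = "\<lambda>i. module_vec TYPE('r) (b i)"
  have dc: "d i \<in> carrier_mat (b i) (b (Suc i))" for i using F unfolding free_resolution_def by simp
  have "is_resolution ?V (\<lambda>i v. d i *\<^sub>v v) \<epsilon> M" using F unfolding free_resolution_def by simp
  note Fd = resolutionD[OF this, unfolded module_vec_simps]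
  have dcl: "d i *\<^sub>v v \<in> carrier_vec (b i)" if "v \<in> carrier_vec (b (Suc i))" for i v by (rule mult_mat_vec_carrier[OF dc that])
  note \<chi> = spec[OF \<chi>'] and \<chi>0 = bspec[OF \<chi>0'] and \<chi>d = bspec[OF spec[OF \<chi>d']]
  note \<chi>c = rhomD(1)[OF \<chi>, unfolded module_vec_simps]
  \<comment> \<open>The invariant says that the difference of \<open>\<chi>\<close> and
    \<open>h d\<close> in the next degree is a cycle, so that it can be lifted through the following
    differential.\<close>
  define R where "R n h \<longleftrightarrow> h \<in> rhom (?V n) (?V (Suc n)) \<and>
    (\<forall>v\<in>carrier_vec (b (Suc n)). d n *\<^sub>v h (d n *\<^sub>v v) = \<chi> n (d n *\<^sub>v v))" for n h
  have "\<exists>h. \<forall>n. R n (h n) \<and>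
     (\<forall>v\<in>carrier_vec (b (Suc n)). d (Suc n) *\<^sub>v h (Suc n) v = \<chi> (Suc n) v - h n (d n *\<^sub>v v))"
  proof (rule dependent_nat_choice)
    have "\<forall>v\<in>carrier (?V 0). \<chi> 0 v \<in> (\<lambda>v. d 0 *\<^sub>v v) ` carrier (?V (Suc 0))"
      using Fd(5)[OF \<chi>c \<chi>0] by (simp add: module_vec_simps)
    from lift_projective[OF fg_projective_vec rmod_vec rmod_vec mult_mat_vec_rhom[OF dc] \<chi> this]
    obtain h where h: "h \<in> rhom (?V 0) (?V (Suc 0))" "\<forall>v\<in>carrier (?V 0). d 0 *\<^sub>v h v = \<chi> 0 v" by (elim bexE)
    have "R 0 h" unfolding R_def using h dcl[of _ 0] by (simp add: module_vec_simps)
    then show "\<exists>x. R 0 x" by blast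
  next
    fix x n assume x: "R n x"
    have xh: "x \<in> rhom (?V n) (?V (Suc n))" using x unfolding R_def by simp
    have xd: "d n *\<^sub>v x (d n *\<^sub>v v) = \<chi> n (d n *\<^sub>v v)" if "v \<in> carrier_vec (b (Suc n))" for v
      using x that unfolding R_def by simp
    note xc = rhomD(1)[OF xh, unfolded module_vec_simps]
    let ?f = "\<lambda>v. \<chi> (Suc n) v - x (d n *\<^sub>v v)"
    have fh: "?f \<in> rhom (?V (Suc n)) (?V (Suc n))"
      by (rule rhom_minus[OF \<chi> rhom_comp[OF mult_mat_vec_rhom[OF dc] xh]])
    have im: "\<forall>v\<in>carrier (?V (Suc n)). ?f v \<in> (\<lambda>v. d (Suc n) *\<^sub>v v) ` carrier (?V (Suc (Suc n)))"
    proof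
      fix v assume "v \<in> carrier (?V (Suc n))"
      then have v: "v \<in> carrier_vec (b (Suc n))" by (simp add: module_vec_simps)
      have c: "\<chi> (Suc n) v \<in> carrier_vec (b (Suc n))" "x (d n *\<^sub>v v) \<in> carrier_vec (b (Suc n))"
        using \<chi>c[OF v] xc[OF dcl[OF v]] by simp_all
      have "d n *\<^sub>v ?f v = d n *\<^sub>v \<chi> (Suc n) v - d n *\<^sub>v x (d n *\<^sub>v v)"
        by (rule mult_minus_distrib_mat_vec[OF dc c])
      also have "\<dots> = \<chi> n (d n *\<^sub>v v) - \<chi> n (d n *\<^sub>v v)" unfolding \<chi>d[OF v] xd[OF v] ..
      also have "\<dots> = 0\<^sub>v (b n)" using \<chi>c[OF dcl[OF v]] by simp
      finally have "d n *\<^sub>v ?f v = 0\<^sub>v (b n)" .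
      then show "?f v \<in> (\<lambda>v. d (Suc n) *\<^sub>v v) ` carrier (?V (Suc (Suc n)))"
        using Fd(6)[of "?f v" n] c by (simp add: module_vec_simps)
    qed
    from lift_projective[OF fg_projective_vec rmod_vec rmod_vec mult_mat_vec_rhom[OF dc] fh im]
    obtain h where h: "h \<in> rhom (?V (Suc n)) (?V (Suc (Suc n)))" "\<forall>v\<in>carrier (?V (Suc n)). d (Suc n) *\<^sub>v h v = ?f v"
      by (elim bexE)
    have "d (Suc n) *\<^sub>v h (d (Suc n) *\<^sub>v v) = \<chi> (Suc n) (d (Suc n) *\<^sub>v v)" if v: "v \<in> carrier_vec (b (Suc (Suc n)))" for v
    proof -
      have "d (Suc n) *\<^sub>v h (d (Suc n) *\<^sub>v v) = \<chi> (Suc n) (d (Suc n) *\<^sub>v v) - x (d n *\<^sub>v (d (Suc n) *\<^sub>v v))"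
        using h(2) dcl[OF v] by (simp add: module_vec_simps)
      also have "d n *\<^sub>v (d (Suc n) *\<^sub>v v) = 0\<^sub>v (b n)" by (rule Fd(8)[OF v])
      also have "x (0\<^sub>v (b n)) = 0\<^sub>v (b (Suc n))" using rhom_zero[OF xh rmod_vec rmod_vec] by (simp add: module_vec_simps)
      finally show ?thesis using \<chi>c[OF dcl[OF v]] by simp
    qed
    then have "R (Suc n) h" unfolding R_def using h(1) by blast
    moreover have "\<forall>v\<in>carrier_vec (b (Suc n)). d (Suc n) *\<^sub>v h v = ?f v" using h(2) by (simp add: module_vec_simps)
    ultimately show "\<exists>y. R (Suc n) y \<and> (\<forall>v\<in>carrier_vec (b (Suc n)). d (Suc n) *\<^sub>v y v = \<chi> (Suc n) v - x (d n *\<^sub>v v))"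
      by blast
  qed
  then obtain h where h: "\<forall>n. R n (h n) \<and>
    (\<forall>v\<in>carrier_vec (b (Suc n)). d (Suc n) *\<^sub>v h (Suc n) v = \<chi> (Suc n) v - h n (d n *\<^sub>v v))"
    by (elim exE)
  note h = h[THEN spec, THEN conjunct1] h[THEN spec, THEN conjunct2, THEN bspec]
  have hh: "h i \<in> rhom (?V i) (?V (Suc i))" for i using h(1)[of i] unfolding R_def by simp
  have "d (Suc i) *\<^sub>v h (Suc i) v + h i (d i *\<^sub>v v) = \<chi> (Suc i) v" if v: "v \<in> carrier_vec (b (Suc i))" for i v
  proof -
    have "h i (d i *\<^sub>v v) \<in> carrier_vec (b (Suc i))"
      using rhomD(1)[OF hh, unfolded module_vec_simps, OF dcl[OF v]] .
    then have "\<chi> (Suc i) v - h i (d i *\<^sub>v v) + h i (d i *\<^sub>v v) = \<chi> (Suc i) v"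
      using \<chi>c[OF v] by (intro eq_vecI) auto
    then show ?thesis using h(2)[OF v] by simp
  qed
  then show ?thesis by (intro exI[of _ h] conjI allI ballI hh)
qed

lemma rhom_vec_mat:
  fixes f :: "'r::comm_ring_1 vec \<Rightarrow> 'r vec"
  assumes f: "f \<in> rhom (module_vec TYPE('r) m) (module_vec TYPE('r) n)"
  shows "\<exists>A\<in>carrier_mat n m. \<forall>v\<in>carrier_vec m. f v = A *\<^sub>v v"
proof -
  define A where "A = mat n m (\<lambda>(i, k). f (unit_vec m k) $ i)"
  have A: "A \<in> carrier_mat n m" unfolding A_def by simp
  have fc: "f (unit_vec m k) \<in> carrier_vec n" for k
    using rhomD(1)[OF f, of "unit_vec m k"] by (simp add: module_vec_simps)
  have "f v = A *\<^sub>v v" if "v \<in> carrier_vec m" for v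
  proof (rule rhom_vec_eq[OF f mult_mat_vec_rhom[OF A] rmod_vec _ that])
    fix k assume k: "k < m"
    show "f (unit_vec m k) = A *\<^sub>v unit_vec m k"
      by (rule eq_vecI) (use k fc[of k] in \<open>simp_all add: A_def scalar_prod_right_unit\<close>)
  qed
  then show ?thesis using A by blast
qed

text \<open>Comparison maps exist in both directions, and the identity minus the composite
  \<open>\<psi> \<phi>\<close> lies over the zero map of \<open>M\<close>. The homotopy is taken on
  the free side, where maps are matrices and can be reduced modulo the variables.\<close>

theorem homotopy_equivalence:
  fixes M :: "('r::comm_ring_1, 'm) module" and P :: "nat \<Rightarrow> ('r, 'p) module"
  assumes M: "rmod M" and F: "free_resolution b d \<epsilon> M"
    and P: "is_resolution P \<delta> \<epsilon>' M" and proj: "\<forall>i. fg_projective (P i)"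
  shows "\<exists>\<phi> \<psi> h. (\<forall>i. \<phi> i \<in> rhom (module_vec TYPE('r) (b i)) (P i)) \<and>
    (\<forall>i. \<psi> i \<in> rhom (P i) (module_vec TYPE('r) (b i))) \<and>
    (\<forall>i. h i \<in> rhom (module_vec TYPE('r) (b i)) (module_vec TYPE('r) (b (Suc i)))) \<and>
    (\<forall>i. \<forall>v\<in>carrier_vec (b (Suc i)). \<delta> i (\<phi> (Suc i) v) = \<phi> i (d i *\<^sub>v v)) \<and>
    (\<forall>i. \<forall>v\<in>carrier (P (Suc i)). d i *\<^sub>v \<psi> (Suc i) v = \<psi> i (\<delta> i v)) \<and>
    (\<forall>i. \<forall>v\<in>carrier_vec (b (Suc i)). d (Suc i) *\<^sub>v h (Suc i) v + h i (d i *\<^sub>v v) = v - \<psi> (Suc i) (\<phi> (Suc i) v))"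
proof -
  let ?V = "\<lambda>i. module_vec TYPE('r) (b i)"
  have dc: "d i \<in> carrier_mat (b i) (b (Suc i))" for i using F unfolding free_resolution_def by simp
  have FF: "is_resolution ?V (\<lambda>i v. d i *\<^sub>v v) \<epsilon> M" using F unfolding free_resolution_def by simp
  obtain \<phi> where \<phi>: "\<forall>i. \<phi> i \<in> rhom (?V i) (P i)" "\<forall>v\<in>carrier (?V 0). \<epsilon>' (\<phi> 0 v) = \<epsilon> v"
    "\<forall>i. \<forall>v\<in>carrier (?V (Suc i)). \<delta> i (\<phi> (Suc i) v) = \<phi> i (d i *\<^sub>v v)"
    using comparison_map[OF M FF allI[OF fg_projective_vec] P] by (elim exE conjE)
  obtain \<psi> where \<psi>: "\<forall>i. \<psi> i \<in> rhom (P i) (?V i)" "\<forall>v\<in>carrier (P 0). \<epsilon> (\<psi> 0 v) = \<epsilon>' v"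
    "\<forall>i. \<forall>v\<in>carrier (P (Suc i)). d i *\<^sub>v \<psi> (Suc i) v = \<psi> i (\<delta> i v)"
    using comparison_map[OF M P proj FF] by (elim exE conjE)
  note \<phi>' = \<phi>(2)[unfolded module_vec_simps] \<phi>(3)[unfolded module_vec_simps]
  have \<phi>c: "\<phi> i v \<in> carrier (P i)" if "v \<in> carrier_vec (b i)" for i v
    using rhomD(1)[OF spec[OF \<phi>(1)], of v i] that by (simp add: module_vec_simps)
  have \<psi>c: "\<psi> i v \<in> carrier_vec (b i)" if "v \<in> carrier (P i)" for i v
    using rhomD(1)[OF spec[OF \<psi>(1)], of v i] that by (simp add: module_vec_simps)
  let ?\<chi> = "\<lambda>i v. v - \<psi> i (\<phi> i v)"
  have i: "(\<lambda>v. v) \<in> rhom (?V i) (?V i)" for i by (rule rhomI) simp_all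
  have \<chi>: "?\<chi> i \<in> rhom (?V i) (?V i)" for i
    by (rule rhom_minus[OF i rhom_comp[OF spec[OF \<phi>(1)] spec[OF \<psi>(1)]]])
  have \<chi>0: "\<forall>v\<in>carrier_vec (b 0). \<epsilon> (?\<chi> 0 v) = \<zero>\<^bsub>M\<^esub>"
  proof
    fix v :: "'r vec" assume v: "v \<in> carrier_vec (b 0)"
    let ?w = "\<psi> 0 (\<phi> 0 v)"
    have w: "?w \<in> carrier_vec (b 0)" using \<psi>c \<phi>c v by simp
    have e: "\<epsilon> ?w = \<epsilon> v" using \<psi>(2) \<phi>'(1) \<phi>c[OF v] v by simp
    have ev: "\<epsilon> v \<in> carrier M" using rhomD(1)[OF resolutionD(3)[OF FF], unfolded module_vec_simps, OF v] .
    have "v - ?w = v + (-1) \<cdot>\<^sub>v ?w" using v w by (intro eq_vecI) simp_all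
    then have "\<epsilon> (v - ?w) = \<epsilon> v \<oplus>\<^bsub>M\<^esub> (-1) \<odot>\<^bsub>M\<^esub> \<epsilon> ?w"
      using rhomD(2)[OF resolutionD(3)[OF FF], unfolded module_vec_simps, of v "(-1) \<cdot>\<^sub>v ?w"]
        rhomD(3)[OF resolutionD(3)[OF FF], unfolded module_vec_simps, of ?w "-1"] v w by simp
    also have "\<dots> = 1 \<odot>\<^bsub>M\<^esub> \<epsilon> v \<oplus>\<^bsub>M\<^esub> (-1) \<odot>\<^bsub>M\<^esub> \<epsilon> v" unfolding e rmodD(11)[OF M ev] ..
    also have "\<dots> = \<zero>\<^bsub>M\<^esub>" using rmodD(8)[OF M ev, of 1 "-1"] rmodD(12)[OF M ev] by simp
    finally show "\<epsilon> (?\<chi> 0 v) = \<zero>\<^bsub>M\<^esub>" .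
  qed
  have \<chi>d: "\<forall>i. \<forall>v\<in>carrier_vec (b (Suc i)). d i *\<^sub>v ?\<chi> (Suc i) v = ?\<chi> i (d i *\<^sub>v v)"
  proof (intro allI ballI)
    fix i and v :: "'r vec" assume v: "v \<in> carrier_vec (b (Suc i))"
    have "d i *\<^sub>v ?\<chi> (Suc i) v = d i *\<^sub>v v - d i *\<^sub>v \<psi> (Suc i) (\<phi> (Suc i) v)"
      by (rule mult_minus_distrib_mat_vec[OF dc v \<psi>c[OF \<phi>c[OF v]]])
    then show "d i *\<^sub>v ?\<chi> (Suc i) v = ?\<chi> i (d i *\<^sub>v v)" using \<psi>(3) \<phi>'(2) \<phi>c[OF v] v by simp
  qed
  obtain h where h: "\<forall>i. h i \<in> rhom (?V i) (?V (Suc i))"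
    "\<forall>i. \<forall>v\<in>carrier_vec (b (Suc i)). d (Suc i) *\<^sub>v h (Suc i) v + h i (d i *\<^sub>v v) = ?\<chi> (Suc i) v"
    using homotopy[where \<chi>="?\<chi>", OF M F allI[OF \<chi>] \<chi>0 \<chi>d] by (elim exE conjE)
  show ?thesis
    by (rule exI[of _ \<phi>], rule exI[of _ \<psi>], rule exI[of _ h])
      (intro conjI \<phi>(1) \<psi>(1) h(1) \<phi>'(2) \<psi>(3) h(2))
qed

section \<open>Quotient modules\<close>

definition rsub :: "('r::comm_ring_1, 'm) module \<Rightarrow> 'm set \<Rightarrow> bool" where
  "rsub M N \<longleftrightarrow> N \<subseteq> carrier M \<and> \<zero>\<^bsub>M\<^esub> \<in> N \<and> (\<forall>x\<in>N. \<forall>y\<in>N. x \<oplus>\<^bsub>M\<^esub> y \<in> N) \<and> (\<forall>a. \<forall>x\<in>N. a \<odot>\<^bsub>M\<^esub> x \<in> N)"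

text \<open>Additive inverses are obtained from the scalar \<open>-1\<close>, which is why no axiom
  about them appears.\<close>

lemma rmodI:
  fixes M :: "('r::comm_ring_1, 'm) module"
  assumes "\<zero>\<^bsub>M\<^esub> \<in> carrier M"
    "\<And>x y. x \<in> carrier M \<Longrightarrow> y \<in> carrier M \<Longrightarrow> x \<oplus>\<^bsub>M\<^esub> y \<in> carrier M"
    "\<And>a x. x \<in> carrier M \<Longrightarrow> a \<odot>\<^bsub>M\<^esub> x \<in> carrier M"
    "\<And>x y z. x \<in> carrier M \<Longrightarrow> y \<in> carrier M \<Longrightarrow> z \<in> carrier M \<Longrightarrow> (x \<oplus>\<^bsub>M\<^esub> y) \<oplus>\<^bsub>M\<^esub> z = x \<oplus>\<^bsub>M\<^esub> (y \<oplus>\<^bsub>M\<^esub> z)"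
    "\<And>x y. x \<in> carrier M \<Longrightarrow> y \<in> carrier M \<Longrightarrow> x \<oplus>\<^bsub>M\<^esub> y = y \<oplus>\<^bsub>M\<^esub> x"
    "\<And>x. x \<in> carrier M \<Longrightarrow> \<zero>\<^bsub>M\<^esub> \<oplus>\<^bsub>M\<^esub> x = x"
    "\<And>a b x. x \<in> carrier M \<Longrightarrow> (a + b) \<odot>\<^bsub>M\<^esub> x = a \<odot>\<^bsub>M\<^esub> x \<oplus>\<^bsub>M\<^esub> b \<odot>\<^bsub>M\<^esub> x"
    "\<And>a x y. x \<in> carrier M \<Longrightarrow> y \<in> carrier M \<Longrightarrow> a \<odot>\<^bsub>M\<^esub> (x \<oplus>\<^bsub>M\<^esub> y) = a \<odot>\<^bsub>M\<^esub> x \<oplus>\<^bsub>M\<^esub> a \<odot>\<^bsub>M\<^esub> y"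
    "\<And>a b x. x \<in> carrier M \<Longrightarrow> (a * b) \<odot>\<^bsub>M\<^esub> x = a \<odot>\<^bsub>M\<^esub> (b \<odot>\<^bsub>M\<^esub> x)"
    "\<And>x. x \<in> carrier M \<Longrightarrow> 1 \<odot>\<^bsub>M\<^esub> x = x"
    "\<And>x. x \<in> carrier M \<Longrightarrow> 0 \<odot>\<^bsub>M\<^esub> x = \<zero>\<^bsub>M\<^esub>"
  shows "rmod M"
proof (rule moduleI)
  show "cring (class_ring :: 'r ring)" by (rule class_cring.cring_axioms)
  show "abelian_group M"
  proof (rule abelian_groupI)
    fix x assume x: "x \<in> carrier M"
    have "(-1) \<odot>\<^bsub>M\<^esub> x \<oplus>\<^bsub>M\<^esub> x = ((-1) + 1) \<odot>\<^bsub>M\<^esub> x" unfolding assms(7)[OF x] assms(10)[OF x] ..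
    also have "\<dots> = \<zero>\<^bsub>M\<^esub>" using assms(11)[OF x] by simp
    finally show "\<exists>y\<in>carrier M. y \<oplus>\<^bsub>M\<^esub> x = \<zero>\<^bsub>M\<^esub>" using assms(3)[OF x] by blast
  qed (use assms in simp_all)
qed (simp_all add: assms)

lemma rmod_sub:
  fixes M :: "('r::comm_ring_1, 'm) module"
  assumes M: "rmod M" and N: "rsub M N"
  shows "rmod (M\<lparr>carrier := N\<rparr>)"
  by (rule rmodI) (use N rmodD[OF M] in \<open>auto simp: rsub_def subset_iff\<close>)

locale quotient =
  fixes M :: "('r::comm_ring_1, 'm) module" and N
  assumes M: "rmod M" and N: "rsub M N"
begin

abbreviation "Q \<equiv> quotient_module M N"

definition pr :: "'m \<Rightarrow> 'm set" where
  "pr x = N +>\<^bsub>M\<^esub> x"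

lemma Nsub: "x \<in> N \<Longrightarrow> x \<in> carrier M" using N unfolding rsub_def by blast
lemma N0: "\<zero>\<^bsub>M\<^esub> \<in> N" using N unfolding rsub_def by blast
lemma Nadd: "x \<in> N \<Longrightarrow> y \<in> N \<Longrightarrow> x \<oplus>\<^bsub>M\<^esub> y \<in> N" using N unfolding rsub_def by blast
lemma Nsmult: "x \<in> N \<Longrightarrow> a \<odot>\<^bsub>M\<^esub> x \<in> N" using N unfolding rsub_def by blast

lemmas Md = rmodD[OF M]

lemma mem_pr: "y \<in> pr x \<longleftrightarrow> (\<exists>n\<in>N. y = n \<oplus>\<^bsub>M\<^esub> x)"
  unfolding pr_def a_r_coset_def r_coset_def by simp

lemma neg: assumes "x \<in> carrier M" shows "(-1) \<odot>\<^bsub>M\<^esub> x \<oplus>\<^bsub>M\<^esub> x = \<zero>\<^bsub>M\<^esub>"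
proof -
  have "(-1) \<odot>\<^bsub>M\<^esub> x \<oplus>\<^bsub>M\<^esub> x = ((-1) + 1) \<odot>\<^bsub>M\<^esub> x" unfolding Md(8)[OF assms] Md(11)[OF assms] ..
  then show ?thesis using Md(12)[OF assms] by simp
qed

lemma pr_add_N: assumes n: "n \<in> N" and x: "x \<in> carrier M" shows "pr (n \<oplus>\<^bsub>M\<^esub> x) = pr x"
proof (intro subset_antisym subsetI)
  fix y assume "y \<in> pr (n \<oplus>\<^bsub>M\<^esub> x)"
  then obtain m where m: "m \<in> N" "y = m \<oplus>\<^bsub>M\<^esub> (n \<oplus>\<^bsub>M\<^esub> x)" unfolding mem_pr by blast
  then have "y = (m \<oplus>\<^bsub>M\<^esub> n) \<oplus>\<^bsub>M\<^esub> x" using Md(4)[OF Nsub Nsub x] n by simp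
  then show "y \<in> pr x" unfolding mem_pr using Nadd[OF m(1) n] by blast
next
  fix y assume "y \<in> pr x"
  then obtain m where m: "m \<in> N" "y = m \<oplus>\<^bsub>M\<^esub> x" unfolding mem_pr by blast
  let ?m = "m \<oplus>\<^bsub>M\<^esub> (-1) \<odot>\<^bsub>M\<^esub> n"
  have mN: "?m \<in> N" using Nadd[OF m(1) Nsmult[OF n]] .
  have "?m \<oplus>\<^bsub>M\<^esub> (n \<oplus>\<^bsub>M\<^esub> x) = (?m \<oplus>\<^bsub>M\<^esub> n) \<oplus>\<^bsub>M\<^esub> x" using Md(4)[OF Nsub[OF mN] Nsub[OF n] x] by simp
  also have "?m \<oplus>\<^bsub>M\<^esub> n = m"
    using Md(4)[OF Nsub[OF m(1)] Nsub[OF Nsmult[OF n]] Nsub[OF n]] neg[OF Nsub[OF n]] Md(7)[OF Nsub[OF m(1)]] by simp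
  finally show "y \<in> pr (n \<oplus>\<^bsub>M\<^esub> x)" unfolding mem_pr m(2) using mN by metis
qed

lemma mem_pr_self: "x \<in> carrier M \<Longrightarrow> x \<in> pr x"
  unfolding mem_pr using N0 Md(6) by metis

lemma pr_zero: "pr \<zero>\<^bsub>M\<^esub> = N"
  using Md(7)[OF Nsub] by (auto simp: mem_pr)

lemma pr_eq_N: assumes x: "x \<in> carrier M" shows "pr x = N \<longleftrightarrow> x \<in> N"
proof
  assume "pr x = N" then show "x \<in> N" using mem_pr_self[OF x] by simp
next
  assume "x \<in> N"
  then show "pr x = N" using pr_add_N[OF _ Md(1), of x] Md(7)[OF x] pr_zero by simp
qed

lemma Q_carrier: "carrier Q = pr ` carrier M"
  unfolding quotient_module_def pr_def A_RCOSETS_def RCOSETS_def a_r_coset_def by auto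

lemma Q_zero: "\<zero>\<^bsub>Q\<^esub> = N"
  unfolding quotient_module_def by simp

lemma Q_add: assumes x: "x \<in> carrier M" and y: "y \<in> carrier M" shows "pr x \<oplus>\<^bsub>Q\<^esub> pr y = pr (x \<oplus>\<^bsub>M\<^esub> y)"
proof -
  have "pr x \<oplus>\<^bsub>Q\<^esub> pr y = (\<Union>h\<in>pr x. \<Union>k\<in>pr y. {h \<oplus>\<^bsub>M\<^esub> k})"
    unfolding quotient_module_def set_add_def set_mult_def by simp
  also have "\<dots> = pr (x \<oplus>\<^bsub>M\<^esub> y)"
  proof (intro subset_antisym subsetI)
    fix z assume "z \<in> (\<Union>h\<in>pr x. \<Union>k\<in>pr y. {h \<oplus>\<^bsub>M\<^esub> k})"
    then obtain h k where hk: "h \<in> pr x" "k \<in> pr y" "z = h \<oplus>\<^bsub>M\<^esub> k" by auto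
    obtain n where n: "n \<in> N" "h = n \<oplus>\<^bsub>M\<^esub> x" using hk(1) unfolding mem_pr by blast
    obtain m where m: "m \<in> N" "k = m \<oplus>\<^bsub>M\<^esub> y" using hk(2) unfolding mem_pr by blast
    note nm = n(1) m(1) hk(3)[unfolded n(2) m(2)]
    note c = Nsub[OF nm(1)] Nsub[OF nm(2)] x y
    have "(n \<oplus>\<^bsub>M\<^esub> x) \<oplus>\<^bsub>M\<^esub> (m \<oplus>\<^bsub>M\<^esub> y) = n \<oplus>\<^bsub>M\<^esub> ((x \<oplus>\<^bsub>M\<^esub> m) \<oplus>\<^bsub>M\<^esub> y)" using c by (simp add: Md(2,4))
    also have "x \<oplus>\<^bsub>M\<^esub> m = m \<oplus>\<^bsub>M\<^esub> x" using c by (simp add: Md(5))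
    also have "n \<oplus>\<^bsub>M\<^esub> (m \<oplus>\<^bsub>M\<^esub> x \<oplus>\<^bsub>M\<^esub> y) = (n \<oplus>\<^bsub>M\<^esub> m) \<oplus>\<^bsub>M\<^esub> (x \<oplus>\<^bsub>M\<^esub> y)" using c by (simp add: Md(2,4))
    finally show "z \<in> pr (x \<oplus>\<^bsub>M\<^esub> y)" unfolding mem_pr nm(3) using Nadd[OF nm(1,2)] by blast
  next
    fix z assume "z \<in> pr (x \<oplus>\<^bsub>M\<^esub> y)"
    then obtain n where n: "n \<in> N" "z = n \<oplus>\<^bsub>M\<^esub> (x \<oplus>\<^bsub>M\<^esub> y)" unfolding mem_pr by blast
    then have "z = (n \<oplus>\<^bsub>M\<^esub> x) \<oplus>\<^bsub>M\<^esub> y" using Md(4)[OF Nsub x y] by simp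
    moreover have "n \<oplus>\<^bsub>M\<^esub> x \<in> pr x" unfolding mem_pr using n(1) by blast
    ultimately show "z \<in> (\<Union>h\<in>pr x. \<Union>k\<in>pr y. {h \<oplus>\<^bsub>M\<^esub> k})" using mem_pr_self[OF y] by blast
  qed
  finally show ?thesis .
qed

text \<open>The union in the definition of scalar multiplication is over equal cosets, since
  \<open>a\<close> maps \<open>N\<close> into itself.\<close>

lemma Q_smult: assumes x: "x \<in> carrier M" shows "a \<odot>\<^bsub>Q\<^esub> pr x = pr (a \<odot>\<^bsub>M\<^esub> x)"
proof -
  have "a \<odot>\<^bsub>Q\<^esub> pr x = (\<Union>v\<in>pr x. pr (a \<odot>\<^bsub>M\<^esub> v))" unfolding quotient_module_def pr_def by simp
  also have "\<dots> = (\<Union>v\<in>pr x. pr (a \<odot>\<^bsub>M\<^esub> x))"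
  proof (rule SUP_cong[OF refl])
    fix v assume "v \<in> pr x"
    then obtain n where n: "n \<in> N" "v = n \<oplus>\<^bsub>M\<^esub> x" unfolding mem_pr by blast
    then have "a \<odot>\<^bsub>M\<^esub> v = a \<odot>\<^bsub>M\<^esub> n \<oplus>\<^bsub>M\<^esub> a \<odot>\<^bsub>M\<^esub> x" using Md(9)[OF Nsub x] by simp
    then show "pr (a \<odot>\<^bsub>M\<^esub> v) = pr (a \<odot>\<^bsub>M\<^esub> x)" using pr_add_N[OF Nsmult[OF n(1)] Md(3)[OF x]] by simp
  qed
  also have "\<dots> = pr (a \<odot>\<^bsub>M\<^esub> x)" using mem_pr_self[OF x] by blast
  finally show ?thesis .
qed

lemma rmod_Q: "rmod Q"
proof (rule rmodI)
  have z: "\<zero>\<^bsub>Q\<^esub> = pr \<zero>\<^bsub>M\<^esub>" by (rule trans[OF Q_zero pr_zero[THEN sym]])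
  show "\<zero>\<^bsub>Q\<^esub> \<in> carrier Q" unfolding z Q_carrier using Md(1) by simp
  fix A assume "A \<in> carrier Q"
  then obtain x where x: "A = pr x" "x \<in> carrier M" unfolding Q_carrier by (rule imageE)
  show "\<zero>\<^bsub>Q\<^esub> \<oplus>\<^bsub>Q\<^esub> A = A" unfolding z x(1) Q_add[OF Md(1) x(2)] Md(6)[OF x(2)] ..
  show "1 \<odot>\<^bsub>Q\<^esub> A = A" unfolding x(1) Q_smult[OF x(2)] Md(11)[OF x(2)] ..
  show "0 \<odot>\<^bsub>Q\<^esub> A = \<zero>\<^bsub>Q\<^esub>" unfolding z x(1) Q_smult[OF x(2)] Md(12)[OF x(2)] ..
  fix a
  show "a \<odot>\<^bsub>Q\<^esub> A \<in> carrier Q" unfolding x(1) Q_smult[OF x(2)] Q_carrier using Md(3)[OF x(2)] by simp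
  fix b
  show "(a + b) \<odot>\<^bsub>Q\<^esub> A = a \<odot>\<^bsub>Q\<^esub> A \<oplus>\<^bsub>Q\<^esub> b \<odot>\<^bsub>Q\<^esub> A"
    unfolding x(1) Q_smult[OF x(2)] Q_add[OF Md(3)[OF x(2)] Md(3)[OF x(2)]] Md(8)[OF x(2)] ..
  show "(a * b) \<odot>\<^bsub>Q\<^esub> A = a \<odot>\<^bsub>Q\<^esub> (b \<odot>\<^bsub>Q\<^esub> A)"
    unfolding x(1) Q_smult[OF x(2)] Q_smult[OF Md(3)[OF x(2)]] Md(10)[OF x(2)] ..
next
  fix A B assume "A \<in> carrier Q" "B \<in> carrier Q"
  then obtain x y where x: "A = pr x" "x \<in> carrier M" and y: "B = pr y" "y \<in> carrier M"
    unfolding Q_carrier by (elim imageE)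
  show "A \<oplus>\<^bsub>Q\<^esub> B \<in> carrier Q" unfolding x(1) y(1) Q_add[OF x(2) y(2)] Q_carrier using Md(2)[OF x(2) y(2)] by simp
  show "A \<oplus>\<^bsub>Q\<^esub> B = B \<oplus>\<^bsub>Q\<^esub> A"
    unfolding x(1) y(1) Q_add[OF x(2) y(2)] Q_add[OF y(2) x(2)] Md(5)[OF x(2) y(2)] ..
  show "a \<odot>\<^bsub>Q\<^esub> (A \<oplus>\<^bsub>Q\<^esub> B) = a \<odot>\<^bsub>Q\<^esub> A \<oplus>\<^bsub>Q\<^esub> a \<odot>\<^bsub>Q\<^esub> B" for a
    unfolding x(1) y(1) Q_add[OF x(2) y(2)] Q_smult[OF x(2)] Q_smult[OF y(2)] Q_smult[OF Md(2)[OF x(2) y(2)]]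
      Q_add[OF Md(3)[OF x(2)] Md(3)[OF y(2)]] Md(9)[OF x(2) y(2)] ..
  fix C assume "C \<in> carrier Q"
  then obtain w where w: "C = pr w" "w \<in> carrier M" unfolding Q_carrier by (rule imageE)
  show "(A \<oplus>\<^bsub>Q\<^esub> B) \<oplus>\<^bsub>Q\<^esub> C = A \<oplus>\<^bsub>Q\<^esub> (B \<oplus>\<^bsub>Q\<^esub> C)"
    unfolding x(1) y(1) w(1) Q_add[OF x(2) y(2)] Q_add[OF y(2) w(2)] Q_add[OF Md(2)[OF x(2) y(2)] w(2)]
      Q_add[OF x(2) Md(2)[OF y(2) w(2)]] Md(4)[OF x(2) y(2) w(2)] ..
qed

lemma pr_rhom: "pr \<in> rhom M Q"
  by (rule rhomI) (simp_all add: Q_carrier Q_add Q_smult)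

end

section \<open>Dimensions\<close>

text \<open>Independence in the subspace is independence in the whole space, so independent subsets
  of \<open>W\<close> have at most \<open>dim\<close> elements; a maximal one is a basis.\<close>

lemma (in vectorspace) subspace_dim_le:
  assumes fd: "fin_dim" and W: "subspace K W V"
  shows "vectorspace.fin_dim K (vs W)" "vectorspace.dim K (vs W) \<le> dim"
proof -
  have "vectorspace K (vs W)" using W by (rule subspace_is_vs)
  then interpret w: vectorspace K "vs W" .
  have sub: "submodule K W V" using W by simp
  have WV: "W \<subseteq> carrier V" using sub by (rule submodule.subset)
  have small: "finite A \<and> card A \<le> dim" if A: "A \<subseteq> W \<and> w.lin_indpt A" for A
  proof -
    have "lin_indpt A" using A span_li_not_depend(2)[OF _ sub, of A] by simp
    moreover have "A \<subseteq> carrier V" using A WV by blast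
    ultimately show ?thesis using li_le_dim[OF fd] by blast
  qed
  have "\<exists>A. finite A \<and> maximal A (\<lambda>S. S \<subseteq> carrier (vs W) \<and> w.lin_indpt S)"
  proof (rule maximal_exists[where N=dim and B="{}"])
    show "{} \<subseteq> carrier (vs W) \<and> w.lin_indpt {}" by (auto simp: w.lin_dep_def)
  qed (use small in simp)
  then obtain A where A: "finite A" "maximal A (\<lambda>S. S \<subseteq> carrier (vs W) \<and> w.lin_indpt S)" by blast
  have b: "w.basis A" using A(2) by (rule w.max_li_is_basis)
  then show "w.fin_dim" using A(1) unfolding w.fin_dim_def w.basis_def by blast
  have "w.dim = card A" using A(1) b by (rule w.dim_basis)
  also have "\<dots> \<le> dim" using small[of A] b unfolding w.basis_def by simp
  finally show "w.dim \<le> dim" .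
qed

lemma vectorspace_rmod:
  fixes M :: "('k::field, 'm) module"
  assumes "rmod M" shows "vectorspace (class_ring :: 'k ring) M"
  using assms class_field unfolding vectorspace_def by blast

text \<open>\<open>C\<close> followed by the projection is an injective map from
  \<open>K\<close>-vectors of length \<open>m\<close> to the quotient, and rank-nullity gives the
  bound. This is how independent homology classes will be counted.\<close>

lemma dim_quotient_ge:
  fixes C :: "'k::field mat"
  assumes Z: "rsub (module_vec TYPE('k) n) Z" and B: "rsub ((module_vec TYPE('k) n)\<lparr>carrier := Z\<rparr>) B"
    and C: "C \<in> carrier_mat n m" and CZ: "\<forall>u\<in>carrier_vec m. C *\<^sub>v u \<in> Z"
    and inj: "\<forall>u\<in>carrier_vec m. C *\<^sub>v u \<in> B \<longrightarrow> u = 0\<^sub>v m"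
  shows "m \<le> vectorspace.dim (class_ring :: 'k ring) (quotient_module ((module_vec TYPE('k) n)\<lparr>carrier := Z\<rparr>) B)"
proof -
  let ?V = "module_vec TYPE('k) n" and ?U = "module_vec TYPE('k) m"
  let ?Z = "?V\<lparr>carrier := Z\<rparr>"
  let ?K = "class_ring :: 'k ring"
  have mZ: "rmod ?Z" by (rule rmod_sub[OF rmod_vec Z])
  interpret q: quotient ?Z B by (rule quotient.intro[OF mZ B])
  let ?Q = "quotient_module ?Z B"
  interpret v: vec_space "TYPE('k)" n .
  interpret u: vec_space "TYPE('k)" m .
  have vV: "vectorspace ?K ?V" by (rule vectorspace_rmod[OF rmod_vec])
  have vU: "vectorspace ?K ?U" by (rule vectorspace_rmod[OF rmod_vec])
  have vZ: "vectorspace ?K ?Z" by (rule vectorspace_rmod[OF mZ])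
  have vQ: "vectorspace ?K ?Q" by (rule vectorspace_rmod[OF q.rmod_Q])
  have "submodule ?K Z ?V"
    by (rule submodule.intro) (use rmod_vec[of n, where 'r='k] Z in \<open>auto simp: rsub_def\<close>)
  then have sZ: "subspace ?K Z ?V" using vV unfolding subspace_def by blast
  have fdV: "vectorspace.fin_dim ?K ?V" by simp
  have fdZ: "vectorspace.fin_dim ?K ?Z" by (rule vectorspace.subspace_dim_le(1)[OF vV fdV sZ])
  have lm1: "linear_map ?K ?Z ?Q q.pr"
    unfolding linear_map_def mod_hom_def mod_hom_axioms_def using vZ vQ mZ q.rmod_Q q.pr_rhom by blast
  have fdQ: "vectorspace.fin_dim ?K ?Q"
    by (rule linear_map.surj_fin_dim[OF lm1 fdZ]) (simp only: q.Q_carrier)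
  let ?T = "\<lambda>u. q.pr (C *\<^sub>v u)"
  have "(\<lambda>u. C *\<^sub>v u) \<in> rhom ?U ?Z"
    by (rule rhomI) (use CZ rhomD[OF mult_mat_vec_rhom[OF C]] in \<open>simp_all add: module_vec_simps\<close>)
  then have T: "?T \<in> rhom ?U ?Q" by (rule rhom_comp[OF _ q.pr_rhom])
  have lm2: "linear_map ?K ?U ?Q ?T"
    unfolding linear_map_def mod_hom_def mod_hom_axioms_def using vU vQ rmod_vec q.rmod_Q T by blast
  have Tinj: "inj_on ?T (carrier ?U)"
  proof (rule linear_map.Ke0_imp_inj[OF lm2])
    have "x = 0\<^sub>v m" if "x \<in> carrier_vec m" "?T x = \<zero>\<^bsub>?Q\<^esub>" for x
      using that inj CZ q.pr_eq_N[of "C *\<^sub>v x"] unfolding q.Q_zero by simp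
    moreover have "?T (0\<^sub>v m) = \<zero>\<^bsub>?Q\<^esub>" using rhom_zero[OF T rmod_vec q.rmod_Q] by (simp add: module_vec_simps)
    ultimately show "carrier (?U\<lparr>carrier := mod_hom.ker ?U ?Q ?T\<rparr>) = {\<zero>\<^bsub>?U\<^esub>}"
      using lm2 unfolding linear_map_def by (auto simp: mod_hom.ker_def module_vec_simps)
  qed
  have "vectorspace.dim ?K (?Q\<lparr>carrier := mod_hom.im ?U ?T\<rparr>) + vectorspace.dim ?K (?U\<lparr>carrier := mod_hom.ker ?U ?Q ?T\<rparr>)
      = vectorspace.dim ?K ?U"
    by (rule linear_map.rank_nullity[OF lm2]) simp
  moreover have "vectorspace.dim ?K (?U\<lparr>carrier := mod_hom.ker ?U ?Q ?T\<rparr>) = 0"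
    by (rule linear_map.inj_imp_dim_ker0[OF lm2 Tinj])
  moreover have "vectorspace.dim ?K ?U = m" by (rule u.dim_is_n)
  moreover have "vectorspace.dim ?K (?Q\<lparr>carrier := mod_hom.im ?U ?T\<rparr>) \<le> vectorspace.dim ?K ?Q"
    by (rule vectorspace.subspace_dim_le(2)[OF vQ fdQ linear_map.imT_is_subspace[OF lm2]])
  ultimately show ?thesis by simp
qed

section \<open>Projective dimension and the last Betti number\<close>

text \<open>Exponents are natural numbers, so a product of monomials is constant only if both
  factors are. Hence taking constant coefficients is a ring homomorphism, and reduction of matrices
  respects products.\<close>

lemma const_coeff_mult:
  fixes p q :: "('v \<Rightarrow>\<^sub>0 nat) \<Rightarrow>\<^sub>0 'k::field"
  shows "Poly_Mapping.lookup (p * q) 0 = Poly_Mapping.lookup p 0 * Poly_Mapping.lookup q 0"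
proof -
  have z: "(0 = l + r) \<longleftrightarrow> l = 0 \<and> r = 0" for l r :: "'v \<Rightarrow>\<^sub>0 nat"
  proof
    assume e: "0 = l + r"
    have "Poly_Mapping.lookup l i + Poly_Mapping.lookup r i = 0" for i
      using arg_cong[OF e, of "\<lambda>p. Poly_Mapping.lookup p i"] by (simp add: lookup_add)
    then show "l = 0 \<and> r = 0" by (intro conjI poly_mapping_eqI) simp_all
  qed simp
  have "Poly_Mapping.lookup (p * q) 0 = (\<Sum>l. Poly_Mapping.lookup p l * (\<Sum>r. Poly_Mapping.lookup q r when 0 = l + r))"
    by (rule lookup_mult)
  also have "\<dots> = (\<Sum>l. (Poly_Mapping.lookup p l * Poly_Mapping.lookup q 0 when l = 0))"
  proof (rule Sum_any.cong)
    fix l :: "'v \<Rightarrow>\<^sub>0 nat"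
    show "Poly_Mapping.lookup p l * (\<Sum>r. Poly_Mapping.lookup q r when 0 = l + r) = (Poly_Mapping.lookup p l * Poly_Mapping.lookup q 0 when l = 0)"
      by (cases "l = 0") (simp_all add: z)
  qed
  finally show ?thesis by simp
qed

interpretation const_hom: comm_ring_hom "\<lambda>p :: ('v \<Rightarrow>\<^sub>0 nat) \<Rightarrow>\<^sub>0 'k::field. Poly_Mapping.lookup p 0"
  by unfold_locales (simp_all add: const_coeff_mult lookup_add)

lemma tensor_K_mult:
  fixes A B :: "('v, 'k::field) polynomials mat"
  assumes "A \<in> carrier_mat m n" "B \<in> carrier_mat n l"
  shows "tensor_K (A * B) = tensor_K A * tensor_K B"
  unfolding tensor_K_def by (rule const_hom.mat_hom_mult[OF assms])

lemma tensor_K_carrier: "A \<in> carrier_mat m n \<Longrightarrow> tensor_K A \<in> carrier_mat m n"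
  unfolding tensor_K_def by simp

lemma mat_eq_on_vec:
  fixes A B :: "'r::comm_ring_1 mat"
  assumes A: "A \<in> carrier_mat m n" and B: "B \<in> carrier_mat m n"
    and eq: "\<And>v. v \<in> carrier_vec n \<Longrightarrow> A *\<^sub>v v = B *\<^sub>v v"
  shows "A = B"
proof (rule eq_matI)
  fix i j assume ij: "i < dim_row B" "j < dim_col B"
  have "A $$ (i, j) = (A *\<^sub>v unit_vec n j) $ i" "B $$ (i, j) = (B *\<^sub>v unit_vec n j) $ i"
    using A B ij by (simp_all add: scalar_prod_right_unit)
  then show "A $$ (i, j) = B $$ (i, j)" using eq[of "unit_vec n j"] by simp
qed (use A B in auto)

lemma zero_mat_vec_mult:
  fixes v :: "'r::comm_ring_1 vec"
  shows "v \<in> carrier_vec n \<Longrightarrow> 0\<^sub>m m n *\<^sub>v v = 0\<^sub>v m"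
  by (rule eq_vecI) (simp_all add: scalar_prod_def)

lemma mat_vec_zero:
  fixes A :: "'r::comm_ring_1 mat"
  shows "A \<in> carrier_mat m n \<Longrightarrow> A *\<^sub>v 0\<^sub>v n = 0\<^sub>v m"
  by (rule eq_vecI) (simp_all add: scalar_prod_def)

lemma vec_minus_add:
  fixes v :: "'r::comm_ring_1 vec"
  shows "v \<in> carrier_vec n \<Longrightarrow> w \<in> carrier_vec n \<Longrightarrow> v - w + w = v"
  by (intro eq_vecI) auto

lemma tensor_K_add:
  fixes A B :: "('v, 'k::field) polynomials mat"
  shows "A \<in> carrier_mat m n \<Longrightarrow> B \<in> carrier_mat m n \<Longrightarrow> tensor_K (A + B) = tensor_K A + tensor_K B"
  unfolding tensor_K_def by (intro eq_matI) (auto simp: lookup_add)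

text \<open>Exactness over the polynomial ring gives \<open>d i * d (Suc i) = 0\<close> as a matrix
  identity, which survives the reduction. This makes the homology an honest quotient of vector
  spaces.\<close>

lemma boundaries_subset_cycles:
  fixes M :: "(('v, 'k::field) polynomials, 'm) module"
  assumes F: "free_resolution b d \<epsilon> M"
  shows "rsub (module_vec TYPE('k) (b i)) (cycles_K b d i)"
    "rsub ((module_vec TYPE('k) (b i))\<lparr>carrier := cycles_K b d i\<rparr>) (boundaries_K b d i)"
proof -
  have dc: "d i \<in> carrier_mat (b i) (b (Suc i))" for i using F unfolding free_resolution_def by simp
  note tc = tensor_K_carrier[OF dc]
  have "is_resolution (\<lambda>i. module_vec TYPE(('v, 'k) polynomials) (b i)) (\<lambda>i v. d i *\<^sub>v v) \<epsilon> M"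
    using F unfolding free_resolution_def by simp
  note Fd = resolutionD[OF this, unfolded module_vec_simps]
  have dd: "d i * d (Suc i) = 0\<^sub>m (b i) (b (Suc (Suc i)))" for i
  proof (rule mat_eq_on_vec)
    fix v :: "('v, 'k) polynomials vec" assume v: "v \<in> carrier_vec (b (Suc (Suc i)))"
    have "(d i * d (Suc i)) *\<^sub>v v = d i *\<^sub>v (d (Suc i) *\<^sub>v v)" by (rule assoc_mult_mat_vec[OF dc dc v])
    then show "(d i * d (Suc i)) *\<^sub>v v = 0\<^sub>m (b i) (b (Suc (Suc i))) *\<^sub>v v"
      using Fd(8)[OF v] v by (simp add: zero_mat_vec_mult)
  qed (use dc in \<open>auto intro!: mult_carrier_mat[OF dc dc]\<close>)
  have tt: "tensor_K (d i) * tensor_K (d (Suc i)) = 0\<^sub>m (b i) (b (Suc (Suc i)))" for i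
  proof -
    have "tensor_K (d i) * tensor_K (d (Suc i)) = tensor_K (d i * d (Suc i))"
      by (rule tensor_K_mult[OF dc dc, symmetric])
    also have "\<dots> = 0\<^sub>m (b i) (b (Suc (Suc i)))" unfolding dd tensor_K_def by (rule eq_matI) simp_all
    finally show ?thesis .
  qed
  show s: "rsub (module_vec TYPE('k) (b i)) (cycles_K b d i)"
  proof (cases i)
    case 0 then show ?thesis unfolding rsub_def by (simp add: module_vec_simps)
  next
    case (Suc j)
    show ?thesis unfolding rsub_def Suc cycles_K.simps mat_kernel[OF tc]
      by (auto simp: module_vec_simps mult_add_distrib_mat_vec[OF tc] mult_mat_vec_smult[OF tc] mat_vec_zero[OF tc])
  qed
  have "(\<lambda>v. tensor_K (d i) *\<^sub>v v) ` carrier_vec (b (Suc i)) \<subseteq> cycles_K b d i"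
  proof (cases i)
    case 0 then show ?thesis using tc[of 0] by auto
  next
    case (Suc j)
    show ?thesis unfolding Suc cycles_K.simps mat_kernel[OF tc]
    proof (intro image_subsetI CollectI conjI)
      fix v :: "'k vec" assume v: "v \<in> carrier_vec (b (Suc (Suc j)))"
      show "tensor_K (d (Suc j)) *\<^sub>v v \<in> carrier_vec (b (Suc j))" by (rule mult_mat_vec_carrier[OF tc v])
      show "tensor_K (d j) *\<^sub>v (tensor_K (d (Suc j)) *\<^sub>v v) = 0\<^sub>v (b j)"
        unfolding assoc_mult_mat_vec[OF tc tc v, symmetric] tt using v by (simp add: zero_mat_vec_mult)
    qed
  qed
  then show "rsub ((module_vec TYPE('k) (b i))\<lparr>carrier := cycles_K b d i\<rparr>) (boundaries_K b d i)"
    unfolding rsub_def boundaries_K_def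
  proof (intro conjI ballI allI)
    have "tensor_K (d i) *\<^sub>v 0\<^sub>v (b (Suc i)) = 0\<^sub>v (b i)" by (rule mat_vec_zero[OF tc])
    then show "\<zero>\<^bsub>(module_vec TYPE('k) (b i))\<lparr>carrier := cycles_K b d i\<rparr>\<^esub> \<in> (\<lambda>v. tensor_K (d i) *\<^sub>v v) ` carrier_vec (b (Suc i))"
      by (intro image_eqI[of _ _ "0\<^sub>v (b (Suc i))"]) (simp_all add: module_vec_simps)
  next
    fix x y assume "x \<in> (\<lambda>v. tensor_K (d i) *\<^sub>v v) ` carrier_vec (b (Suc i))" "y \<in> (\<lambda>v. tensor_K (d i) *\<^sub>v v) ` carrier_vec (b (Suc i))"
    then obtain v w where vw: "v \<in> carrier_vec (b (Suc i))" "w \<in> carrier_vec (b (Suc i))"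
      "x = tensor_K (d i) *\<^sub>v v" "y = tensor_K (d i) *\<^sub>v w" by (elim imageE) simp
    show "x \<oplus>\<^bsub>(module_vec TYPE('k) (b i))\<lparr>carrier := cycles_K b d i\<rparr>\<^esub> y \<in> (\<lambda>v. tensor_K (d i) *\<^sub>v v) ` carrier_vec (b (Suc i))"
      by (intro image_eqI[of _ _ "v + w"]) (use vw in \<open>simp_all add: module_vec_simps mult_add_distrib_mat_vec[OF tc]\<close>)
  next
    fix a x assume "x \<in> (\<lambda>v. tensor_K (d i) *\<^sub>v v) ` carrier_vec (b (Suc i))"
    then obtain v where v: "v \<in> carrier_vec (b (Suc i))" "x = tensor_K (d i) *\<^sub>v v" by (elim imageE) simp
    show "a \<odot>\<^bsub>(module_vec TYPE('k) (b i))\<lparr>carrier := cycles_K b d i\<rparr>\<^esub> x \<in> (\<lambda>v. tensor_K (d i) *\<^sub>v v) ` carrier_vec (b (Suc i))"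
      by (intro image_eqI[of _ _ "a \<cdot>\<^sub>v v"]) (use v in \<open>simp_all add: module_vec_simps mult_mat_vec_smult[OF tc]\<close>)
  qed simp
qed

text \<open>The hypotheses on \<open>b\<close>, \<open>d\<close> describe a resolution of length \<open>s\<close> whose last differential has
  minimal columns indexed by \<open>S\<close>. A homotopy equivalence with another resolution identifies the
  span of these columns with a subspace of \<open>Tor\<^sub>s\<close>, since there are no boundaries in degree \<open>s\<close>.\<close>

theorem last_betti_ge:
  fixes M :: "(('v, 'k::field) polynomials, 'm) module"
  assumes M: "rmod M" and F: "free_resolution b d \<epsilon> M" and b: "\<And>i. i > Suc j \<Longrightarrow> b i = 0"
    and S: "S \<subseteq> {..<b (Suc j)}" "S \<noteq> {}"
    and min: "\<And>l k. l < b j \<Longrightarrow> k \<in> S \<Longrightarrow> Poly_Mapping.lookup (d j $$ (l, k)) 0 = 0"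
  shows "last_betti M \<ge> card S"
proof -
  let ?R = "TYPE(('v, 'k) polynomials)"
  let ?V = "\<lambda>i. module_vec ?R (b i)"
  let ?s = "Suc j"
  have dc: "d i \<in> carrier_mat (b i) (b (Suc i))" for i using F unfolding free_resolution_def by simp
  note tc = tensor_K_carrier[OF dc]
  have FF: "is_resolution ?V (\<lambda>i v. d i *\<^sub>v v) \<epsilon> M" using F unfolding free_resolution_def by simp
  have b0: "b (Suc ?s) = 0" using b by simp
  have top0: "d ?s *\<^sub>v w = 0\<^sub>v (b ?s)" if "w \<in> carrier_vec (b (Suc ?s))" for w
  proof -
    have "w = 0\<^sub>v (b (Suc ?s))" using that b0 by (intro eq_vecI) auto
    then show ?thesis using mat_vec_zero[OF dc] by simp
  qed
  have finS: "finite S" using S(1) finite_subset by blast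
  obtain e where e: "bij_betw e {..<card S} S" using ex_bij_betw_nat_finite[OF finS] by (auto simp: atLeast0LessThan)
  let ?m = "card S"
  have eS: "e i \<in> S" if "i < ?m" for i using e that unfolding bij_betw_def by auto
  have eb: "e i < b ?s" if "i < ?m" for i using eS[OF that] S(1) by auto
  have einj: "e i = e i' \<longleftrightarrow> i = i'" if "i < ?m" "i' < ?m" for i i'
    using e that unfolding bij_betw_def inj_on_def by auto
  \<comment> \<open>The inclusion of the coordinate subspace spanned by the columns in
    \<open>S\<close>, enumerated by \<open>e\<close>.\<close>
  define J where "J = mat (b ?s) ?m (\<lambda>(l, i). if l = e i then 1 else 0 :: 'k)"
  have Jc: "J \<in> carrier_mat (b ?s) ?m" unfolding J_def by simp
  have Jinj: "u = 0\<^sub>v ?m" if u: "u \<in> carrier_vec ?m" "J *\<^sub>v u = 0\<^sub>v (b ?s)" for u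
  proof (rule eq_vecI)
    fix i assume i: "i < dim_vec (0\<^sub>v ?m :: 'k vec)"
    then have im: "i < ?m" by simp
    have "(J *\<^sub>v u) $ (e i) = (\<Sum>i'\<in>{0..<?m}. (if e i = e i' then 1 else 0) * u $ i')"
      using u(1) eb[OF im] unfolding J_def by (simp add: scalar_prod_def)
    also have "\<dots> = (\<Sum>i'\<in>{0..<?m}. if i = i' then u $ i' else 0)"
      by (rule sum.cong) (use einj[OF im] in auto)
    also have "\<dots> = u $ i" using im by simp
    finally show "u $ i = 0\<^sub>v ?m $ i" using u(2) eb[OF im] im by simp
  qed (use u in auto)
  have dJ: "tensor_K (d j) *\<^sub>v (J *\<^sub>v u) = 0\<^sub>v (b j)" if u: "u \<in> carrier_vec ?m" for u
  proof (rule eq_vecI)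
    fix l assume "l < dim_vec (0\<^sub>v (b j) :: 'k vec)"
    then have l: "l < b j" by simp
    have z: "tensor_K (d j) $$ (l, k) * (J *\<^sub>v u) $ k = 0" if k: "k < b ?s" for k
    proof (cases "k \<in> S")
      case True
      have "tensor_K (d j) $$ (l, k) = Poly_Mapping.lookup (d j $$ (l, k)) 0"
        using dc[of j] l k unfolding tensor_K_def by simp
      then show ?thesis using min[OF l True] by simp
    next
      case False
      have "(J *\<^sub>v u) $ k = (\<Sum>i'\<in>{0..<?m}. (if k = e i' then 1 else 0) * u $ i')"
        using u k unfolding J_def by (simp add: scalar_prod_def)
      also have "\<dots> = 0" by (rule sum.neutral) (use eS False in auto)
      finally show ?thesis by simp
    qed
    have "(tensor_K (d j) *\<^sub>v (J *\<^sub>v u)) $ l = (\<Sum>k\<in>{0..<b ?s}. tensor_K (d j) $$ (l, k) * (J *\<^sub>v u) $ k)"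
      using tc[of j] Jc u l by (simp add: scalar_prod_def)
    also have "\<dots> = 0" by (rule sum.neutral) (use z in auto)
    finally show "(tensor_K (d j) *\<^sub>v (J *\<^sub>v u)) $ l = 0\<^sub>v (b j) $ l" using l by simp
  qed (use tc[of j] in auto)
  have pd: "projective_dimension M = ?s"
    unfolding projective_dimension_def
  proof (rule Least_equality)
    show "\<exists>(P :: nat \<Rightarrow> (('v, 'k) polynomials, ('v, 'k) polynomials vec) module) \<delta> \<epsilon>. is_resolution P \<delta> \<epsilon> M \<and>
        (\<forall>i. fg_projective (P i)) \<and> (\<forall>i>?s. carrier (P i) = {\<zero>\<^bsub>P i\<^esub>})"
    proof (rule exI[of _ ?V], rule exI[of _ "\<lambda>i v. d i *\<^sub>v v"], rule exI[of _ \<epsilon>], intro conjI allI impI)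
      show "is_resolution ?V (\<lambda>i v. d i *\<^sub>v v) \<epsilon> M" by (rule FF)
      show "fg_projective (?V i)" for i by (rule fg_projective_vec)
      fix i assume "?s < i"
      then have "b i = 0" by (rule b)
      then show "carrier (?V i) = {\<zero>\<^bsub>?V i\<^esub>}" by (auto simp: module_vec_simps)
    qed
  next
    fix r
    assume "\<exists>(P :: nat \<Rightarrow> (('v, 'k) polynomials, ('v, 'k) polynomials vec) module) \<delta> \<epsilon>. is_resolution P \<delta> \<epsilon> M \<and>
        (\<forall>i. fg_projective (P i)) \<and> (\<forall>i>r. carrier (P i) = {\<zero>\<^bsub>P i\<^esub>})"
    then obtain P :: "nat \<Rightarrow> (('v, 'k) polynomials, ('v, 'k) polynomials vec) module" and \<delta> \<epsilon>' where
      P: "is_resolution P \<delta> \<epsilon>' M" "\<forall>i. fg_projective (P i)" "\<forall>i>r. carrier (P i) = {\<zero>\<^bsub>P i\<^esub>}"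
      by (elim exE conjE)
    show "?s \<le> r"
    proof (rule ccontr)
      assume "\<not> ?s \<le> r"
      then have P0: "carrier (P ?s) = {\<zero>\<^bsub>P ?s\<^esub>}" using P(3) by simp
      obtain \<phi> \<psi> h where
        \<phi>: "\<forall>i. \<phi> i \<in> rhom (?V i) (P i)" and \<psi>: "\<forall>i. \<psi> i \<in> rhom (P i) (?V i)"
        and h: "\<forall>i. h i \<in> rhom (?V i) (?V (Suc i))"
        and hd: "\<forall>i. \<forall>v\<in>carrier_vec (b (Suc i)). d (Suc i) *\<^sub>v h (Suc i) v + h i (d i *\<^sub>v v) = v - \<psi> (Suc i) (\<phi> (Suc i) v)"
        using homotopy_equivalence[OF M F P(1,2)] by (elim exE conjE)
      obtain H where H: "H \<in> carrier_mat (b ?s) (b j)" "\<forall>v\<in>carrier_vec (b j). h j v = H *\<^sub>v v"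
        using rhom_vec_mat[OF spec[OF h, of j]] by (elim bexE)
      \<comment> \<open>A shorter projective resolution vanishes in degree \<open>Suc j\<close>, so
        there the composite \<open>\<psi> \<phi>\<close> is zero; so is \<open>d (Suc j)\<close>.
        The homotopy therefore becomes a left inverse of \<open>d j\<close>, which is impossible
        since its reduction kills the columns in \<open>S\<close>.\<close>
      have HD: "H * d j = 1\<^sub>m (b ?s)"
      proof (rule mat_eq_on_vec)
        show "H * d j \<in> carrier_mat (b ?s) (b ?s)" by (rule mult_carrier_mat[OF H(1) dc])
        fix v :: "('v, 'k) polynomials vec" assume v: "v \<in> carrier_vec (b ?s)"
        have dv: "d j *\<^sub>v v \<in> carrier_vec (b j)" by (rule mult_mat_vec_carrier[OF dc v])
        have hc: "h ?s v \<in> carrier_vec (b (Suc ?s))"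
          using rhomD(1)[OF spec[OF h], unfolded module_vec_simps, OF v] .
        have "\<phi> ?s v \<in> carrier (P ?s)" using rhomD(1)[OF spec[OF \<phi>], unfolded module_vec_simps, OF v] .
        then have "\<psi> ?s (\<phi> ?s v) = 0\<^sub>v (b ?s)"
          using rhom_zero[OF spec[OF \<psi>, of ?s] resolutionD(1)[OF P(1)] rmod_vec] P0 by (simp add: module_vec_simps)
        then have "d ?s *\<^sub>v h ?s v + h j (d j *\<^sub>v v) = v - 0\<^sub>v (b ?s)" using hd v by simp
        then have "H *\<^sub>v (d j *\<^sub>v v) = v"
          using top0[OF hc] H(2) dv H(1) v by simp
        then show "(H * d j) *\<^sub>v v = 1\<^sub>m (b ?s) *\<^sub>v v"
          using assoc_mult_mat_vec[OF H(1) dc v] v by simp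
      qed simp
      have "tensor_K H * tensor_K (d j) = tensor_K (1\<^sub>m (b ?s) :: ('v, 'k) polynomials mat)"
        unfolding tensor_K_mult[OF H(1) dc, symmetric] HD ..
      also have "\<dots> = 1\<^sub>m (b ?s)" unfolding tensor_K_def by (rule const_hom.mat_hom_one)
      finally have HD1: "tensor_K H * tensor_K (d j) = 1\<^sub>m (b ?s)" .
      have m0: "0 < ?m" using S(2) finS by (simp add: card_gt_0_iff)
      let ?u = "unit_vec ?m 0 :: 'k vec"
      have Ju: "J *\<^sub>v ?u \<in> carrier_vec (b ?s)" by (rule mult_mat_vec_carrier[OF Jc]) simp
      have "J *\<^sub>v ?u = (tensor_K H * tensor_K (d j)) *\<^sub>v (J *\<^sub>v ?u)" unfolding HD1 using Ju by simp
      also have "\<dots> = tensor_K H *\<^sub>v (tensor_K (d j) *\<^sub>v (J *\<^sub>v ?u))"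
        by (rule assoc_mult_mat_vec[OF tensor_K_carrier[OF H(1)] tc Ju])
      also have "\<dots> = 0\<^sub>v (b ?s)"
        using dJ[of ?u] mat_vec_zero[OF tensor_K_carrier[OF H(1)]] by simp
      finally have "?u = 0\<^sub>v ?m" by (intro Jinj) simp_all
      then show False using m0 by (metis index_unit_vec(1) index_zero_vec(1) zero_neq_one)
    qed
  qed
  \<comment> \<open>\<open>Tor_K\<close> is computed from an unspecified free resolution; it is
    named \<open>b'\<close>, \<open>d'\<close> and compared with the given one.\<close>
  have "case (SOME (b, d). \<exists>\<epsilon>. free_resolution b d \<epsilon> M) of (b, d) \<Rightarrow> \<exists>\<epsilon>. free_resolution b d \<epsilon> M"
    by (rule someI[of _ "(b, d)"]) (use F in auto)
  then obtain b' d' \<epsilon>' where some: "(SOME (b, d). \<exists>\<epsilon>. free_resolution b d \<epsilon> M) = (b', d')"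
    and F': "free_resolution b' d' \<epsilon>' M"
    by (auto split: prod.splits)
  have Tor: "Tor_K M ?s = homology_K b' d' ?s" unfolding Tor_K_def some by simp
  let ?V' = "\<lambda>i. module_vec ?R (b' i)"
  have dc': "d' i \<in> carrier_mat (b' i) (b' (Suc i))" for i using F' unfolding free_resolution_def by simp
  note tc' = tensor_K_carrier[OF dc']
  have FF': "is_resolution ?V' (\<lambda>i v. d' i *\<^sub>v v) \<epsilon>' M" using F' unfolding free_resolution_def by simp
  obtain \<phi> \<psi> h where
    \<phi>: "\<forall>i. \<phi> i \<in> rhom (?V i) (?V' i)" and \<psi>: "\<forall>i. \<psi> i \<in> rhom (?V' i) (?V i)"
    and h: "\<forall>i. h i \<in> rhom (?V i) (?V (Suc i))"
    and \<phi>d: "\<forall>i. \<forall>v\<in>carrier_vec (b (Suc i)). d' i *\<^sub>v \<phi> (Suc i) v = \<phi> i (d i *\<^sub>v v)"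
    and \<psi>d: "\<forall>i. \<forall>v\<in>carrier (?V' (Suc i)). d i *\<^sub>v \<psi> (Suc i) v = \<psi> i (d' i *\<^sub>v v)"
    and hd: "\<forall>i. \<forall>v\<in>carrier_vec (b (Suc i)). d (Suc i) *\<^sub>v h (Suc i) v + h i (d i *\<^sub>v v) = v - \<psi> (Suc i) (\<phi> (Suc i) v)"
    using homotopy_equivalence[OF M F FF' allI[OF fg_projective_vec]] by (elim exE conjE)
  obtain H where H: "H \<in> carrier_mat (b ?s) (b j)" "\<forall>v\<in>carrier_vec (b j). h j v = H *\<^sub>v v"
    using rhom_vec_mat[OF spec[OF h, of j]] by (elim bexE)
  obtain \<Phi> where \<Phi>: "\<Phi> \<in> carrier_mat (b' ?s) (b ?s)" "\<forall>v\<in>carrier_vec (b ?s). \<phi> ?s v = \<Phi> *\<^sub>v v"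
    using rhom_vec_mat[OF spec[OF \<phi>, of ?s]] by (elim bexE)
  obtain \<Phi>j where \<Phi>j: "\<Phi>j \<in> carrier_mat (b' j) (b j)" "\<forall>v\<in>carrier_vec (b j). \<phi> j v = \<Phi>j *\<^sub>v v"
    using rhom_vec_mat[OF spec[OF \<phi>, of j]] by (elim bexE)
  obtain \<Psi> where \<Psi>: "\<Psi> \<in> carrier_mat (b ?s) (b' ?s)" "\<forall>v\<in>carrier_vec (b' ?s). \<psi> ?s v = \<Psi> *\<^sub>v v"
    using rhom_vec_mat[OF spec[OF \<psi>, of ?s]] by (elim bexE)
  have E1: "H * d j + \<Psi> * \<Phi> = 1\<^sub>m (b ?s)"
  proof (rule mat_eq_on_vec)
    show "H * d j + \<Psi> * \<Phi> \<in> carrier_mat (b ?s) (b ?s)"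
      by (intro add_carrier_mat mult_carrier_mat[OF \<Psi>(1) \<Phi>(1)])
    fix v :: "('v, 'k) polynomials vec" assume v: "v \<in> carrier_vec (b ?s)"
    have dv: "d j *\<^sub>v v \<in> carrier_vec (b j)" by (rule mult_mat_vec_carrier[OF dc v])
    have hc: "h ?s v \<in> carrier_vec (b (Suc ?s))"
      using rhomD(1)[OF spec[OF h], unfolded module_vec_simps, OF v] .
    have fv: "\<Phi> *\<^sub>v v \<in> carrier_vec (b' ?s)" by (rule mult_mat_vec_carrier[OF \<Phi>(1) v])
    have pv: "\<Psi> *\<^sub>v (\<Phi> *\<^sub>v v) \<in> carrier_vec (b ?s)" by (rule mult_mat_vec_carrier[OF \<Psi>(1) fv])
    have Hv: "H *\<^sub>v (d j *\<^sub>v v) \<in> carrier_vec (b ?s)" by (rule mult_mat_vec_carrier[OF H(1) dv])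
    have "d ?s *\<^sub>v h ?s v + h j (d j *\<^sub>v v) = v - \<psi> ?s (\<phi> ?s v)" using hd v by simp
    then have e: "H *\<^sub>v (d j *\<^sub>v v) = v - \<Psi> *\<^sub>v (\<Phi> *\<^sub>v v)"
      using top0[OF hc] H(2) dv \<Phi>(2) \<Psi>(2) fv v Hv by simp
    have "(H * d j + \<Psi> * \<Phi>) *\<^sub>v v = (H * d j) *\<^sub>v v + (\<Psi> * \<Phi>) *\<^sub>v v"
      by (rule add_mult_distrib_mat_vec[OF mult_carrier_mat[OF H(1) dc] mult_carrier_mat[OF \<Psi>(1) \<Phi>(1)] v])
    also have "\<dots> = (v - \<Psi> *\<^sub>v (\<Phi> *\<^sub>v v)) + \<Psi> *\<^sub>v (\<Phi> *\<^sub>v v)"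
      unfolding assoc_mult_mat_vec[OF H(1) dc v] assoc_mult_mat_vec[OF \<Psi>(1) \<Phi>(1) v] e ..
    also have "\<dots> = v" by (rule vec_minus_add[OF v pv])
    finally show "(H * d j + \<Psi> * \<Phi>) *\<^sub>v v = 1\<^sub>m (b ?s) *\<^sub>v v" using v by simp
  qed simp
  have E2: "d' j * \<Phi> = \<Phi>j * d j"
  proof (rule mat_eq_on_vec)
    fix v :: "('v, 'k) polynomials vec" assume v: "v \<in> carrier_vec (b ?s)"
    have dv: "d j *\<^sub>v v \<in> carrier_vec (b j)" by (rule mult_mat_vec_carrier[OF dc v])
    have "d' j *\<^sub>v (\<Phi> *\<^sub>v v) = d' j *\<^sub>v \<phi> ?s v" using bspec[OF \<Phi>(2) v] by simp
    also have "\<dots> = \<phi> j (d j *\<^sub>v v)" using \<phi>d v by blast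
    also have "\<dots> = \<Phi>j *\<^sub>v (d j *\<^sub>v v)" by (rule bspec[OF \<Phi>j(2) dv])
    finally show "(d' j * \<Phi>) *\<^sub>v v = (\<Phi>j * d j) *\<^sub>v v"
      unfolding assoc_mult_mat_vec[OF dc' \<Phi>(1) v] assoc_mult_mat_vec[OF \<Phi>j(1) dc v] .
  qed (rule mult_carrier_mat[OF dc' \<Phi>(1)], rule mult_carrier_mat[OF \<Phi>j(1) dc])
  \<comment> \<open>The given resolution is zero in degree \<open>Suc (Suc j)\<close>, so the
    comparison map \<open>\<Psi>\<close> kills every boundary of the other resolution.\<close>
  have E3: "\<Psi> * d' ?s = 0\<^sub>m (b ?s) (b' (Suc ?s))"
  proof (rule mat_eq_on_vec)
    fix v :: "('v, 'k) polynomials vec" assume v: "v \<in> carrier_vec (b' (Suc ?s))"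
    have dv: "d' ?s *\<^sub>v v \<in> carrier_vec (b' ?s)" by (rule mult_mat_vec_carrier[OF dc' v])
    have pc: "\<psi> (Suc ?s) v \<in> carrier_vec (b (Suc ?s))"
      using rhomD(1)[OF spec[OF \<psi>], unfolded module_vec_simps, OF v] .
    have "\<psi> ?s (d' ?s *\<^sub>v v) = d ?s *\<^sub>v \<psi> (Suc ?s) v" using \<psi>d v by (simp add: module_vec_simps)
    then have "\<Psi> *\<^sub>v (d' ?s *\<^sub>v v) = 0\<^sub>v (b ?s)" using \<Psi>(2) dv top0[OF pc] by simp
    then show "(\<Psi> * d' ?s) *\<^sub>v v = 0\<^sub>m (b ?s) (b' (Suc ?s)) *\<^sub>v v"
      unfolding assoc_mult_mat_vec[OF \<Psi>(1) dc' v] zero_mat_vec_mult[OF v] .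
  qed (rule mult_carrier_mat[OF \<Psi>(1) dc'], simp)
  note tH = tensor_K_carrier[OF H(1)] and t\<Phi> = tensor_K_carrier[OF \<Phi>(1)]
    and t\<Phi>j = tensor_K_carrier[OF \<Phi>j(1)] and t\<Psi> = tensor_K_carrier[OF \<Psi>(1)]
  have T1: "tensor_K H * tensor_K (d j) + tensor_K \<Psi> * tensor_K \<Phi> = 1\<^sub>m (b ?s)"
  proof -
    have "tensor_K H * tensor_K (d j) + tensor_K \<Psi> * tensor_K \<Phi> = tensor_K (H * d j) + tensor_K (\<Psi> * \<Phi>)"
      unfolding tensor_K_mult[OF H(1) dc] tensor_K_mult[OF \<Psi>(1) \<Phi>(1)] ..
    also have "\<dots> = tensor_K (H * d j + \<Psi> * \<Phi>)"
      by (rule tensor_K_add[OF mult_carrier_mat[OF H(1) dc] mult_carrier_mat[OF \<Psi>(1) \<Phi>(1)], symmetric])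
    also have "\<dots> = 1\<^sub>m (b ?s)" unfolding E1 tensor_K_def by (rule const_hom.mat_hom_one)
    finally show ?thesis .
  qed
  have T2: "tensor_K (d' j) * tensor_K \<Phi> = tensor_K \<Phi>j * tensor_K (d j)"
    unfolding tensor_K_mult[OF dc' \<Phi>(1), symmetric] tensor_K_mult[OF \<Phi>j(1) dc, symmetric] E2 ..
  have T3: "tensor_K \<Psi> * tensor_K (d' ?s) = 0\<^sub>m (b ?s) (b' (Suc ?s))"
  proof -
    have "tensor_K \<Psi> * tensor_K (d' ?s) = tensor_K (0\<^sub>m (b ?s) (b' (Suc ?s)) :: ('v, 'k) polynomials mat)"
      unfolding tensor_K_mult[OF \<Psi>(1) dc', symmetric] E3 ..
    also have "\<dots> = 0\<^sub>m (b ?s) (b' (Suc ?s))" unfolding tensor_K_def by (rule eq_matI) simp_all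
    finally show ?thesis .
  qed
  \<comment> \<open>The columns in \<open>S\<close> are carried to cycles of the unspecified
    resolution; their classes are to be shown independent.\<close>
  let ?C = "tensor_K \<Phi> * J"
  have Cc: "?C \<in> carrier_mat (b' ?s) ?m" by (rule mult_carrier_mat[OF t\<Phi> Jc])
  have Cu: "?C *\<^sub>v u = tensor_K \<Phi> *\<^sub>v (J *\<^sub>v u)" if "u \<in> carrier_vec ?m" for u
    by (rule assoc_mult_mat_vec[OF t\<Phi> Jc that])
  have Juc: "J *\<^sub>v u \<in> carrier_vec (b ?s)" if "u \<in> carrier_vec ?m" for u by (rule mult_mat_vec_carrier[OF Jc that])
  have "?m \<le> vectorspace.dim (class_ring :: 'k ring)
     (quotient_module ((module_vec TYPE('k) (b' ?s))\<lparr>carrier := cycles_K b' d' ?s\<rparr>) (boundaries_K b' d' ?s))"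
  proof (rule dim_quotient_ge[OF boundaries_subset_cycles[OF F'] Cc])
    show "\<forall>u\<in>carrier_vec ?m. ?C *\<^sub>v u \<in> cycles_K b' d' ?s"
    proof
      fix u :: "'k vec" assume u: "u \<in> carrier_vec ?m"
      have f: "tensor_K \<Phi> *\<^sub>v (J *\<^sub>v u) \<in> carrier_vec (b' ?s)" by (rule mult_mat_vec_carrier[OF t\<Phi> Juc[OF u]])
      have "tensor_K (d' j) *\<^sub>v (tensor_K \<Phi> *\<^sub>v (J *\<^sub>v u)) = (tensor_K \<Phi>j * tensor_K (d j)) *\<^sub>v (J *\<^sub>v u)"
        unfolding T2[symmetric] by (rule assoc_mult_mat_vec[OF tc' t\<Phi> Juc[OF u], symmetric])
      also have "\<dots> = tensor_K \<Phi>j *\<^sub>v (tensor_K (d j) *\<^sub>v (J *\<^sub>v u))"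
        by (rule assoc_mult_mat_vec[OF t\<Phi>j tc Juc[OF u]])
      also have "\<dots> = 0\<^sub>v (b' j)" unfolding dJ[OF u] by (rule mat_vec_zero[OF t\<Phi>j])
      finally show "?C *\<^sub>v u \<in> cycles_K b' d' ?s"
        unfolding Cu[OF u] cycles_K.simps mat_kernel[OF tc'] using f by simp
    qed
    show "\<forall>u\<in>carrier_vec ?m. ?C *\<^sub>v u \<in> boundaries_K b' d' ?s \<longrightarrow> u = 0\<^sub>v ?m"
    proof (intro ballI impI)
      fix u :: "'k vec" assume u: "u \<in> carrier_vec ?m" and bd: "?C *\<^sub>v u \<in> boundaries_K b' d' ?s"
      obtain w where w: "w \<in> carrier_vec (b' (Suc ?s))" "?C *\<^sub>v u = tensor_K (d' ?s) *\<^sub>v w"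
        using bd unfolding boundaries_K_def by (elim imageE) simp
      \<comment> \<open>Insert the reduced homotopy identity: the first term vanishes because
        \<open>J u\<close> is a cycle, the second because \<open>\<Psi>\<close> kills the boundary
        to which \<open>\<Phi>\<close> sends it.\<close>
      have "J *\<^sub>v u = (tensor_K H * tensor_K (d j) + tensor_K \<Psi> * tensor_K \<Phi>) *\<^sub>v (J *\<^sub>v u)"
        unfolding T1 using Juc[OF u] by simp
      also have "\<dots> = (tensor_K H * tensor_K (d j)) *\<^sub>v (J *\<^sub>v u) + (tensor_K \<Psi> * tensor_K \<Phi>) *\<^sub>v (J *\<^sub>v u)"
        by (rule add_mult_distrib_mat_vec[OF mult_carrier_mat[OF tH tc] mult_carrier_mat[OF t\<Psi> t\<Phi>] Juc[OF u]])
      also have "(tensor_K H * tensor_K (d j)) *\<^sub>v (J *\<^sub>v u) = 0\<^sub>v (b ?s)"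
        unfolding assoc_mult_mat_vec[OF tH tc Juc[OF u]] dJ[OF u] by (rule mat_vec_zero[OF tH])
      also have "(tensor_K \<Psi> * tensor_K \<Phi>) *\<^sub>v (J *\<^sub>v u) = (tensor_K \<Psi> * tensor_K (d' ?s)) *\<^sub>v w"
        unfolding assoc_mult_mat_vec[OF t\<Psi> t\<Phi> Juc[OF u]] assoc_mult_mat_vec[OF t\<Psi> tc' w(1)]
          Cu[OF u, symmetric] w(2) ..
      also have "\<dots> = 0\<^sub>v (b ?s)" unfolding T3 by (rule zero_mat_vec_mult[OF w(1)])
      finally have "J *\<^sub>v u = 0\<^sub>v (b ?s)" by simp
      then show "u = 0\<^sub>v ?m" by (rule Jinj[OF u])
    qed
  qed
  then show ?thesis unfolding last_betti_def betti_def pd Tor homology_K_def .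
qed

section \<open>From labelled complexes to polynomial resolutions\<close>

definition mon :: "('v::finite) set \<Rightarrow> 'v \<Rightarrow>\<^sub>0 nat" where
  "mon S = (\<Sum>v\<in>S. Poly_Mapping.single v 1)"

lemma lookup_mon: "Poly_Mapping.lookup (mon S) v = (if v \<in> S then 1 else 0)"
proof -
  have "Poly_Mapping.lookup (mon S) v = (\<Sum>u\<in>S. if u = v then 1 else 0)"
    unfolding mon_def lookup_sum by (intro sum.cong refl) (simp add: lookup_single when_def)
  then show ?thesis by simp
qed

text \<open>Divisibility by a squarefree monomial is containment in the support, and exactly then
  the truncated subtraction of exponents can be undone.\<close>

lemma eq_mon_add: "x = mon S + q \<longleftrightarrow> S \<subseteq> Poly_Mapping.keys x \<and> q = x - mon S"
proof
  assume x: "x = mon S + q"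
  have "S \<subseteq> Poly_Mapping.keys x"
    unfolding x by (auto simp: in_keys_iff lookup_add lookup_mon)
  moreover have "q = x - mon S" unfolding x by (rule poly_mapping_eqI) (simp add: lookup_minus lookup_add)
  ultimately show "S \<subseteq> Poly_Mapping.keys x \<and> q = x - mon S" by simp
next
  assume a: "S \<subseteq> Poly_Mapping.keys x \<and> q = x - mon S"
  show "x = mon S + q"
  proof (rule poly_mapping_eqI)
    fix v
    have "v \<in> S \<Longrightarrow> Poly_Mapping.lookup x v \<noteq> 0" using a by (auto simp: in_keys_iff)
    then show "Poly_Mapping.lookup x v = Poly_Mapping.lookup (mon S + q) v"
      using a by (auto simp: lookup_add lookup_minus lookup_mon)
  qed
qed

lemma lookup_mon_mult:
  fixes p :: "('v::finite, 'k::field) polynomials"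
  shows "Poly_Mapping.lookup (Poly_Mapping.single (mon S) c * p) x =
    (if S \<subseteq> Poly_Mapping.keys x then c * Poly_Mapping.lookup p (x - mon S) else 0)"
proof -
  have "Poly_Mapping.lookup (Poly_Mapping.single (mon S) c * p) x =
    (\<Sum>l. Poly_Mapping.lookup (Poly_Mapping.single (mon S) c) l * (\<Sum>q. Poly_Mapping.lookup p q when x = l + q))"
    by (rule lookup_mult)
  also have "\<dots> = (\<Sum>l. c * (\<Sum>q. Poly_Mapping.lookup p q when x = mon S + q) when mon S = l)"
    by (rule Sum_any.cong) (simp add: lookup_single when_def)
  also have "\<dots> = c * (\<Sum>q. Poly_Mapping.lookup p q when x = mon S + q)" by simp
  also have "(\<Sum>q. Poly_Mapping.lookup p q when x = mon S + q) = (if S \<subseteq> Poly_Mapping.keys x then Poly_Mapping.lookup p (x - mon S) else 0)"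
    unfolding eq_mon_add by simp
  finally show ?thesis by simp
qed

definition mono_ideal :: "('v::finite) set set \<Rightarrow> ('v, 'k::field) polynomials set" where
  "mono_ideal J = {p. \<forall>a\<in>Poly_Mapping.keys p. Poly_Mapping.keys a \<in> J}"

lemma mono_idealI: "(\<And>a. Poly_Mapping.lookup p a \<noteq> 0 \<Longrightarrow> Poly_Mapping.keys a \<in> J) \<Longrightarrow> p \<in> mono_ideal J"
  unfolding mono_ideal_def by (simp add: in_keys_iff)

lemma mono_idealD: "p \<in> mono_ideal J \<Longrightarrow> Poly_Mapping.lookup p a \<noteq> 0 \<Longrightarrow> Poly_Mapping.keys a \<in> J"
  unfolding mono_ideal_def by (simp add: in_keys_iff)

lemma rmod_regular: "rmod (regular_module :: ('r::comm_ring_1, 'r) module)"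
  by (rule rmodI) (simp_all add: regular_module_def algebra_simps)

lemma mono_ideal_add: "p \<in> mono_ideal J \<Longrightarrow> q \<in> mono_ideal J \<Longrightarrow> p + q \<in> mono_ideal J"
proof (rule mono_idealI)
  fix a assume pq: "p \<in> mono_ideal J" "q \<in> mono_ideal J" "Poly_Mapping.lookup (p + q) a \<noteq> 0"
  then have "Poly_Mapping.lookup p a \<noteq> 0 \<or> Poly_Mapping.lookup q a \<noteq> 0" by (auto simp: lookup_add)
  then show "Poly_Mapping.keys a \<in> J" using mono_idealD[OF pq(1)] mono_idealD[OF pq(2)] by blast
qed

lemma mono_ideal_mult:
  fixes p q :: "('v::finite, 'k::field) polynomials"
  assumes J: "up_closed J" and q: "q \<in> mono_ideal J"
  shows "p * q \<in> mono_ideal J"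
proof -
  have "Poly_Mapping.keys c \<in> J" if "c \<in> Poly_Mapping.keys (p * q)" for c
  proof -
    have "c \<in> {a + b | a b. a \<in> Poly_Mapping.keys p \<and> b \<in> Poly_Mapping.keys q}" using keys_mult that by blast
    then obtain a b where ab: "c = a + b" "b \<in> Poly_Mapping.keys q" by blast
    have "Poly_Mapping.keys b \<subseteq> Poly_Mapping.keys c" unfolding ab(1) by (auto simp: in_keys_iff lookup_add)
    moreover have "Poly_Mapping.keys b \<in> J" using q ab(2) unfolding mono_ideal_def by blast
    ultimately show ?thesis using up_closedD[OF J] by blast
  qed
  then show ?thesis unfolding mono_ideal_def by blast
qed

lemma mono_ideal_uminus: "p \<in> mono_ideal J \<Longrightarrow> - p \<in> mono_ideal J"
  unfolding mono_ideal_def by (simp add: in_keys_iff)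

lemma zero_mono_ideal: "0 \<in> mono_ideal J"
  unfolding mono_ideal_def by simp

lemma rsub_mono_ideal: "up_closed J \<Longrightarrow> rsub regular_module (mono_ideal J)"
  unfolding rsub_def by (simp add: regular_module_def zero_mono_ideal mono_ideal_add mono_ideal_mult)

section \<open>The polynomial complex and its multigraded strands\<close>

locale graded_complex =
  fixes J :: "('v::finite) set set" and G :: "'v gen set" and D :: "'v gen \<Rightarrow> 'v gen \<Rightarrow> 'k::field"
  assumes res: "lres J G D" and up: "up_closed J"
begin

definition gens :: "nat \<Rightarrow> 'v gen set" where "gens i = {g \<in> G. hdeg g = i}"
definition rk :: "nat \<Rightarrow> nat" where "rk i = card (gens i)"
definition en :: "nat \<Rightarrow> nat \<Rightarrow> 'v gen" where "en i = (SOME e. bij_betw e {..<rk i} (gens i))"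
definition idx :: "nat \<Rightarrow> 'v gen \<Rightarrow> nat" where "idx i = inv_into {..<rk i} (en i)"

lemma en: "bij_betw (en i) {..<rk i} (gens i)"
proof -
  have "finite (gens i)" by simp
  then have "\<exists>e. bij_betw e {..<rk i} (gens i)"
    using ex_bij_betw_nat_finite[of "gens i"] unfolding rk_def by (simp add: atLeast0LessThan)
  then show ?thesis unfolding en_def by (rule someI_ex)
qed

lemma en_mem: "k < rk i \<Longrightarrow> en i k \<in> gens i"
  using en[of i] unfolding bij_betw_def by blast

lemma idx_en: "k < rk i \<Longrightarrow> idx i (en i k) = k"
  unfolding idx_def using en[of i] by (simp add: bij_betw_def inv_into_f_f)

lemma en_idx: "g \<in> gens i \<Longrightarrow> en i (idx i g) = g"
  unfolding idx_def using en[of i] by (metis bij_betw_def f_inv_into_f)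

lemma idx_less: "g \<in> gens i \<Longrightarrow> idx i g < rk i"
  unfolding idx_def using en[of i] by (metis bij_betw_def inv_into_into lessThan_iff)

lemma sum_en: "(\<Sum>k\<in>{0..<rk i}. F (en i k)) = (\<Sum>g\<in>gens i. F g)"
  by (rule sum.reindex_bij_betw) (use en[of i] in \<open>simp add: atLeast0LessThan\<close>)

definition dmat :: "nat \<Rightarrow> ('v, 'k) polynomials mat" where
  "dmat i = mat (rk i) (rk (Suc i)) (\<lambda>(l, k).
     Poly_Mapping.single (mon (lab (en (Suc i) k) - lab (en i l))) (D (en i l) (en (Suc i) k)))"

definition cf :: "nat \<Rightarrow> ('v, 'k) polynomials vec \<Rightarrow> 'v gen \<Rightarrow> ('v, 'k) polynomials" where
  "cf i v g = (if g \<in> gens i then v $ idx i g else 0)"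

text \<open>The component of \<open>v\<close> in multidegree \<open>a\<close>: its coordinate at
  \<open>g\<close> is the coefficient of the monomial of degree \<open>a\<close> minus the label.
  All labels are squarefree, so which generators take part depends only on the support of
  \<open>a\<close>; this is why exactness in squarefree degrees suffices.\<close>

definition strand :: "nat \<Rightarrow> ('v, 'k) polynomials vec \<Rightarrow> ('v \<Rightarrow>\<^sub>0 nat) \<Rightarrow> 'v gen \<Rightarrow> 'k" where
  "strand i v a g = (if lab g \<subseteq> Poly_Mapping.keys a then Poly_Mapping.lookup (cf i v g) (a - mon (lab g)) else 0)"

definition ev :: "('v, 'k) polynomials vec \<Rightarrow> ('v, 'k) polynomials" where
  "ev v = (\<Sum>g\<in>gens 0. Poly_Mapping.single (mon (lab g)) 1 * cf 0 v g)"

lemma dmat_carrier: "dmat i \<in> carrier_mat (rk i) (rk (Suc i))"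
  unfolding dmat_def by simp

lemma strand_gens: "strand i v a g \<noteq> 0 \<Longrightarrow> g \<in> gens i"
  unfolding strand_def cf_def by (auto split: if_splits)

lemma strand_supp: "supp_in G (Poly_Mapping.keys a) (strand i v a)"
  unfolding supp_in_def
proof (intro allI impI)
  fix g assume s: "strand i v a g \<noteq> 0"
  then have "g \<in> gens i" by (rule strand_gens)
  then show "g \<in> G \<and> lab g \<subseteq> Poly_Mapping.keys a" using s unfolding strand_def gens_def by (simp split: if_splits)
qed

text \<open>Each coefficient is visible in some strand: the one at exponent \<open>c\<close> of
  coordinate \<open>g\<close> appears in degree \<open>mon (lab g) + c\<close>.\<close>

lemma strand_inject:
  assumes v: "v \<in> carrier_vec (rk i)" "w \<in> carrier_vec (rk i)" and eq: "\<And>a. strand i v a = strand i w a"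
  shows "v = w"
proof (rule eq_vecI)
  fix k assume "k < dim_vec w"
  then have k: "k < rk i" using v by simp
  let ?g = "en i k"
  have g: "?g \<in> gens i" by (rule en_mem[OF k])
  have "Poly_Mapping.lookup (u $ k) c = strand i u (mon (lab ?g) + c) ?g" for c u
  proof -
    have "lab ?g \<subseteq> Poly_Mapping.keys (mon (lab ?g) + c) \<and> c = (mon (lab ?g) + c) - mon (lab ?g)"
      by (rule iffD1[OF eq_mon_add]) (rule refl)
    then show ?thesis unfolding strand_def cf_def using g idx_en[OF k] by simp
  qed
  then show "v $ k = w $ k" using eq by (intro poly_mapping_eqI) simp
qed (use v in auto)

lemma cf_dmat:
  assumes v: "v \<in> carrier_vec (rk (Suc i))" and h: "h \<in> gens i"
  shows "cf i (dmat i *\<^sub>v v) h = (\<Sum>g\<in>gens (Suc i). Poly_Mapping.single (mon (lab g - lab h)) (D h g) * cf (Suc i) v g)"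
proof -
  have "cf i (dmat i *\<^sub>v v) h = (\<Sum>k\<in>{0..<rk (Suc i)}. dmat i $$ (idx i h, k) * v $ k)"
    using h idx_less[OF h] dmat_carrier[of i] v unfolding cf_def by (simp add: scalar_prod_def)
  also have "\<dots> = (\<Sum>k\<in>{0..<rk (Suc i)}. Poly_Mapping.single (mon (lab (en (Suc i) k) - lab h)) (D h (en (Suc i) k)) * cf (Suc i) v (en (Suc i) k))"
    by (rule sum.cong) (use idx_less[OF h] in \<open>auto simp: dmat_def en_idx[OF h] cf_def en_mem idx_en\<close>)
  also have "\<dots> = (\<Sum>g\<in>gens (Suc i). Poly_Mapping.single (mon (lab g - lab h)) (D h g) * cf (Suc i) v g)"
    by (rule sum_en)
  finally show ?thesis .
qed

text \<open>The matrix is homogeneous. In degree \<open>a\<close>, the monomial in an entry merely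
  accounts for the difference of the two labels, so only the scalar \<open>D h g\<close>
  acts.\<close>

lemma strand_dmat:
  assumes v: "v \<in> carrier_vec (rk (Suc i))"
  shows "strand i (dmat i *\<^sub>v v) a = bd D (strand (Suc i) v a)"
proof
  fix h
  note Dz = lresD[OF res]
  have bdG: "bd D (strand (Suc i) v a) h = (\<Sum>g\<in>gens (Suc i). D h g * strand (Suc i) v a g)"
    unfolding bd_def by (rule sum.mono_neutral_right) (use strand_gens[of "Suc i" v a] in \<open>auto\<close>)
  show "strand i (dmat i *\<^sub>v v) a h = bd D (strand (Suc i) v a) h"
  proof (cases "h \<in> gens i \<and> lab h \<subseteq> Poly_Mapping.keys a")
    case False
    have "D h g * strand (Suc i) v a g = 0" if g: "g \<in> gens (Suc i)" for g
    proof (rule ccontr)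
      assume "D h g * strand (Suc i) v a g \<noteq> 0"
      then have nz: "D h g \<noteq> 0" "strand (Suc i) v a g \<noteq> 0" by auto
      have "h \<in> gens i" using Dz(1,3)[OF nz(1)] g unfolding gens_def by simp
      moreover have "lab g \<subseteq> Poly_Mapping.keys a" using nz(2) unfolding strand_def by (simp split: if_splits)
      then have "lab h \<subseteq> Poly_Mapping.keys a" using Dz(4)[OF nz(1)] by blast
      ultimately show False using False by blast
    qed
    moreover have "strand i (dmat i *\<^sub>v v) a h = 0" using False unfolding strand_def cf_def by auto
    ultimately show ?thesis unfolding bdG by simp
  next
    case True
    then have h: "h \<in> gens i" "lab h \<subseteq> Poly_Mapping.keys a" by simp_all
    have "strand i (dmat i *\<^sub>v v) a h = (\<Sum>g\<in>gens (Suc i).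
        Poly_Mapping.lookup (Poly_Mapping.single (mon (lab g - lab h)) (D h g) * cf (Suc i) v g) (a - mon (lab h)))"
      unfolding strand_def cf_dmat[OF v h(1)] lookup_sum using h(2) by simp
    also have "\<dots> = (\<Sum>g\<in>gens (Suc i). D h g * strand (Suc i) v a g)"
    proof (intro sum.cong refl)
      fix g assume "g \<in> gens (Suc i)"
      show "Poly_Mapping.lookup (Poly_Mapping.single (mon (lab g - lab h)) (D h g) * cf (Suc i) v g) (a - mon (lab h))
        = D h g * strand (Suc i) v a g"
      proof (cases "D h g = 0")
        case False
        then have sub: "lab h \<subseteq> lab g" by (rule Dz(4))
        have 1: "lab g - lab h \<subseteq> Poly_Mapping.keys (a - mon (lab h)) \<longleftrightarrow> lab g \<subseteq> Poly_Mapping.keys a"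
        proof -
          have "x \<in> Poly_Mapping.keys (a - mon (lab h)) \<longleftrightarrow> x \<in> Poly_Mapping.keys a" if "x \<notin> lab h" for x
            using that by (simp add: in_keys_iff lookup_minus lookup_mon)
          then show ?thesis using h(2) by blast
        qed
        have 2: "a - mon (lab h) - mon (lab g - lab h) = a - mon (lab g)"
          by (rule poly_mapping_eqI) (use sub in \<open>auto simp: lookup_minus lookup_mon\<close>)
        show ?thesis unfolding lookup_mon_mult 1 2 strand_def by simp
      qed simp
    qed
    finally show ?thesis unfolding bdG .
  qed
qed

lemma lookup_ev: "Poly_Mapping.lookup (ev v) a = aug (strand 0 v a)"
proof -
  have "Poly_Mapping.lookup (ev v) a = (\<Sum>g\<in>gens 0. strand 0 v a g)"
    unfolding ev_def lookup_sum lookup_mon_mult strand_def by (intro sum.cong refl) simp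
  also have "\<dots> = (\<Sum>g\<in>gens 0. if hdeg g = 0 then strand 0 v a g else 0)"
    by (intro sum.cong refl) (simp add: gens_def)
  also have "\<dots> = aug (strand 0 v a)"
    unfolding aug_def by (rule sum.mono_neutral_left) (use strand_gens[of 0 v a] in auto)
  finally show ?thesis .
qed

lemma finite_strand: "finite {a. strand i v a \<noteq> (\<lambda>_. 0)}"
proof (rule finite_subset)
  show "{a. strand i v a \<noteq> (\<lambda>_. 0)} \<subseteq> (\<Union>g\<in>UNIV. (\<lambda>c. mon (lab g) + c) ` Poly_Mapping.keys (cf i v g))"
  proof
    fix a assume "a \<in> {a. strand i v a \<noteq> (\<lambda>_. 0)}"
    then obtain g where "strand i v a g \<noteq> 0" by auto
    then have g: "lab g \<subseteq> Poly_Mapping.keys a" "Poly_Mapping.lookup (cf i v g) (a - mon (lab g)) \<noteq> 0"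
      unfolding strand_def by (simp_all split: if_splits)
    have "a = mon (lab g) + (a - mon (lab g))" using g(1) unfolding eq_mon_add by simp
    moreover have "a - mon (lab g) \<in> Poly_Mapping.keys (cf i v g)" using g(2) by (simp add: in_keys_iff)
    ultimately show "a \<in> (\<Union>g\<in>UNIV. (\<lambda>c. mon (lab g) + c) ` Poly_Mapping.keys (cf i v g))" by blast
  qed
qed simp

text \<open>Converse to taking strands: prescribed components in finitely many multidegrees come
  from a polynomial vector. Finiteness keeps each coordinate a polynomial.\<close>

lemma assemble:
  assumes A: "finite A" and w0: "\<And>a. a \<notin> A \<Longrightarrow> w a = (\<lambda>_. 0)"
    and w: "\<And>a. supp_in G (Poly_Mapping.keys a) (w a)" and deg: "\<And>a g. w a g \<noteq> 0 \<Longrightarrow> hdeg g = i"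
  shows "\<exists>v\<in>carrier_vec (rk i). \<forall>a. strand i v a = w a"
proof -
  define c where "c g = (\<Sum>a\<in>A. Poly_Mapping.single (a - mon (lab g)) (w a g))" for g
  define v where "v = vec (rk i) (\<lambda>k. c (en i k))"
  have vc: "v \<in> carrier_vec (rk i)" unfolding v_def by simp
  have sub: "lab g \<subseteq> Poly_Mapping.keys a" "g \<in> gens i" if "w a g \<noteq> 0" for a g
    using w[of a] deg[OF that] that unfolding supp_in_def gens_def by blast+
  have "strand i v a g = w a g" for a g
  proof (cases "g \<in> gens i \<and> lab g \<subseteq> Poly_Mapping.keys a")
    case False
    then have "strand i v a g = 0" unfolding strand_def cf_def by auto
    moreover have "w a g = 0" using sub[of a g] False by blast
    ultimately show ?thesis by simp
  next
    case True
    have "cf i v g = c g" unfolding cf_def v_def using True idx_less[of g i] en_idx[of g i] by simp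
    then have "strand i v a g = (\<Sum>a'\<in>A. Poly_Mapping.lookup (Poly_Mapping.single (a' - mon (lab g)) (w a' g)) (a - mon (lab g)))"
      unfolding strand_def using True by (simp add: c_def lookup_sum)
    also have "\<dots> = (\<Sum>a'\<in>A. if a' = a then w a g else 0)"
    proof (intro sum.cong refl)
      fix a'
      show "Poly_Mapping.lookup (Poly_Mapping.single (a' - mon (lab g)) (w a' g)) (a - mon (lab g)) = (if a' = a then w a g else 0)"
      proof (cases "w a' g = 0")
        case T: True then show ?thesis by auto
      next
        case F: False
        have "a' = mon (lab g) + (a' - mon (lab g))" using sub(1)[OF F] unfolding eq_mon_add by simp
        moreover have "a = mon (lab g) + (a - mon (lab g))" using True unfolding eq_mon_add by simp
        ultimately have "a' - mon (lab g) = a - mon (lab g) \<longleftrightarrow> a' = a" by metis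
        then show ?thesis by (simp add: lookup_single when_def)
      qed
    qed
    also have "\<dots> = w a g" using A w0[of a] by (cases "a \<in> A") simp_all
    finally show ?thesis .
  qed
  then have "strand i v a = w a" for a by (intro ext)
  then show ?thesis using vc by blast
qed

text \<open>Preimages are chosen separately in each multidegree and assembled. Choosing 0 wherever
  the strand of \<open>v\<close> is 0 leaves only finitely many nonzero choices.\<close>

lemma lift_strands:
  assumes v: "v \<in> carrier_vec (rk i)" and cyc: "\<And>a. bd D (strand i v a) = (\<lambda>_. 0)"
    and au: "\<And>a. Poly_Mapping.keys a \<notin> J \<Longrightarrow> aug (strand i v a) = 0"
  shows "v \<in> (\<lambda>u. dmat i *\<^sub>v u) ` carrier_vec (rk (Suc i))"
proof -
  note Dz = lresD[OF res]
  have "\<exists>w. supp_in G (Poly_Mapping.keys a) w \<and> (\<forall>g. w g \<noteq> 0 \<longrightarrow> hdeg g = Suc i) \<and> bd D w = strand i v a \<and>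
      (strand i v a = (\<lambda>_. 0) \<longrightarrow> w = (\<lambda>_. 0))" for a
  proof (cases "strand i v a = (\<lambda>_. 0)")
    case True
    have "bd D (\<lambda>_. 0) = (\<lambda>_. 0)" unfolding bd_def by simp
    then show ?thesis using True by (intro exI[of _ "\<lambda>_. 0"]) (simp add: supp_in_def)
  next
    case False
    obtain w where w: "supp_in G (Poly_Mapping.keys a) w" "bd D w = strand i v a"
      using Dz(8)[OF strand_supp cyc au] by blast
    \<comment> \<open>Exactness does not control homological degree, so the preimage is cut down to
      degree \<open>Suc i\<close>; its other components do not contribute in degree
      \<open>i\<close>.\<close>
    define w' where "w' g = (if hdeg g = Suc i then w g else 0)" for g
    have "bd D w' h = strand i v a h" for h
    proof (cases "hdeg h = i")
      case True
      have "bd D w' h = bd D w h" unfolding bd_def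
      proof (intro sum.cong refl)
        fix g show "D h g * w' g = D h g * w g"
          using Dz(3)[of h g] True unfolding w'_def by (cases "D h g = 0") simp_all
      qed
      then show ?thesis using w(2) by simp
    next
      case F: False
      have "D h g * w' g = 0" for g
        using Dz(3)[of h g] F unfolding w'_def by (cases "D h g = 0") simp_all
      then have "bd D w' h = 0" unfolding bd_def by simp
      moreover have "strand i v a h = 0" using strand_gens[of i v a h] F unfolding gens_def by blast
      ultimately show ?thesis by simp
    qed
    then have "bd D w' = strand i v a" by (rule ext)
    moreover have "supp_in G (Poly_Mapping.keys a) w'" using w(1) unfolding supp_in_def w'_def by simp
    ultimately show ?thesis using False by (intro exI[of _ w']) (simp add: w'_def)
  qed
  then have "\<forall>a. \<exists>w. supp_in G (Poly_Mapping.keys a) w \<and> (\<forall>g. w g \<noteq> 0 \<longrightarrow> hdeg g = Suc i) \<and> bd D w = strand i v a \<and>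
      (strand i v a = (\<lambda>_. 0) \<longrightarrow> w = (\<lambda>_. 0))" by (rule allI)
  from choice[OF this] obtain w where
    w: "\<forall>a. supp_in G (Poly_Mapping.keys a) (w a) \<and> (\<forall>g. w a g \<noteq> 0 \<longrightarrow> hdeg g = Suc i) \<and> bd D (w a) = strand i v a \<and>
      (strand i v a = (\<lambda>_. 0) \<longrightarrow> w a = (\<lambda>_. 0))" by (elim exE)
  have "\<exists>u\<in>carrier_vec (rk (Suc i)). \<forall>a. strand (Suc i) u a = w a"
    by (rule assemble[OF finite_strand[of i v]]) (use w in auto)
  then obtain u where u: "u \<in> carrier_vec (rk (Suc i))" "\<forall>a. strand (Suc i) u a = w a" by (elim bexE)
  have "dmat i *\<^sub>v u = v"
  proof (rule strand_inject[OF _ v])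
    show "dmat i *\<^sub>v u \<in> carrier_vec (rk i)" by (rule mult_mat_vec_carrier[OF dmat_carrier u(1)])
    fix a show "strand i (dmat i *\<^sub>v u) a = strand i v a"
      unfolding strand_dmat[OF u(1)] using u(2) w by simp
  qed
  then show ?thesis using u(1) by blast
qed

lemma aug_bd:
  assumes w: "supp_in G U w" and U: "U \<notin> J"
  shows "aug (bd D w) = 0"
proof -
  have "bd D w = (\<lambda>h. \<Sum>g\<in>UNIV. w g * D h g)" unfolding bd_def by (simp add: mult.commute)
  then have "aug (bd D w) = (\<Sum>g\<in>UNIV. w g * aug (\<lambda>h. D h g))"
    using aug_sum_smult[where A=UNIV and a=w and t="\<lambda>g h. D h g"] by simp
  also have "\<dots> = 0"
  proof (rule sum.neutral, intro ballI)
    fix g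
    show "w g * aug (\<lambda>h. D h g) = 0"
    proof (cases "w g = 0")
      case False
      then have "lab g \<subseteq> U" using w unfolding supp_in_def by blast
      then have "lab g \<notin> J" using U up_closedD[OF up, of "lab g" U] by blast
      then show ?thesis using lresD(6)[OF res] by simp
    qed simp
  qed
  finally show ?thesis .
qed

lemma cf_add: "v \<in> carrier_vec (rk i) \<Longrightarrow> w \<in> carrier_vec (rk i) \<Longrightarrow> cf i (v + w) g = cf i v g + cf i w g"
  unfolding cf_def using idx_less[of g i] by auto

lemma cf_smult: "v \<in> carrier_vec (rk i) \<Longrightarrow> cf i (a \<cdot>\<^sub>v v) g = a * cf i v g"
  unfolding cf_def using idx_less[of g i] by auto

abbreviation "I \<equiv> mono_ideal J :: ('v, 'k) polynomials set"

sublocale q: quotient regular_module I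
  by (rule quotient.intro[OF rmod_regular rsub_mono_ideal[OF up]])

definition eps :: "('v, 'k) polynomials vec \<Rightarrow> ('v, 'k) polynomials set" where
  "eps v = q.pr (ev v)"

lemma eps_rhom: "eps \<in> rhom (module_vec TYPE(('v, 'k) polynomials) (rk 0)) (quotient_module regular_module I)"
proof -
  have "ev \<in> rhom (module_vec TYPE(('v, 'k) polynomials) (rk 0)) regular_module"
  proof (rule rhomI; unfold module_vec_simps)
    fix x y :: "('v, 'k) polynomials vec" assume x: "x \<in> carrier_vec (rk 0)"
    show "ev x \<in> carrier regular_module" by (simp add: regular_module_def)
    show "ev (a \<cdot>\<^sub>v x) = a \<odot>\<^bsub>regular_module\<^esub> ev x" for a
      unfolding ev_def by (simp add: regular_module_def cf_smult[OF x] sum_distrib_left mult.left_commute)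
    assume y: "y \<in> carrier_vec (rk 0)"
    show "ev (x + y) = ev x \<oplus>\<^bsub>regular_module\<^esub> ev y"
      unfolding ev_def by (simp add: regular_module_def cf_add[OF x y] sum.distrib distrib_left)
  qed
  from rhom_comp[OF this q.pr_rhom] show ?thesis unfolding eps_def[abs_def] .
qed

lemma eps_zero_iff: "eps v = \<zero>\<^bsub>quotient_module regular_module I\<^esub> \<longleftrightarrow> ev v \<in> I"
  unfolding eps_def q.Q_zero by (rule q.pr_eq_N) (simp add: regular_module_def)

text \<open>Modulo the ideal only the coefficients in degrees outside \<open>J\<close> count, and
  there a chain of augmentation 1 can be scaled to the required coefficient.\<close>

lemma ev_surj: "\<exists>v\<in>carrier_vec (rk 0). ev v - p \<in> I"
proof -
  have "\<exists>w. supp_in G (Poly_Mapping.keys a) w \<and> (\<forall>g. w g \<noteq> 0 \<longrightarrow> hdeg g = 0) \<and>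
      (Poly_Mapping.keys a \<notin> J \<longrightarrow> aug w = Poly_Mapping.lookup p a) \<and> (a \<notin> Poly_Mapping.keys p \<longrightarrow> w = (\<lambda>_. 0))" for a
  proof (cases "a \<in> Poly_Mapping.keys p \<and> Poly_Mapping.keys a \<notin> J")
    case False
    then show ?thesis by (intro exI[of _ "\<lambda>_. 0"]) (auto simp: supp_in_def aug_def in_keys_iff)
  next
    case True
    obtain c where c: "supp_in G (Poly_Mapping.keys a) c" "aug c = (1::'k)"
      using lresD(7)[OF res, of "Poly_Mapping.keys a"] True by blast
    let ?w = "\<lambda>g. Poly_Mapping.lookup p a * (if hdeg g = 0 then c g else 0)"
    have "aug ?w = Poly_Mapping.lookup p a * aug c"
      unfolding aug_def sum_distrib_left by (intro sum.cong refl) simp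
    then show ?thesis using c True by (intro exI[of _ ?w]) (auto simp: supp_in_def)
  qed
  then have "\<forall>a. \<exists>w. supp_in G (Poly_Mapping.keys a) w \<and> (\<forall>g. w g \<noteq> 0 \<longrightarrow> hdeg g = 0) \<and>
      (Poly_Mapping.keys a \<notin> J \<longrightarrow> aug w = Poly_Mapping.lookup p a) \<and> (a \<notin> Poly_Mapping.keys p \<longrightarrow> w = (\<lambda>_. 0))" by (rule allI)
  from choice[OF this] obtain w where
    w: "\<forall>a. supp_in G (Poly_Mapping.keys a) (w a) \<and> (\<forall>g. w a g \<noteq> 0 \<longrightarrow> hdeg g = 0) \<and>
      (Poly_Mapping.keys a \<notin> J \<longrightarrow> aug (w a) = Poly_Mapping.lookup p a) \<and> (a \<notin> Poly_Mapping.keys p \<longrightarrow> w a = (\<lambda>_. 0))"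
    by (elim exE)
  have "\<exists>v\<in>carrier_vec (rk 0). \<forall>a. strand 0 v a = w a"
    by (rule assemble[of "Poly_Mapping.keys p"]) (use w in auto)
  then obtain v where v: "v \<in> carrier_vec (rk 0)" "\<forall>a. strand 0 v a = w a" by (elim bexE)
  have "ev v - p \<in> I"
  proof (rule mono_idealI, rule ccontr)
    fix a assume a: "Poly_Mapping.lookup (ev v - p) a \<noteq> 0" "Poly_Mapping.keys a \<notin> J"
    then show False using w v(2) by (simp add: lookup_minus lookup_ev)
  qed
  then show ?thesis using v(1) by blast
qed

theorem resolution: "free_resolution rk dmat eps (quotient_module regular_module I)"
  unfolding free_resolution_def is_resolution_def
proof (intro conjI allI)
  let ?V = "\<lambda>i. module_vec TYPE(('v, 'k) polynomials) (rk i)"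
  show "dmat i \<in> carrier_mat (rk i) (rk (Suc i))" for i by (rule dmat_carrier)
  show "rmod (?V i)" for i by (rule rmod_vec)
  show "(\<lambda>v. dmat i *\<^sub>v v) \<in> rhom (?V (Suc i)) (?V i)" for i by (rule mult_mat_vec_rhom[OF dmat_carrier])
  show "eps \<in> rhom (?V 0) (quotient_module regular_module I)" by (rule eps_rhom)
  note Dz = lresD[OF res]
  show "eps ` carrier (?V 0) = carrier (quotient_module regular_module I)"
  proof (intro subset_antisym subsetI)
    fix A assume "A \<in> eps ` carrier (?V 0)"
    then show "A \<in> carrier (quotient_module regular_module I)" using rhomD(1)[OF eps_rhom] by blast
  next
    fix A assume "A \<in> carrier (quotient_module regular_module I)"
    then obtain p where p: "A = q.pr p" unfolding q.Q_carrier by blast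
    obtain v where v: "v \<in> carrier_vec (rk 0)" "ev v - p \<in> I" using ev_surj by blast
    have "q.pr ((ev v - p) \<oplus>\<^bsub>regular_module\<^esub> p) = q.pr p"
      by (rule q.pr_add_N[OF v(2)]) (simp add: regular_module_def)
    then have "eps v = A" unfolding eps_def p by (simp add: regular_module_def)
    then show "A \<in> eps ` carrier (?V 0)" using v(1) by (auto simp: module_vec_simps)
  qed
  have deg0: "bd D (strand 0 v a) = (\<lambda>_. 0)" for v a
  proof
    fix h
    have "D h g * strand 0 v a g = 0" for g
      using Dz(3)[of h g] strand_gens[of 0 v a g] unfolding gens_def by (cases "D h g = 0") auto
    then show "bd D (strand 0 v a) h = 0" unfolding bd_def by simp
  qed
  have aug0: "aug (strand (Suc i) v a) = 0" for i v a
  proof -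
    have "(if hdeg g = 0 then strand (Suc i) v a g else 0) = 0" for g
      using strand_gens[of "Suc i" v a g] unfolding gens_def by (cases "strand (Suc i) v a g = 0") auto
    then show ?thesis unfolding aug_def using strand_gens[of "Suc i" v a] by (intro sum.neutral) (auto simp: gens_def)
  qed
  show "a_kernel (?V 0) (quotient_module regular_module I) eps = (\<lambda>v. dmat 0 *\<^sub>v v) ` carrier (?V 1)"
  proof (intro subset_antisym subsetI)
    fix v assume "v \<in> a_kernel (?V 0) (quotient_module regular_module I) eps"
    then have v: "v \<in> carrier_vec (rk 0)" "ev v \<in> I" unfolding a_kernel_iff eps_zero_iff by (simp_all add: module_vec_simps)
    have "v \<in> (\<lambda>u. dmat 0 *\<^sub>v u) ` carrier_vec (rk (Suc 0))"
    proof (rule lift_strands[OF v(1) deg0])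
      fix a :: "'v \<Rightarrow>\<^sub>0 nat" assume "Poly_Mapping.keys a \<notin> J"
      then show "aug (strand 0 v a) = 0" using mono_idealD[OF v(2), of a] unfolding lookup_ev by blast
    qed
    then show "v \<in> (\<lambda>v. dmat 0 *\<^sub>v v) ` carrier (?V 1)" by (simp add: module_vec_simps)
  next
    fix v assume "v \<in> (\<lambda>v. dmat 0 *\<^sub>v v) ` carrier (?V 1)"
    then obtain u where u: "u \<in> carrier_vec (rk (Suc 0))" "v = dmat 0 *\<^sub>v u" by (auto simp: module_vec_simps)
    have "ev v \<in> I"
    proof (rule mono_idealI, rule ccontr)
      fix a assume a: "Poly_Mapping.lookup (ev v) a \<noteq> 0" "Poly_Mapping.keys a \<notin> J"
      then show False unfolding lookup_ev u(2) strand_dmat[OF u(1)] using aug_bd[OF strand_supp a(2)] by blast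
    qed
    then show "v \<in> a_kernel (?V 0) (quotient_module regular_module I) eps"
      unfolding a_kernel_iff eps_zero_iff using u mult_mat_vec_carrier[OF dmat_carrier u(1)] by (simp add: module_vec_simps)
  qed
  fix i
  show "a_kernel (?V (Suc i)) (?V i) (\<lambda>v. dmat i *\<^sub>v v) = (\<lambda>v. dmat (Suc i) *\<^sub>v v) ` carrier (?V (Suc (Suc i)))"
  proof (intro subset_antisym subsetI)
    fix v assume "v \<in> a_kernel (?V (Suc i)) (?V i) (\<lambda>v. dmat i *\<^sub>v v)"
    then have v: "v \<in> carrier_vec (rk (Suc i))" "dmat i *\<^sub>v v = 0\<^sub>v (rk i)" unfolding a_kernel_iff by (simp_all add: module_vec_simps)
    have "v \<in> (\<lambda>u. dmat (Suc i) *\<^sub>v u) ` carrier_vec (rk (Suc (Suc i)))"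
    proof (rule lift_strands[OF v(1) _ aug0])
      fix a
      have "strand i (0\<^sub>v (rk i)) a g = 0" for g unfolding strand_def cf_def using idx_less[of g i] by simp
      then have "strand i (0\<^sub>v (rk i)) a = (\<lambda>_. 0)" by (rule ext)
      then show "bd D (strand (Suc i) v a) = (\<lambda>_. 0)" unfolding strand_dmat[OF v(1), symmetric] v(2) .
    qed
    then show "v \<in> (\<lambda>v. dmat (Suc i) *\<^sub>v v) ` carrier (?V (Suc (Suc i)))" by (simp add: module_vec_simps)
  next
    fix v assume "v \<in> (\<lambda>v. dmat (Suc i) *\<^sub>v v) ` carrier (?V (Suc (Suc i)))"
    then obtain u where u: "u \<in> carrier_vec (rk (Suc (Suc i)))" "v = dmat (Suc i) *\<^sub>v u" by (auto simp: module_vec_simps)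
    have v: "v \<in> carrier_vec (rk (Suc i))" unfolding u(2) by (rule mult_mat_vec_carrier[OF dmat_carrier u(1)])
    have "dmat i *\<^sub>v v = 0\<^sub>v (rk i)"
    proof (rule strand_inject)
      show "dmat i *\<^sub>v v \<in> carrier_vec (rk i)" by (rule mult_mat_vec_carrier[OF dmat_carrier v])
      show "0\<^sub>v (rk i) \<in> carrier_vec (rk i)" by simp
      fix a
      have "strand i (0\<^sub>v (rk i)) a g = 0" for g unfolding strand_def cf_def using idx_less[of g i] by simp
      then have "strand i (0\<^sub>v (rk i)) a = (\<lambda>_. 0)" by (rule ext)
      moreover have "strand i (dmat i *\<^sub>v v) a = bd D (strand (Suc i) v a)" by (rule strand_dmat[OF v])
      moreover have "strand (Suc i) v a = bd D (strand (Suc (Suc i)) u a)" unfolding u(2) by (rule strand_dmat[OF u(1)])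
      moreover have "bd D (bd D (strand (Suc (Suc i)) u a)) = (\<lambda>_. 0)" by (rule bd_bd[OF res])
      ultimately show "strand i (dmat i *\<^sub>v v) a = strand i (0\<^sub>v (rk i)) a" by simp
    qed
    then show "v \<in> a_kernel (?V (Suc i)) (?V i) (\<lambda>v. dmat i *\<^sub>v v)"
      unfolding a_kernel_iff using v by (simp add: module_vec_simps)
  qed
qed

text \<open>A nonzero entry between different labels carries a nontrivial monomial; entries between
  equal labels vanish by assumption.\<close>

lemma dmat_const:
  assumes "l < rk i" "k < rk (Suc i)" "\<forall>h. lab h = lab (en (Suc i) k) \<longrightarrow> D h (en (Suc i) k) = 0"
  shows "Poly_Mapping.lookup (dmat i $$ (l, k)) 0 = 0"
proof (cases "D (en i l) (en (Suc i) k) = 0")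
  case True
  then show ?thesis using assms(1,2) unfolding dmat_def by simp
next
  case False
  then have "lab (en i l) \<subseteq> lab (en (Suc i) k)" by (rule lresD(4)[OF res])
  moreover have "lab (en i l) \<noteq> lab (en (Suc i) k)" using False assms(3) by blast
  ultimately obtain x where x: "x \<in> lab (en (Suc i) k) - lab (en i l)" by blast
  have "mon (lab (en (Suc i) k) - lab (en i l)) \<noteq> 0"
  proof
    assume "mon (lab (en (Suc i) k) - lab (en i l)) = 0"
    then have "Poly_Mapping.lookup (mon (lab (en (Suc i) k) - lab (en i l))) x = 0" by simp
    then show False using x unfolding lookup_mon by simp
  qed
  then show ?thesis using assms(1,2) unfolding dmat_def by (simp add: lookup_single when_def)
qed

end

section \<open>The edge ideal as a monomial ideal, and the conclusion\<close>

lemma ideal_mono_ideal: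
  assumes J: "up_closed J"
  shows "ideal (mono_ideal J :: ('v::finite, 'k::field) polynomials set) class_ring"
proof (rule idealI)
  let ?R = "class_ring :: ('v, 'k) polynomials ring"
  show R: "ring ?R" by (rule class_ring.ring_axioms)
  have G: "Group.group (add_monoid ?R)" by (rule abelian_group.a_group[OF ring.is_abelian_group[OF R]])
  show "subgroup (mono_ideal J) (add_monoid ?R)"
  proof (rule group.subgroupI[OF G])
    fix a assume a: "a \<in> (mono_ideal J :: ('v, 'k) polynomials set)"
    have "inv\<^bsub>add_monoid ?R\<^esub> a = - a" by (rule group.inv_equality[OF G]) simp_all
    then show "inv\<^bsub>add_monoid ?R\<^esub> a \<in> mono_ideal J" using mono_ideal_uminus[OF a] by simp
  next
    show "mono_ideal J \<noteq> ({} :: ('v, 'k) polynomials set)" using zero_mono_ideal by blast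
  qed (simp_all add: mono_ideal_add)
  fix a x assume a: "a \<in> (mono_ideal J :: ('v, 'k) polynomials set)"
  show "x \<otimes>\<^bsub>?R\<^esub> a \<in> mono_ideal J" using mono_ideal_mult[OF J a, of x] by simp
  then show "a \<otimes>\<^bsub>?R\<^esub> x \<in> mono_ideal J" by (simp add: mult.commute[of a x])
qed

lemma poly_mapping_sum_single: "p = (\<Sum>a\<in>Poly_Mapping.keys p. Poly_Mapping.single a (Poly_Mapping.lookup p a))"
proof (rule poly_mapping_eqI)
  fix b
  show "Poly_Mapping.lookup p b = Poly_Mapping.lookup (\<Sum>a\<in>Poly_Mapping.keys p. Poly_Mapping.single a (Poly_Mapping.lookup p a)) b"
    by (simp add: lookup_sum lookup_single when_def in_keys_iff)
qed

lemma mon_pair: "u \<noteq> v \<Longrightarrow> var u * var v = Poly_Mapping.single (mon {u, v}) 1"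
  unfolding var_def mon_def by (simp add: mult_single)

context unmixed_bipartite
begin

lemma up_closed_edgeJ: "up_closed (edgeJ Q)"
  unfolding up_closed_def edgeJ_def by blast

text \<open>A monomial whose support contains both ends of an edge is a multiple of the
  corresponding generator, and a member of the monomial ideal is the sum of its terms.\<close>

lemma edge_ideal_eq: "edge_ideal E = (mono_ideal (edgeJ UNIV) :: ('n vertex, 'k::field) polynomials set)"
proof (rule subset_antisym)
  let ?R = "class_ring :: ('n vertex, 'k) polynomials ring"
  let ?S = "{var u * var v | u v. {u, v} \<in> E} :: ('n vertex, 'k) polynomials set"
  have S: "?S \<subseteq> mono_ideal (edgeJ UNIV)"
  proof (rule subsetI)
    fix p assume "p \<in> ?S"
    then obtain u v where p: "p = var u * var v" "{u, v} \<in> E" by blast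
    obtain i j where ij: "{u, v} = {X i, Y j}" "le i j" using p(2) by (rule edge_cases)
    have "u \<noteq> v" using ij(1) by auto
    then have "p = Poly_Mapping.single (mon {X i, Y j}) 1" unfolding p(1) ij(1)[symmetric] by (rule mon_pair)
    then have "Poly_Mapping.keys p \<subseteq> {mon {X i, Y j}}" by simp
    moreover have "Poly_Mapping.keys (mon {X i, Y j}) \<in> edgeJ UNIV"
      unfolding edgeJ_def using ij(2) by (auto simp: in_keys_iff lookup_mon)
    ultimately show "p \<in> mono_ideal (edgeJ UNIV)" unfolding mono_ideal_def by blast
  qed
  have id: "ideal (mono_ideal (edgeJ UNIV)) ?R" by (rule ideal_mono_ideal[OF up_closed_edgeJ])
  show "edge_ideal E \<subseteq> (mono_ideal (edgeJ UNIV) :: ('n vertex, 'k) polynomials set)"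
    unfolding edge_ideal_def genideal_def using id S by blast
  show "(mono_ideal (edgeJ UNIV) :: ('n vertex, 'k) polynomials set) \<subseteq> edge_ideal E"
    unfolding edge_ideal_def genideal_def
  proof (intro subsetI InterI, elim CollectE conjE)
    fix p :: "('n vertex, 'k) polynomials" and I
    assume p: "p \<in> mono_ideal (edgeJ UNIV)" and I: "ideal I ?R" and SI: "?S \<subseteq> I"
    interpret I: ideal I ?R by (rule I)
    have mult: "a * b \<in> I" if "b \<in> I" for a b
      using I.I_l_closed[OF that, of a] by simp
    have add: "a + b \<in> I" if "a \<in> I" "b \<in> I" for a b
      using I.a_closed[OF that] by simp
    have zero: "0 \<in> I" using I.zero_closed by simp
    have sum: "(\<Sum>x\<in>A. f x) \<in> I" if "\<And>x. x \<in> A \<Longrightarrow> f x \<in> I" for A and f :: "('n vertex \<Rightarrow>\<^sub>0 nat) \<Rightarrow> ('n vertex, 'k) polynomials"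
      using that by (induction A rule: infinite_finite_induct) (simp_all add: zero add)
    have "Poly_Mapping.single a c \<in> I" if a: "a \<in> Poly_Mapping.keys p" for a c
    proof -
      obtain i j where ij: "le i j" "X i \<in> Poly_Mapping.keys a" "Y j \<in> Poly_Mapping.keys a"
        using p a unfolding mono_ideal_def edgeJ_def by blast
      have "(a - mon {X i, Y j}) + mon {X i, Y j} = a"
        using eq_mon_add[of a "{X i, Y j}" "a - mon {X i, Y j}"] ij(2,3) by (simp add: add.commute)
      then have "Poly_Mapping.single a c = Poly_Mapping.single (a - mon {X i, Y j}) c * Poly_Mapping.single (mon {X i, Y j}) 1"
        by (simp add: mult_single)
      also have "\<dots> = Poly_Mapping.single (a - mon {X i, Y j}) c * (var (X i) * var (Y j))"
        by (simp add: mon_pair)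
      also have "\<dots> \<in> I" 
      proof (rule mult)
        have "var (X i) * var (Y j) \<in> ?S" using ij(1) unfolding le_def by blast
        then show "var (X i) * var (Y j) \<in> I" by (rule subsetD[OF SI])
      qed
      finally show ?thesis .
    qed
    then have "(\<Sum>a\<in>Poly_Mapping.keys p. Poly_Mapping.single a (Poly_Mapping.lookup p a)) \<in> I" by (rule sum)
    then show "p \<in> I" unfolding poly_mapping_sum_single[of p, symmetric] .
  qed
qed

end

theorem corollary1p9:
  fixes E :: "('n::finite) vertex set set"
    and I :: "('n vertex, 'k::field) polynomials set"
  assumes "simple_graph UNIV E"
    and "no_isolated_vertices UNIV E"
    and "is_bipartition UNIV E (range X) (range Y)"
    and "\<forall>i. {X i, Y i} \<in> E"
    and "unmixed UNIV E"
    and "I = edge_ideal E"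
  shows "last_betti (quotient_module regular_module I) \<ge> card (B_set E)"
proof (cases "B_set E = {}")
  case False
  interpret unmixed_bipartite E using assms(1-5) by unfold_locales
  obtain s G S and D :: "'n vertex gen \<Rightarrow> 'n vertex gen \<Rightarrow> 'k" where
    G: "lres (edgeJ UNIV) G D" "\<forall>g\<in>G. hdeg g \<le> s" "0 < s"
    and S: "S \<subseteq> G" "card S = card (B_set E)" "\<forall>g\<in>S. hdeg g = s \<and> (\<forall>h. lab h = lab g \<longrightarrow> D h g = 0)"
    by (rule top_generators[OF False])
  obtain j where j: "s = Suc j" using G(3) gr0_implies_Suc by blast
  interpret C: graded_complex "edgeJ UNIV" G D using G(1) up_closed_edgeJ by unfold_locales
  have I: "I = mono_ideal (edgeJ UNIV)" unfolding assms(6) by (rule edge_ideal_eq)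
  have Sg: "S \<subseteq> C.gens (Suc j)" 
  proof
    fix g assume g: "g \<in> S"
    then show "g \<in> C.gens (Suc j)" using subsetD[OF S(1) g] bspec[OF S(3) g] unfolding C.gens_def j by simp
  qed
  \<comment> \<open>Generators are turned into column indices of the last differential; the
    injectivity keeps their number equal to \<open>card (B_set E)\<close>.\<close>
  have inj: "inj_on (C.idx (Suc j)) S"
  proof (rule inj_onI)
    fix g h assume gh: "g \<in> S" "h \<in> S" and e: "C.idx (Suc j) g = C.idx (Suc j) h"
    have "g = C.en (Suc j) (C.idx (Suc j) g)" using C.en_idx[OF subsetD[OF Sg gh(1)]] by simp
    also have "\<dots> = h" unfolding e by (rule C.en_idx[OF subsetD[OF Sg gh(2)]])
    finally show "g = h" .
  qed
  have "card (B_set E) = card (C.idx (Suc j) ` S)" using card_image[OF inj] S(2) by simp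
  also have "\<dots> \<le> last_betti (quotient_module regular_module I)"
  proof (rule last_betti_ge)
    show "rmod (quotient_module regular_module I)" unfolding I by (rule C.q.rmod_Q)
    show "free_resolution C.rk C.dmat C.eps (quotient_module regular_module I)" unfolding I by (rule C.resolution)
    show "C.rk i = 0" if "i > Suc j" for i
    proof -
      have "C.gens i = {}" using G(2) that unfolding C.gens_def j by fastforce
      then show ?thesis unfolding C.rk_def by simp
    qed
    show "C.idx (Suc j) ` S \<subseteq> {..<C.rk (Suc j)}" 
    proof (rule image_subsetI)
      fix g assume "g \<in> S"
      then show "C.idx (Suc j) g \<in> {..<C.rk (Suc j)}" using C.idx_less[OF subsetD[OF Sg]] by simp
    qed
    have "S \<noteq> {}" using S(2) False by (metis card_0_eq card.empty finite)
    then show "C.idx (Suc j) ` S \<noteq> {}" by simp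
  next
    fix l k assume l: "l < C.rk j" and "k \<in> C.idx (Suc j) ` S"
    then obtain g where g: "g \<in> S" "k = C.idx (Suc j) g" by blast
    have gg: "g \<in> C.gens (Suc j)" by (rule subsetD[OF Sg g(1)])
    show "Poly_Mapping.lookup (C.dmat j $$ (l, k)) 0 = 0"
    proof (rule C.dmat_const[OF l])
      show "k < C.rk (Suc j)" unfolding g(2) by (rule C.idx_less[OF gg])
      show "\<forall>h. lab h = lab (C.en (Suc j) k) \<longrightarrow> D h (C.en (Suc j) k) = 0"
        unfolding g(2) C.en_idx[OF gg] by (rule bspec[OF S(3) g(1), THEN conjunct2])
    qed
  qed
  finally show ?thesis .
qed simp

end
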